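(* Let $G$ be a finitely generated group for which the family of all non-singleton connected components of the Morse boundary $\partial_* G$ is point-convergent. Then for any finitely generated group $G'$ which is quasi-isometric to $G$, we have $(\partial_* H',G') = C'$ for every non-singleton connected component $C'\subset \partial_* G'$ and its stabiliser $H'\leq G'$ (under the action of $G'$ on $\partial_* G'$).
   Context: Morse gauges and Morse quasi-geodesics. A Morse gauge is a function $M:\mathbb{R}_{\geq 1}\times\mathbb{R}_{\geq 0}\to\mathbb{R}_{\geq 0}$ that is increasing and continuous in the second coordinate. A quasi-geodesic $\gamma$ in a geodesic metric space is $M$-Morse if for all $s\le t$ and all $q\geq 1,Q\geq 0$, every $(q,Q)$-quasi-geodesic with endpoints $\gamma(s),\gamma(t)$ stays in the closed $M(q,Q)$-neighbourhood of $\gamma[s,t]$; it is Morse if it is $M$-Morse for some Morse gauge $M$. Put $\delta_M=\max\{4M(1,2M(5,0))+2M(5,0),\,8M(3,0)\}$. Morse boundary. Let $(X,d)$ be a proper geodesic metric space with basepoint $e$. For a Morse gauge $N$, $\partial_e^N X$ is the set of $N$-Morse geodesic rays $\gamma:[0,\infty)\to X$ starting at $e$, modulo bounded Hausdorff distance, with topology given by the neighbourhood bases $U_k^N(\gamma)_e=\{[\gamma'] \mid d(\gamma(t),\gamma'(t))\le\delta_N \text{ for all } t\le k\}$. The Morse boundary $\partial_* X$ is the direct limit $\varinjlim_M \partial_e^M X$ over all Morse gauges (ordered pointwise), with the direct limit topology; it does not depend on $e$ as a topological space. A Morse (quasi-)geodesic ray $\gamma$ with any starting point represents a point $[\gamma]=\gamma^+\in\partial_*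 X$, namely the class of Morse geodesic rays from $e$ at bounded Hausdorff distance from $\gamma$. Groups. For a finitely generated group $G$ with finite generating set $S$, let $X=\mathrm{Cay}(G,S)$ (with vertex set $G$) and $\partial_* G:=\partial_* X$. The left multiplication action of $G$ on $X$ induces an action on $\partial_* G$ by $g\cdot[\gamma]=[g\gamma]$; it permutes the connected components. Relative Morse boundary. For a subset $Y\subset X$, the relative Morse boundary $(\partial_* Y,X)$ is the set of all $\gamma^+\in\partial_* X$, $\gamma$ a Morse geodesic ray, such that $\gamma$ is contained in the $k$-neighbourhood of $Y$ for some $k$; it carries the subspace topology. For $H\le G$, viewed as a set of vertices of $X$, one writes $(\partial_* H,G)$ for $(\partial_* H,X)$. Point-convergence. For a sequence $(A_n)_{n\in\mathbb{N}}$ of subsets of a topological space $Y$, $\lim_{n\to\infty}A_n$ is the set of points $x\in Y$ that can be written as $x=\lim_{n\to\infty}x_n$ with $x_n\in A_n$. A family of subsets of $Y$ is point-convergent if for every sequence $(A_n)_{n\in\mathbb{N}}$ of distinct elements of the family, $|\lim_{n\to\infty}A_n|\le 1$. *)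

theory Defs
  imports "HOL-Analysis.Analysis" "HOL-Algebra.Generated_Groups" "HOL-Algebra.Group_Action"
begin

section \<open>Coarse geometry of metric spaces\<close>

text \<open>The points at distance at most \<open>r\<close> from \<open>A\<close>, where the distance to \<open>A\<close> is the infimum
  of the distances to its points. The empty set is infinitely far away from everything.\<close>

definition closed_nbhd :: "'p metric \<Rightarrow> real \<Rightarrow> 'p set \<Rightarrow> 'p set" where
  "closed_nbhd X r A = {x \<in> mspace X. A \<noteq> {} \<and> (INF a\<in>A. mdist X x a) \<le> r}"

definition hausdorff_close :: "'p metric \<Rightarrow> 'p set \<Rightarrow> 'p set \<Rightarrow> bool" where
  "hausdorff_close X A B \<longleftrightarrow> (\<exists>K. A \<subseteq> closed_nbhd X K B \<and> B \<subseteq> closed_nbhd X K A)"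

text \<open>Quasi-geodesics are not required to be continuous.\<close>

definition quasi_geodesic :: "'p metric \<Rightarrow> real \<Rightarrow> real \<Rightarrow> real set \<Rightarrow> (real \<Rightarrow> 'p) \<Rightarrow> bool" where
  "quasi_geodesic X q Q I \<gamma> \<longleftrightarrow>
     \<gamma> \<in> I \<rightarrow> mspace X \<and>
     (\<forall>s\<in>I. \<forall>t\<in>I. \<bar>s - t\<bar> / q - Q \<le> mdist X (\<gamma> s) (\<gamma> t) \<and> mdist X (\<gamma> s) (\<gamma> t) \<le> q * \<bar>s - t\<bar> + Q)"

text \<open>The values of a ray at negative arguments are irrelevant everywhere below.\<close>

definition geodesic_ray :: "'p metric \<Rightarrow> (real \<Rightarrow> 'p) \<Rightarrow> bool" where
  "geodesic_ray X \<gamma> \<longleftrightarrow>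
     \<gamma> \<in> {0..} \<rightarrow> mspace X \<and> (\<forall>s\<ge>0. \<forall>t\<ge>0. mdist X (\<gamma> s) (\<gamma> t) = \<bar>s - t\<bar>)"

definition quasi_isometric :: "'p metric \<Rightarrow> 'q metric \<Rightarrow> bool" where
  "quasi_isometric X Y \<longleftrightarrow>
     (\<exists>f q Q. q \<ge> 1 \<and> Q \<ge> 0 \<and> f \<in> mspace X \<rightarrow> mspace Y \<and>
        (\<forall>x\<in>mspace X. \<forall>y\<in>mspace X.
           mdist X x y / q - Q \<le> mdist Y (f x) (f y) \<and> mdist Y (f x) (f y) \<le> q * mdist X x y + Q) \<and>
        (\<forall>y\<in>mspace Y. \<exists>x\<in>mspace X. mdist Y (f x) y \<le> Q))"


section \<open>The Morse boundary\<close>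

text \<open>A Morse gauge is a function on \<open>[1,\<infinity>) \<times> [0,\<infinity>)\<close>; its values elsewhere are irrelevant.\<close>

definition morse_gauge :: "(real \<Rightarrow> real \<Rightarrow> real) \<Rightarrow> bool" where
  "morse_gauge M \<longleftrightarrow>
     (\<forall>q\<ge>1. (\<forall>Q\<ge>0. 0 \<le> M q Q) \<and> mono_on {0..} (M q) \<and> continuous_on {0..} (M q))"

definition morse_delta :: "(real \<Rightarrow> real \<Rightarrow> real) \<Rightarrow> real" where
  "morse_delta M = max (4 * M 1 (2 * M 5 0) + 2 * M 5 0) (8 * M 3 0)"

definition is_morse :: "'p metric \<Rightarrow> (real \<Rightarrow> real \<Rightarrow> real) \<Rightarrow> real set \<Rightarrow> (real \<Rightarrow> 'p) \<Rightarrow> bool" where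
  "is_morse X M I \<gamma> \<longleftrightarrow>
     (\<forall>s\<in>I. \<forall>t\<in>I. s \<le> t \<longrightarrow>
       (\<forall>q\<ge>1. \<forall>Q\<ge>0. \<forall>a b \<eta>. a \<le> b \<and> quasi_geodesic X q Q {a..b} \<eta> \<and> \<eta> a = \<gamma> s \<and> \<eta> b = \<gamma> t \<longrightarrow>
          \<eta> ` {a..b} \<subseteq> closed_nbhd X (M q Q) (\<gamma> ` {s..t})))"

definition morse_geodesic_ray :: "'p metric \<Rightarrow> (real \<Rightarrow> 'p) \<Rightarrow> bool" where
  "morse_geodesic_ray X \<gamma> \<longleftrightarrow> geodesic_ray X \<gamma> \<and> (\<exists>M. morse_gauge M \<and> is_morse X M {0..} \<gamma>)"

definition morse_rays :: "'p metric \<Rightarrow> 'p \<Rightarrow> (real \<Rightarrow> real \<Rightarrow> real) \<Rightarrow> (real \<Rightarrow> 'p) set" where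
  "morse_rays X e N = {\<gamma>. geodesic_ray X \<gamma> \<and> \<gamma> 0 = e \<and> is_morse X N {0..} \<gamma>}"

text \<open>The point \<open>\<gamma>\<^sup>+ = [\<gamma>]\<close> of the Morse boundary; \<open>\<gamma>\<close> may start anywhere.\<close>

definition morse_class :: "'p metric \<Rightarrow> 'p \<Rightarrow> (real \<Rightarrow> 'p) \<Rightarrow> (real \<Rightarrow> 'p) set" where
  "morse_class X e \<gamma> =
     {\<gamma>'. morse_geodesic_ray X \<gamma>' \<and> \<gamma>' 0 = e \<and> hausdorff_close X (\<gamma>' ` {0..}) (\<gamma> ` {0..})}"

text \<open>The canonical maps from the strata to the direct limit are injective, since all strata carry
  the same equivalence relation. The stratum of \<open>N\<close> is identified with its image: it consists of the
  classes containing an \<open>N\<close>-Morse ray.\<close>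

definition morse_stratum :: "'p metric \<Rightarrow> 'p \<Rightarrow> (real \<Rightarrow> real \<Rightarrow> real) \<Rightarrow> (real \<Rightarrow> 'p) set set" where
  "morse_stratum X e N = morse_class X e ` morse_rays X e N"

definition stratum_nbhd ::
  "'p metric \<Rightarrow> 'p \<Rightarrow> (real \<Rightarrow> real \<Rightarrow> real) \<Rightarrow> nat \<Rightarrow> (real \<Rightarrow> 'p) \<Rightarrow> (real \<Rightarrow> 'p) set set" where
  "stratum_nbhd X e N k \<gamma> = morse_class X e `
     {\<gamma>' \<in> morse_rays X e N. \<forall>t\<in>{0..real k}. mdist X (\<gamma> t) (\<gamma>' t) \<le> morse_delta N}"

definition stratum_topology ::
  "'p metric \<Rightarrow> 'p \<Rightarrow> (real \<Rightarrow> real \<Rightarrow> real) \<Rightarrow> (real \<Rightarrow> 'p) set topology" where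
  "stratum_topology X e N = topology (\<lambda>U. U \<subseteq> morse_stratum X e N \<and>
     (\<forall>\<gamma>\<in>morse_rays X e N. morse_class X e \<gamma> \<in> U \<longrightarrow> (\<exists>k. stratum_nbhd X e N k \<gamma> \<subseteq> U)))"

text \<open>The direct limit over all Morse gauges: the union of the strata with the final topology.\<close>

definition morse_boundary :: "'p metric \<Rightarrow> 'p \<Rightarrow> (real \<Rightarrow> 'p) set topology" where
  "morse_boundary X e = topology (\<lambda>U. U \<subseteq> (\<Union>N\<in>Collect morse_gauge. morse_stratum X e N) \<and>
     (\<forall>N. morse_gauge N \<longrightarrow> openin (stratum_topology X e N) (U \<inter> morse_stratum X e N)))"

definition relative_morse_boundary :: "'p metric \<Rightarrow> 'p \<Rightarrow> 'p set \<Rightarrow> (real \<Rightarrow> 'p) set set" where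
  "relative_morse_boundary X e Y =
     {morse_class X e \<gamma> | \<gamma>. morse_geodesic_ray X \<gamma> \<and> (\<exists>k. \<gamma> ` {0..} \<subseteq> closed_nbhd X k Y)}"

lemma stratum_nbhd_antimono: "k \<le> l \<Longrightarrow> stratum_nbhd X e N l \<gamma> \<subseteq> stratum_nbhd X e N k \<gamma>"
  unfolding stratum_nbhd_def by (intro image_mono) auto

lemma openin_stratum_topology:
  "openin (stratum_topology X e N) U \<longleftrightarrow> U \<subseteq> morse_stratum X e N \<and>
     (\<forall>\<gamma>\<in>morse_rays X e N. morse_class X e \<gamma> \<in> U \<longrightarrow> (\<exists>k. stratum_nbhd X e N k \<gamma> \<subseteq> U))"
proof -
  have "istopology (\<lambda>U. U \<subseteq> morse_stratum X e N \<and>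
     (\<forall>\<gamma>\<in>morse_rays X e N. morse_class X e \<gamma> \<in> U \<longrightarrow> (\<exists>k. stratum_nbhd X e N k \<gamma> \<subseteq> U)))"
    (is "istopology ?L")
    unfolding istopology_def
  proof (rule conjI; intro allI impI)
    fix U V assume UV: "?L U" "?L V"
    show "?L (U \<inter> V)"
    proof (intro conjI ballI impI)
      fix \<gamma> assume "\<gamma> \<in> morse_rays X e N" "morse_class X e \<gamma> \<in> U \<inter> V"
      then obtain k l where "stratum_nbhd X e N k \<gamma> \<subseteq> U" "stratum_nbhd X e N l \<gamma> \<subseteq> V"
        using UV by blast
      then have "stratum_nbhd X e N (max k l) \<gamma> \<subseteq> U \<inter> V"
        using stratum_nbhd_antimono[of k "max k l" X e N \<gamma>]
          stratum_nbhd_antimono[of l "max k l" X e N \<gamma>] by auto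
      then show "\<exists>k. stratum_nbhd X e N k \<gamma> \<subseteq> U \<inter> V" by blast
    qed (use UV in blast)
  next
    fix \<K> assume "\<forall>K\<in>\<K>. ?L K"
    then show "?L (\<Union>\<K>)"
      by (intro conjI) (blast, meson Union_iff Union_upper subset_trans)
  qed
  then show ?thesis
    unfolding stratum_topology_def by (simp add: topology_inverse')
qed

lemma topspace_stratum_topology: "topspace (stratum_topology X e N) = morse_stratum X e N"
proof -
  have "openin (stratum_topology X e N) (morse_stratum X e N)"
    by (auto simp: openin_stratum_topology stratum_nbhd_def morse_stratum_def)
  then show ?thesis
    by (meson openin_stratum_topology openin_subset openin_topspace subset_antisym)
qed

lemma openin_morse_boundary:
  "openin (morse_boundary X e) U \<longleftrightarrow> U \<subseteq> (\<Union>N\<in>Collect morse_gauge. morse_stratum X e N) \<and>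
     (\<forall>N. morse_gauge N \<longrightarrow> openin (stratum_topology X e N) (U \<inter> morse_stratum X e N))"
proof -
  have "istopology (\<lambda>U. U \<subseteq> (\<Union>N\<in>Collect morse_gauge. morse_stratum X e N) \<and>
     (\<forall>N. morse_gauge N \<longrightarrow> openin (stratum_topology X e N) (U \<inter> morse_stratum X e N)))"
    (is "istopology ?L")
    unfolding istopology_def
  proof (intro conjI allI impI)
    fix U V N assume UV: "?L U" "?L V" and N: "morse_gauge N"
    have "U \<inter> V \<inter> morse_stratum X e N = (U \<inter> morse_stratum X e N) \<inter> (V \<inter> morse_stratum X e N)"
      by blast
    then show "openin (stratum_topology X e N) (U \<inter> V \<inter> morse_stratum X e N)"
      using UV N by (simp add: openin_Int)
  next
    fix \<K> N assume K: "\<forall>K\<in>\<K>. ?L K" and N: "morse_gauge N"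
    have "openin (stratum_topology X e N) (\<Union>K\<in>\<K>. K \<inter> morse_stratum X e N)"
      using K N by (intro openin_Union) auto
    then show "openin (stratum_topology X e N) (\<Union>\<K> \<inter> morse_stratum X e N)"
      by (simp only: Int_Union2)
  qed blast+
  then show ?thesis
    unfolding morse_boundary_def by (simp add: topology_inverse')
qed

lemma topspace_morse_boundary:
  "topspace (morse_boundary X e) = (\<Union>N\<in>Collect morse_gauge. morse_stratum X e N)" (is "_ = ?B")
proof -
  have "?B \<inter> morse_stratum X e N = morse_stratum X e N" if "morse_gauge N" for N
    using that by blast
  then have "openin (morse_boundary X e) ?B"
    by (simp add: openin_morse_boundary flip: topspace_stratum_topology)
  then show ?thesis
    by (meson openin_morse_boundary openin_subset openin_topspace subset_antisym)
qed


section \<open>Point-convergence\<close>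

definition set_limit :: "'p topology \<Rightarrow> (nat \<Rightarrow> 'p set) \<Rightarrow> 'p set" where
  "set_limit T A = {x. \<exists>\<xi>. (\<forall>n. \<xi> n \<in> A n) \<and> limitin T \<xi> x sequentially}"

definition point_convergent :: "'p topology \<Rightarrow> 'p set set \<Rightarrow> bool" where
  "point_convergent T \<F> \<longleftrightarrow>
     (\<forall>A :: nat \<Rightarrow> 'p set. inj A \<and> range A \<subseteq> \<F> \<longrightarrow> finite (set_limit T A) \<and> card (set_limit T A) \<le> 1)"

definition nonsingleton_components :: "'p topology \<Rightarrow> 'p set set" where
  "nonsingleton_components T = {C \<in> connected_components_of T. \<not> is_singleton C}"


section \<open>Cayley graphs\<close>

definition finite_generating_set :: "('a, 'm) monoid_scheme \<Rightarrow> 'a set \<Rightarrow> bool" where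
  "finite_generating_set G S \<longleftrightarrow> finite S \<and> S \<subseteq> carrier G \<and> generate G S = carrier G"

text \<open>The Cayley graph is the geometric realisation of the simplicial graph with vertex set
  \<open>carrier G\<close> and edges \<open>{g, gs}\<close>: a point is a function assigning to each vertex its barycentric
  coordinate. Loops and multiple edges, which arise if \<open>\<one> \<in> S\<close> or \<open>s, inv s \<in> S\<close>, are suppressed.\<close>

definition cayley_cells :: "('a, 'm) monoid_scheme \<Rightarrow> 'a set \<Rightarrow> 'a set set" where
  "cayley_cells G S =
     {{g} | g. g \<in> carrier G} \<union> {{g, g \<otimes>\<^bsub>G\<^esub> s} | g s. g \<in> carrier G \<and> s \<in> S}"

definition cell_points :: "'a set \<Rightarrow> ('a \<Rightarrow> real) set" where
  "cell_points \<sigma> = {p. (\<forall>x. 0 \<le> p x) \<and> (\<forall>x. x \<notin> \<sigma> \<longrightarrow> p x = 0) \<and> (\<Sum>x\<in>\<sigma>. p x) = 1}"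

definition cayley_points :: "('a, 'm) monoid_scheme \<Rightarrow> 'a set \<Rightarrow> ('a \<Rightarrow> real) set" where
  "cayley_points G S = (\<Union>\<sigma>\<in>cayley_cells G S. cell_points \<sigma>)"

text \<open>Piecewise linear paths from \<open>p\<close> to \<open>q\<close>, with their length. Edges have length one, so the
  length of the segment between two points of the edge \<open>{u, v}\<close> is the difference of their \<open>v\<close>-th
  (equivalently, of their \<open>u\<close>-th) coordinates.\<close>

inductive pl_path :: "('a, 'm) monoid_scheme \<Rightarrow> 'a set \<Rightarrow> ('a \<Rightarrow> real) \<Rightarrow> ('a \<Rightarrow> real) \<Rightarrow> real \<Rightarrow> bool"
  for G S where
  pl_refl: "p \<in> cayley_points G S \<Longrightarrow> pl_path G S p p 0"
| pl_step: "\<lbrakk>pl_path G S p q l; \<sigma> \<in> cayley_cells G S; q \<in> cell_points \<sigma>; r \<in> cell_points \<sigma>; v \<in> \<sigma>\<rbrakk>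
    \<Longrightarrow> pl_path G S p r (l + \<bar>q v - r v\<bar>)"

definition cayley_dist :: "('a, 'm) monoid_scheme \<Rightarrow> 'a set \<Rightarrow> ('a \<Rightarrow> real) \<Rightarrow> ('a \<Rightarrow> real) \<Rightarrow> real" where
  "cayley_dist G S p q = Inf {l. pl_path G S p q l}"

definition cayley_graph :: "('a, 'm) monoid_scheme \<Rightarrow> 'a set \<Rightarrow> ('a \<Rightarrow> real) metric" where
  "cayley_graph G S = metric (cayley_points G S, \<lambda>p q.
     if p \<in> cayley_points G S \<and> q \<in> cayley_points G S then cayley_dist G S p q else 0)"

definition cayley_vertex :: "'a \<Rightarrow> 'a \<Rightarrow> real" where
  "cayley_vertex g = (\<lambda>x. of_bool (x = g))"

text \<open>Left multiplication, extended affinely from the vertices.\<close>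

definition cayley_translate :: "('a, 'm) monoid_scheme \<Rightarrow> 'a \<Rightarrow> ('a \<Rightarrow> real) \<Rightarrow> 'a \<Rightarrow> real" where
  "cayley_translate G g p = (\<lambda>x. if x \<in> carrier G then p (inv\<^bsub>G\<^esub> g \<otimes>\<^bsub>G\<^esub> x) else 0)"

lemma cayley_translate_vertex:
  assumes "group G" "g \<in> carrier G" "h \<in> carrier G"
  shows "cayley_translate G g (cayley_vertex h) = cayley_vertex (g \<otimes>\<^bsub>G\<^esub> h)"
proof -
  interpret group G by fact
  show ?thesis
    using assms(2,3) by (auto simp: cayley_translate_def cayley_vertex_def fun_eq_iff m_assoc[symmetric]
        inv_solve_left')
qed

text \<open>The chain definition is a metric when the graph is connected.\<close>

lemma cell_dist_eq:
  assumes "\<sigma> \<in> cayley_cells G S" "p \<in> cell_points \<sigma>" "q \<in> cell_points \<sigma>" "v \<in> \<sigma>" "x \<in> \<sigma>"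
  shows "\<bar>p x - q x\<bar> = \<bar>p v - q v\<bar>"
proof -
  from assms(1) obtain a b where ab: "\<sigma> = {a, b}" by (auto simp: cayley_cells_def)
  show ?thesis
    using assms(2-) unfolding ab cell_points_def by (cases "a = b") auto
qed

lemma pl_path_points: "pl_path G S p q l \<Longrightarrow> p \<in> cayley_points G S \<and> q \<in> cayley_points G S"
  by (induction rule: pl_path.induct) (auto simp: cayley_points_def)

lemma pl_path_coord: "pl_path G S p q l \<Longrightarrow> \<bar>p x - q x\<bar> \<le> l"
proof (induction rule: pl_path.induct)
  case (pl_step p q l \<sigma> r v)
  have "\<bar>q x - r x\<bar> \<le> \<bar>q v - r v\<bar>"
  proof (cases "x \<in> \<sigma>")
    case True
    then show ?thesis using cell_dist_eq[of \<sigma> G S q r v x] pl_step by simp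
  next
    case False
    then show ?thesis using pl_step by (simp add: cell_points_def)
  qed
  then show ?case using pl_step by linarith
qed simp

lemma pl_path_trans:
  assumes "pl_path G S q r m" "pl_path G S p q l" shows "pl_path G S p r (l + m)"
  using assms
proof (induction arbitrary: l rule: pl_path.induct)
  case (pl_step q q' m \<sigma> r v)
  from pl_path.pl_step[OF pl_step.IH[OF pl_step.prems] pl_step.hyps(2-5)]
  show ?case by (simp add: add.assoc)
qed simp

lemma pl_path_step1:
  "\<lbrakk>\<sigma> \<in> cayley_cells G S; q \<in> cell_points \<sigma>; r \<in> cell_points \<sigma>; v \<in> \<sigma>\<rbrakk> \<Longrightarrow> pl_path G S q r \<bar>q v - r v\<bar>"
  using pl_step[OF pl_refl, of q G S \<sigma> r v] by (auto simp: cayley_points_def)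

lemma pl_path_sym: "pl_path G S p q l \<Longrightarrow> pl_path G S q p l"
proof (induction rule: pl_path.induct)
  case (pl_step p q l \<sigma> r v)
  have "pl_path G S r q \<bar>r v - q v\<bar>" using pl_step by (intro pl_path_step1)
  from pl_path_trans[OF pl_step.IH this] show ?case by (simp add: abs_minus_commute add.commute)
qed (rule pl_refl)

lemma cayley_vertex_in_cell: "\<lbrakk>g \<in> \<sigma>; finite \<sigma>\<rbrakk> \<Longrightarrow> cayley_vertex g \<in> cell_points \<sigma>"
  by (auto simp: cayley_vertex_def cell_points_def)

lemma pl_path_exists:
  assumes "group G" "finite_generating_set G S" "p \<in> cayley_points G S" "q \<in> cayley_points G S"
  shows "\<exists>l. pl_path G S p q l"
proof -
  interpret group G by fact
  have S: "S \<subseteq> carrier G" and gen: "generate G S = carrier G"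
    using assms(2) by (auto simp: finite_generating_set_def)
  have edge: "\<exists>l. pl_path G S (cayley_vertex g) (cayley_vertex (g \<otimes>\<^bsub>G\<^esub> s)) l"
    if "g \<in> carrier G" "s \<in> S" for g s
  proof -
    have "{g, g \<otimes>\<^bsub>G\<^esub> s} \<in> cayley_cells G S" using that by (auto simp: cayley_cells_def)
    from pl_path_step1[OF this cayley_vertex_in_cell cayley_vertex_in_cell, of g "g \<otimes>\<^bsub>G\<^esub> s" g]
    show ?thesis by auto
  qed
  have gen_path: "\<forall>g\<in>carrier G. \<exists>l. pl_path G S (cayley_vertex g) (cayley_vertex (g \<otimes>\<^bsub>G\<^esub> h)) l"
    if "h \<in> generate G S" for h
    using that
  proof (induction rule: generate.induct)
    case one
    have "cayley_vertex g \<in> cayley_points G S" if "g \<in> carrier G" for g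
      using that cayley_vertex_in_cell[of g "{g}"] by (auto simp: cayley_points_def cayley_cells_def)
    then show ?case by (auto intro: pl_refl)
  next
    case (incl h)
    then show ?case using edge by blast
  next
    case (inv h)
    show ?case
    proof
      fix g assume g: "g \<in> carrier G"
      have h: "h \<in> carrier G" using inv S by blast
      have "g \<otimes>\<^bsub>G\<^esub> inv\<^bsub>G\<^esub> h \<otimes>\<^bsub>G\<^esub> h = g" using g h by (simp add: m_assoc)
      then show "\<exists>l. pl_path G S (cayley_vertex g) (cayley_vertex (g \<otimes>\<^bsub>G\<^esub> inv\<^bsub>G\<^esub> h)) l"
        using edge[of "g \<otimes>\<^bsub>G\<^esub> inv\<^bsub>G\<^esub> h" h] inv g h by (auto intro: pl_path_sym)
    qed
  next
    case (eng h1 h2)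
    show ?case
    proof
      fix g assume g: "g \<in> carrier G"
      have h: "h1 \<in> carrier G" "h2 \<in> carrier G" using eng gen by auto
      obtain l where "pl_path G S (cayley_vertex g) (cayley_vertex (g \<otimes>\<^bsub>G\<^esub> h1)) l"
        using eng g by blast
      moreover obtain m where
        "pl_path G S (cayley_vertex (g \<otimes>\<^bsub>G\<^esub> h1)) (cayley_vertex (g \<otimes>\<^bsub>G\<^esub> h1 \<otimes>\<^bsub>G\<^esub> h2)) m"
        using eng g h by (meson m_closed)
      ultimately show "\<exists>l. pl_path G S (cayley_vertex g) (cayley_vertex (g \<otimes>\<^bsub>G\<^esub> (h1 \<otimes>\<^bsub>G\<^esub> h2))) l"
        using pl_path_trans g h by (metis m_assoc)
    qed
  qed
  have one: "\<exists>l. pl_path G S (cayley_vertex \<one>\<^bsub>G\<^esub>) p l" if p: "p \<in> cayley_points G S" for p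
  proof -
    obtain \<sigma> where \<sigma>: "\<sigma> \<in> cayley_cells G S" "p \<in> cell_points \<sigma>"
      using p by (auto simp: cayley_points_def)
    then obtain g where g: "g \<in> \<sigma>" "g \<in> carrier G" "finite \<sigma>" by (auto simp: cayley_cells_def)
    obtain l where "pl_path G S (cayley_vertex \<one>\<^bsub>G\<^esub>) (cayley_vertex g) l"
      using bspec[OF gen_path[of g] one_closed] g(2) gen l_one[OF g(2)] by auto
    moreover have "pl_path G S (cayley_vertex g) p \<bar>cayley_vertex g g - p g\<bar>"
      using \<sigma> g by (intro pl_path_step1 cayley_vertex_in_cell)
    ultimately show ?thesis using pl_path_trans by blast
  qed
  from one[OF assms(3)] one[OF assms(4)] show ?thesis
    using pl_path_sym pl_path_trans by blast
qed

lemma Metric_space_cayley: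
  assumes "group G" "finite_generating_set G S"
  shows "Metric_space (cayley_points G S) (\<lambda>p q.
     if p \<in> cayley_points G S \<and> q \<in> cayley_points G S then cayley_dist G S p q else 0)"
proof -
  have nonneg: "0 \<le> l" if "pl_path G S p q l" for p q l
    using pl_path_coord[OF that, of undefined] by linarith
  have bdd: "bdd_below {l. pl_path G S p q l}" for p q
    using nonneg by (intro bdd_belowI[of _ 0]) auto
  have ne: "{l. pl_path G S p q l} \<noteq> {}" if "p \<in> cayley_points G S" "q \<in> cayley_points G S" for p q
    using pl_path_exists[OF assms that] by blast
  have le: "cayley_dist G S p q \<le> l" if "pl_path G S p q l" for p q l
    unfolding cayley_dist_def using that bdd by (intro cInf_lower) auto
  have ge: "b \<le> cayley_dist G S p q"
    if "p \<in> cayley_points G S" "q \<in> cayley_points G S" "\<And>l. pl_path G S p q l \<Longrightarrow> b \<le> l" for p q b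
    unfolding cayley_dist_def using that ne by (intro cInf_greatest) auto
  have zero: "cayley_dist G S p q = 0 \<longleftrightarrow> p = q"
    if pq: "p \<in> cayley_points G S" "q \<in> cayley_points G S" for p q
  proof
    assume 0: "cayley_dist G S p q = 0"
    have "\<bar>p x - q x\<bar> \<le> 0" for x
      using ge[OF pq, of "\<bar>p x - q x\<bar>"] pl_path_coord 0 by metis
    then show "p = q" by auto
  next
    assume "p = q"
    then show "cayley_dist G S p q = 0"
      using le[OF pl_refl[OF pq(1)]] ge[OF pq, of 0] nonneg by (metis order_antisym)
  qed
  have triangle: "cayley_dist G S p r \<le> cayley_dist G S p q + cayley_dist G S q r"
    if pqr: "p \<in> cayley_points G S" "q \<in> cayley_points G S" "r \<in> cayley_points G S" for p q r
  proof -
    have "cayley_dist G S p r - m \<le> cayley_dist G S p q" if m: "pl_path G S q r m" for m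
      using pqr(1,2)
    proof (rule ge)
      fix l assume "pl_path G S p q l"
      from le[OF pl_path_trans[OF m this]] show "cayley_dist G S p r - m \<le> l" by linarith
    qed
    then have "cayley_dist G S p r - cayley_dist G S p q \<le> cayley_dist G S q r"
      using pqr by (intro ge) (auto simp: algebra_simps)
    then show ?thesis by linarith
  qed
  have sym: "cayley_dist G S p q = cayley_dist G S q p" for p q
    unfolding cayley_dist_def using pl_path_sym[of G S] by (intro arg_cong[where f = Inf]) blast
  have pos: "0 \<le> cayley_dist G S p q" if "p \<in> cayley_points G S" "q \<in> cayley_points G S" for p q
    using ge[OF that] nonneg by blast
  show ?thesis
  proof (rule Metric_space.intro, goal_cases)
    case (1 p q)
    show ?case using pos by simp
  next
    case (2 p q)
    show ?case using sym[of p q] by simp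
  next
    case (3 p q)
    then show ?case using zero by simp
  next
    case (4 p q r)
    then show ?case using triangle by simp
  qed
qed

lemma
  assumes "group G" "finite_generating_set G S"
  shows mspace_cayley_graph: "mspace (cayley_graph G S) = cayley_points G S"
    and mdist_cayley_graph: "\<lbrakk>p \<in> cayley_points G S; q \<in> cayley_points G S\<rbrakk>
      \<Longrightarrow> mdist (cayley_graph G S) p q = cayley_dist G S p q"
  unfolding cayley_graph_def
  using Metric_space.mspace_metric[OF Metric_space_cayley[OF assms]]
    Metric_space.mdist_metric[OF Metric_space_cayley[OF assms]] by simp_all


section \<open>The Morse boundary of a group\<close>

abbreviation group_morse_boundary ::
  "('a, 'm) monoid_scheme \<Rightarrow> 'a set \<Rightarrow> (real \<Rightarrow> 'a \<Rightarrow> real) set topology" where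
  "group_morse_boundary G S \<equiv> morse_boundary (cayley_graph G S) (cayley_vertex \<one>\<^bsub>G\<^esub>)"

abbreviation relative_group_boundary ::
  "('a, 'm) monoid_scheme \<Rightarrow> 'a set \<Rightarrow> 'a set \<Rightarrow> (real \<Rightarrow> 'a \<Rightarrow> real) set set" where
  "relative_group_boundary G S H \<equiv>
     relative_morse_boundary (cayley_graph G S) (cayley_vertex \<one>\<^bsub>G\<^esub>) (cayley_vertex ` H)"

text \<open>\<open>g \<cdot> [\<gamma>] = [g\<gamma>]\<close>. All \<open>\<gamma> \<in> c\<close> yield the same class, so the union is that class.\<close>

definition boundary_action ::
  "('a, 'm) monoid_scheme \<Rightarrow> 'a set \<Rightarrow> 'a \<Rightarrow> (real \<Rightarrow> 'a \<Rightarrow> real) set \<Rightarrow> (real \<Rightarrow> 'a \<Rightarrow> real) set" where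
  "boundary_action G S g c =
     (\<Union>\<gamma>\<in>c. morse_class (cayley_graph G S) (cayley_vertex \<one>\<^bsub>G\<^esub>) (\<lambda>t. cayley_translate G g (\<gamma> t)))"

abbreviation component_stabiliser ::
  "('a, 'm) monoid_scheme \<Rightarrow> 'a set \<Rightarrow> (real \<Rightarrow> 'a \<Rightarrow> real) set set \<Rightarrow> 'a set" where
  "component_stabiliser G S \<equiv> stabilizer G (\<lambda>g C. boundary_action G S g ` C)"

end

theory Submission
  imports Defs
begin

text \<open>A quasi-isometry induces a homeomorphism of Morse boundaries, so the non-singleton components
  of \<open>\<partial>\<^sub>* G'\<close> are point-convergent as well. Two points of \<open>C'\<close> are joined by a Morse quasi-geodesic
  line \<open>\<sigma>\<close> through the identity, made of two rays.

  Let \<open>g\<^sub>n\<close> be a group element near the \<open>n\<close>-th point of the ray towards \<open>\<xi> \<in> C'\<close>. The lines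
  \<open>g\<^sub>n\<inverse> \<sigma>\<close> pass near the identity and are uniformly Morse, hence after passing to a subsequence
  their two ends converge to two different points. As both ends lie in the component \<open>g\<^sub>n\<inverse> C'\<close>,
  only finitely many of these components are distinct. So the \<open>g\<^sub>n\<close> lie in finitely many cosets
  \<open>H' g\<close>, and the ray stays close to \<open>H'\<close>.

  Conversely, if a Morse ray \<open>\<gamma>\<close> passes near \<open>h\<^sub>n \<in> H'\<close> at time \<open>n\<close>, go from the identity to the
  nearest point of \<open>h\<^sub>n \<sigma>\<close> and then follow \<open>h\<^sub>n \<sigma>\<close> in the direction that passes through \<open>h\<^sub>n\<close>. This
  is a uniformly Morse quasi-geodesic ray to a point of \<open>h\<^sub>n C' = C'\<close> that fellow-travels \<open>\<gamma>\<close> up to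
  time about \<open>n\<close>. So \<open>\<gamma>\<^sup>+\<close> is a limit of points of \<open>C'\<close>, and components are closed.\<close>

section \<open>Quasi-geodesics\<close>

text \<open>In the direct limit, convergence is tested inside a single stratum, and both inclusions
  deal with infinitely many lines or rays at once. So every construction (image under a
  quasi-isometry, joined path, nearby path, limit of rays) must yield a Morse bound that depends
  only on the constants put in; this is what most of the explicit constants record.

  Two facts carry the estimates. A geodesic to an almost nearest point of a (q, Q)-quasi-geodesic,
  continued along it, is a (2q + 1, Q + 1)-quasi-geodesic; this makes lines out of rays, joins Morse
  pieces, and attaches the identity to a translated line. And a quasi-geodesic with endpoints near a
  Morse path is tracked in both directions; this passes the Morse property on to nearby paths.

  The two ends of the translated lines have different limits because all these lines have the same
  quasi-geodesic constants: their ends separate at a uniform rate, which survives in the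
  limit.\<close>

lemma mdist_refl [simp]: "x \<in> mspace X \<Longrightarrow> mdist X x x = 0"
  by simp

lemma quasi_geodesic_mem: "quasi_geodesic X q Q I \<gamma> \<Longrightarrow> s \<in> I \<Longrightarrow> \<gamma> s \<in> mspace X"
  by (auto simp: quasi_geodesic_def)

lemma quasi_geodesic_upper:
  "quasi_geodesic X q Q I \<gamma> \<Longrightarrow> s \<in> I \<Longrightarrow> t \<in> I \<Longrightarrow> mdist X (\<gamma> s) (\<gamma> t) \<le> q * \<bar>s - t\<bar> + Q"
  by (auto simp: quasi_geodesic_def)

lemma quasi_geodesic_lower:
  assumes "quasi_geodesic X q Q I \<gamma>" "s \<in> I" "t \<in> I" "q \<ge> 1"
  shows "\<bar>s - t\<bar> \<le> q * (mdist X (\<gamma> s) (\<gamma> t) + Q)"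
proof -
  have "\<bar>s - t\<bar> / q - Q \<le> mdist X (\<gamma> s) (\<gamma> t)"
    using assms by (auto simp: quasi_geodesic_def)
  with assms(4) show ?thesis by (simp add: field_simps)
qed

text \<open>Both bounds are symmetric in \<open>s\<close> and \<open>t\<close>, so ordered pairs
  suffice. The lower bound is multiplied by \<open>q\<close>, which keeps quotients out of the later
  estimates.\<close>

lemma quasi_geodesicI:
  assumes "\<And>s. s \<in> I \<Longrightarrow> \<gamma> s \<in> mspace X" "q \<ge> 1"
    and "\<And>s t. s \<in> I \<Longrightarrow> t \<in> I \<Longrightarrow> s \<le> t \<Longrightarrow> t - s \<le> q * (mdist X (\<gamma> s) (\<gamma> t) + Q)"
    and "\<And>s t. s \<in> I \<Longrightarrow> t \<in> I \<Longrightarrow> s \<le> t \<Longrightarrow> mdist X (\<gamma> s) (\<gamma> t) \<le> q * (t - s) + Q"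
  shows "quasi_geodesic X q Q I \<gamma>"
proof -
  have "\<bar>s - t\<bar> / q - Q \<le> mdist X (\<gamma> s) (\<gamma> t) \<and> mdist X (\<gamma> s) (\<gamma> t) \<le> q * \<bar>s - t\<bar> + Q"
    if "s \<in> I" "t \<in> I" for s t
  proof (cases "s \<le> t")
    case True
    then show ?thesis using assms(3,4)[OF that] \<open>q \<ge> 1\<close> by (simp add: field_simps)
  next
    case False
    then show ?thesis using assms(3,4)[OF that(2,1)] \<open>q \<ge> 1\<close>
      by (simp add: field_simps mdist_commute[of X "\<gamma> s" "\<gamma> t"])
  qed
  then show ?thesis using assms(1) by (auto simp: quasi_geodesic_def)
qed

lemma quasi_geodesic_subset: "quasi_geodesic X q Q I \<gamma> \<Longrightarrow> J \<subseteq> I \<Longrightarrow> quasi_geodesic X q Q J \<gamma>"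
  by (auto simp: quasi_geodesic_def)

lemma quasi_geodesic_weaken:
  assumes "quasi_geodesic X q Q I \<gamma>" "1 \<le> q" "q \<le> q'" "Q \<le> Q'"
  shows "quasi_geodesic X q' Q' I \<gamma>"
proof (rule quasi_geodesicI)
  fix s t assume st: "s \<in> I" "t \<in> I" "s \<le> t"
  \<comment> \<open>The product estimate below needs a nonnegative factor. No sign of
    \<open>Q\<close> is assumed, so it is read off from the lower bound, where \<open>q\<close> is
    positive.\<close>
  have nn: "0 \<le> mdist X (\<gamma> s) (\<gamma> t) + Q"
    using quasi_geodesic_lower[OF assms(1) st(1,2)] assms(2) st(3)
    by (smt (verit) mult_nonneg_nonpos mult_pos_neg)
  have "t - s \<le> q * (mdist X (\<gamma> s) (\<gamma> t) + Q)"
    using quasi_geodesic_lower[OF assms(1) st(1,2)] assms(2) st(3) by simp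
  also have "\<dots> \<le> q' * (mdist X (\<gamma> s) (\<gamma> t) + Q')"
    using assms nn by (intro mult_mono) auto
  finally show "t - s \<le> q' * (mdist X (\<gamma> s) (\<gamma> t) + Q')" .
  have "mdist X (\<gamma> s) (\<gamma> t) \<le> q * (t - s) + Q"
    using quasi_geodesic_upper[OF assms(1) st(1,2)] st(3) by simp
  also have "\<dots> \<le> q' * (t - s) + Q'"
    using assms st by (intro add_mono mult_right_mono) auto
  finally show "mdist X (\<gamma> s) (\<gamma> t) \<le> q' * (t - s) + Q'" .
qed (use assms quasi_geodesic_mem in auto)

lemma quasi_geodesic_reflect:
  assumes "quasi_geodesic X q Q I \<gamma>" "\<And>x. x \<in> J \<Longrightarrow> c - x \<in> I"
  shows "quasi_geodesic X q Q J (\<lambda>x. \<gamma> (c - x))"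
proof -
  have "\<bar>(c - s) - (c - t)\<bar> = \<bar>s - t\<bar>" for s t :: real by simp
  then show ?thesis using assms unfolding quasi_geodesic_def Pi_iff by metis
qed

lemma quasi_geodesic_shift:
  assumes "quasi_geodesic X q Q I \<gamma>" "\<And>x. x \<in> J \<Longrightarrow> c + x \<in> I"
  shows "quasi_geodesic X q Q J (\<lambda>x. \<gamma> (c + x))"
proof -
  have "\<bar>(c + s) - (c + t)\<bar> = \<bar>s - t\<bar>" for s t :: real by simp
  then show ?thesis using assms unfolding quasi_geodesic_def Pi_iff by metis
qed

lemma mdist_triangle4:
  assumes "x \<in> mspace X" "y \<in> mspace X" "z \<in> mspace X" "w \<in> mspace X"
  shows "mdist X x w \<le> mdist X x y + mdist X y z + mdist X z w"
  using mdist_triangle[of x X y w] mdist_triangle[of y X z w] assms by linarith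

text \<open>Distances change by at most \<open>2 * K\<close>. As quasi-geodesics may jump, this also
  allows moving nothing but the two endpoints.\<close>

lemma quasi_geodesic_perturb:
  assumes "quasi_geodesic X q Q I \<gamma>" "q \<ge> 1" "K \<ge> 0"
    and "\<And>x. x \<in> I \<Longrightarrow> \<gamma>' x \<in> mspace X \<and> mdist X (\<gamma> x) (\<gamma>' x) \<le> K"
  shows "quasi_geodesic X q (Q + 2 * K) I \<gamma>'"
proof (rule quasi_geodesicI)
  fix s t assume st: "s \<in> I" "t \<in> I" "s \<le> t"
  note mem = quasi_geodesic_mem[OF assms(1)] assms(4)
  have 1: "mdist X (\<gamma> s) (\<gamma> t) \<le> mdist X (\<gamma>' s) (\<gamma>' t) + 2 * K"
    using mdist_triangle4[of "\<gamma> s" X "\<gamma>' s" "\<gamma>' t" "\<gamma> t"] mem[of s] mem[of t] st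
    by (simp add: mdist_commute[of X "\<gamma>' t"])
  have 2: "mdist X (\<gamma>' s) (\<gamma>' t) \<le> mdist X (\<gamma> s) (\<gamma> t) + 2 * K"
    using mdist_triangle4[of "\<gamma>' s" X "\<gamma> s" "\<gamma> t" "\<gamma>' t"] mem[of s] mem[of t] st
    by (simp add: mdist_commute[of X "\<gamma>' s" "\<gamma> s"])
  have "t - s \<le> q * (mdist X (\<gamma> s) (\<gamma> t) + Q)"
    using quasi_geodesic_lower[OF assms(1) st(1,2)] assms(2) st(3) by simp
  also have "\<dots> \<le> q * (mdist X (\<gamma>' s) (\<gamma>' t) + (Q + 2 * K))"
    using 1 assms(2) by (intro mult_left_mono) auto
  finally show "t - s \<le> q * (mdist X (\<gamma>' s) (\<gamma>' t) + (Q + 2 * K))" .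
  show "mdist X (\<gamma>' s) (\<gamma>' t) \<le> q * (t - s) + (Q + 2 * K)"
    using quasi_geodesic_upper[OF assms(1) st(1,2)] 2 st(3) by simp
qed (use assms in auto)


section \<open>Morse quasi-geodesics\<close>

text \<open>The bound \<open>B\<close> is an arbitrary function rather than a Morse gauge. As long as constants are
  uniform, it can be replaced by a gauge at the very end.\<close>

definition morse_on :: "'p metric \<Rightarrow> (real \<Rightarrow> real \<Rightarrow> real) \<Rightarrow> real set \<Rightarrow> (real \<Rightarrow> 'p) \<Rightarrow> bool" where
  "morse_on X B I \<gamma> \<longleftrightarrow>
     (\<forall>s\<in>I. \<forall>t\<in>I. s \<le> t \<longrightarrow>
       (\<forall>q\<ge>1. \<forall>Q\<ge>0. \<forall>a b \<eta>. a \<le> b \<and> quasi_geodesic X q Q {a..b} \<eta> \<and> \<eta> a = \<gamma> s \<and> \<eta> b = \<gamma> t \<longrightarrow>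
          (\<forall>u\<in>{a..b}. \<exists>v\<in>{s..t}. mdist X (\<eta> u) (\<gamma> v) \<le> B q Q)))"

lemma morse_onD:
  assumes "morse_on X B I \<gamma>" "s \<in> I" "t \<in> I" "s \<le> t" "q \<ge> 1" "Q \<ge> 0" "a \<le> b"
    "quasi_geodesic X q Q {a..b} \<eta>" "\<eta> a = \<gamma> s" "\<eta> b = \<gamma> t" "u \<in> {a..b}"
  obtains v where "v \<in> {s..t}" "mdist X (\<eta> u) (\<gamma> v) \<le> B q Q"
  using assms unfolding morse_on_def by blast

lemma morse_on_subset: "morse_on X B I \<gamma> \<Longrightarrow> J \<subseteq> I \<Longrightarrow> morse_on X B J \<gamma>"
  unfolding morse_on_def by (meson subsetD)

lemma morse_on_shift:
  assumes "morse_on X B I \<gamma>" "\<And>x. x \<in> J \<Longrightarrow> c + x \<in> I"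
  shows "morse_on X B J (\<lambda>x. \<gamma> (c + x))"
  unfolding morse_on_def
proof (intro ballI allI impI; elim conjE)
  fix s t q Q a b \<eta> u
  assume *: "s \<in> J" "t \<in> J" "s \<le> t" "(1::real) \<le> q" "(0::real) \<le> Q" "a \<le> b"
    "quasi_geodesic X q Q {a..b} \<eta>" "\<eta> a = \<gamma> (c + s)" "\<eta> b = \<gamma> (c + t)" "u \<in> {a..b}"
  obtain v where "v \<in> {c + s..c + t}" "mdist X (\<eta> u) (\<gamma> v) \<le> B q Q"
    by (rule morse_onD[OF assms(1), of "c + s" "c + t" q Q a b \<eta> u]) (use assms(2) * in auto)
  then show "\<exists>v\<in>{s..t}. mdist X (\<eta> u) (\<gamma> (c + v)) \<le> B q Q"
    by (intro bexI[of _ "v - c"]) auto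
qed

lemma morse_on_reflect:
  assumes "morse_on X B I \<gamma>" "\<And>x. x \<in> J \<Longrightarrow> c - x \<in> I"
  shows "morse_on X B J (\<lambda>x. \<gamma> (c - x))"
  unfolding morse_on_def
proof (intro ballI allI impI; elim conjE)
  fix s t q Q a b \<eta> u
  assume *: "s \<in> J" "t \<in> J" "s \<le> t" "(1::real) \<le> q" "(0::real) \<le> Q" "a \<le> b"
    "quasi_geodesic X q Q {a..b} \<eta>" "\<eta> a = \<gamma> (c - s)" "\<eta> b = \<gamma> (c - t)" "u \<in> {a..b}"
  have "quasi_geodesic X q Q {a..b} (\<lambda>x. \<eta> (a + b - x))"
    using *(7) by (rule quasi_geodesic_reflect) auto
  then obtain v where "v \<in> {c - t..c - s}" "mdist X (\<eta> (a + b - (a + b - u))) (\<gamma> v) \<le> B q Q"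
    by (rule morse_onD[OF assms(1), rotated 6, where s = "c - t" and t = "c - s" and u = "a + b - u"])
      (use assms(2) * in auto)
  then show "\<exists>v\<in>{s..t}. mdist X (\<eta> u) (\<gamma> (c - v)) \<le> B q Q"
    by (intro bexI[of _ "c - v"]) auto
qed

text \<open>Replacing the endpoints of \<open>\<eta>\<close> by \<open>\<gamma> s\<close> and
  \<open>\<gamma> t\<close> costs \<open>2 * K\<close> in the additive constant and leaves inner
  points alone. The endpoints themselves account for the maximum with \<open>K\<close>.\<close>

lemma morse_on_near:
  assumes M: "morse_on X B I \<gamma>" and \<gamma>: "\<gamma> \<in> I \<rightarrow> mspace X" and st: "s \<in> I" "t \<in> I" "s \<le> t"
    and "q \<ge> 1" "Q \<ge> 0" "K \<ge> 0" "a \<le> b" and \<eta>: "quasi_geodesic X q Q {a..b} \<eta>"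
    and K: "mdist X (\<eta> a) (\<gamma> s) \<le> K" "mdist X (\<eta> b) (\<gamma> t) \<le> K" and u: "u \<in> {a..b}"
  shows "\<exists>v\<in>{s..t}. mdist X (\<eta> u) (\<gamma> v) \<le> max (B q (Q + 2 * K)) K"
proof -
  consider "u = a" | "u = b" | "a < u" "u < b" using u by force
  then show ?thesis
  proof cases
    case 3
    define \<eta>' where "\<eta>' = \<eta>(a := \<gamma> s, b := \<gamma> t)"
    have "quasi_geodesic X q (Q + 2 * K) {a..b} \<eta>'"
      using \<eta> by (rule quasi_geodesic_perturb)
        (use assms quasi_geodesic_mem[OF \<eta>] in \<open>auto simp: \<eta>'_def\<close>)
    then obtain v where "v \<in> {s..t}" "mdist X (\<eta>' u) (\<gamma> v) \<le> B q (Q + 2 * K)"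
      by (rule morse_onD[OF M, rotated 6, where s = s and t = t and u = u]) (use assms 3 in \<open>auto
          simp: \<eta>'_def\<close>)
    then show ?thesis using 3 by (force simp: \<eta>'_def)
  qed (use K st in force)+
qed

lemma morse_on_near':
  assumes M: "morse_on X B I \<gamma>" and \<gamma>: "\<gamma> \<in> I \<rightarrow> mspace X" and st: "s \<in> I" "t \<in> I"
    and "q \<ge> 1" "Q \<ge> 0" "K \<ge> 0" "a \<le> b" and \<eta>: "quasi_geodesic X q Q {a..b} \<eta>"
    and K: "mdist X (\<eta> a) (\<gamma> s) \<le> K" "mdist X (\<eta> b) (\<gamma> t) \<le> K" and u: "u \<in> {a..b}"
  shows "\<exists>v\<in>{min s t..max s t}. mdist X (\<eta> u) (\<gamma> v) \<le> max (B q (Q + 2 * K)) K"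
proof (cases "s \<le> t")
  case True
  then show ?thesis using morse_on_near[OF assms(1-4) True assms(5-)] by simp
next
  case False
  have "quasi_geodesic X q Q {a..b} (\<lambda>x. \<eta> (a + b - x))"
    using \<eta> by (rule quasi_geodesic_reflect) auto
  from morse_on_near[OF assms(1,2) st(2,1) _ assms(5-8) this, of "a + b - u"] False K u
  show ?thesis by simp
qed

text \<open>A discrete substitute for the intermediate value theorem, as quasi-geodesics may jump.\<close>

lemma real_crossing:
  fixes \<tau> :: "real \<Rightarrow> real"
  assumes "a \<le> b" "\<tau> a \<le> v" "v \<le> \<tau> b"
  shows "\<exists>u\<in>{a..b}. \<exists>u'\<in>{a..b}. \<bar>u - u'\<bar> \<le> 1 \<and> \<tau> u \<le> v \<and> v \<le> \<tau> u'"
proof -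
  define A where "A = {u \<in> {a..b}. \<tau> u \<le> v}"
  have A: "A \<noteq> {}" "bdd_above A" using assms by (auto simp: A_def intro!: bdd_aboveI[of _ b])
  \<comment> \<open>Within 1 of the supremum: \<open>u + 1\<close> has left \<open>A\<close>, unless
    it has left the interval, in which case \<open>b\<close> takes its place.\<close>
  obtain u where u: "u \<in> A" "Sup A - 1 < u"
    using less_cSupD[OF A(1), of "Sup A - 1"] by auto
  show ?thesis
  proof (cases "u + 1 \<le> b")
    case True
    have "u + 1 \<notin> A" using u(2) cSup_upper[OF _ A(2), of "u + 1"] by auto
    then show ?thesis using u True
      by (intro bexI[of _ u] bexI[of _ "u + 1"]) (auto simp: A_def)
  next
    case False
    then show ?thesis using u assms by (intro bexI[of _ u] bexI[of _ b]) (auto simp: A_def)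
  qed
qed

text \<open>\<open>D\<close> bounds the distance from \<open>\<eta>\<close> to the Morse path. A
  parameter step of at most 1 moves \<open>\<eta>\<close> by at most \<open>q + Q\<close>, hence its
  companions on \<open>\<gamma>\<close> by \<open>2 * D + q + Q\<close>, hence their parameters by
  \<open>q0\<close> times this plus \<open>Q0\<close>. The outer \<open>q0\<close> and
  \<open>Q0\<close> convert back to distance.\<close>

definition track_const :: "(real \<Rightarrow> real \<Rightarrow> real) \<Rightarrow> real \<Rightarrow> real \<Rightarrow> real \<Rightarrow> real \<Rightarrow> real \<Rightarrow> real" where
  "track_const B q0 Q0 q Q K =
     (let D = max (B q (Q + 2 * K)) K in D + Q0 + q0 * (q0 * (2 * D + q + Q + Q0)))"

lemma track_const_ge:
  assumes "q0 \<ge> 1" "Q0 \<ge> 0" "q \<ge> 1" "Q \<ge> 0" "K \<ge> 0"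
  shows "max (B q (Q + 2 * K)) K \<le> track_const B q0 Q0 q Q K" "0 \<le> track_const B q0 Q0 q Q K"
proof -
  define D where "D = max (B q (Q + 2 * K)) K"
  have "0 \<le> D" using assms by (simp add: D_def)
  then have "0 \<le> q0 * (q0 * (2 * D + q + Q + Q0))" using assms by (intro mult_nonneg_nonneg) auto
  then show "max (B q (Q + 2 * K)) K \<le> track_const B q0 Q0 q Q K" "0 \<le> track_const B q0 Q0 q Q K"
    using assms \<open>0 \<le> D\<close> unfolding track_const_def Let_def D_def[symmetric] by linarith+
qed

text \<open>Each \<open>\<eta> u\<close> has a companion \<open>\<gamma> (\<tau> u)\<close>, and
  \<open>\<tau>\<close> goes from \<open>s\<close> to \<open>t\<close>. Where it crosses
  \<open>v\<close> it can jump only by the amount computed in \<open>track_const\<close>, so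
  \<open>\<gamma> v\<close> is close to \<open>\<eta>\<close> there.\<close>

lemma morse_on_track_aux:
  assumes M: "morse_on X B I \<gamma>" and \<gamma>: "quasi_geodesic X q0 Q0 I \<gamma>" and I: "is_interval I"
    and st: "s \<in> I" "t \<in> I" "s \<le> t" and q0: "q0 \<ge> 1" "Q0 \<ge> 0"
    and q: "q \<ge> 1" "Q \<ge> 0" "K \<ge> 0" "a \<le> b" and \<eta>: "quasi_geodesic X q Q {a..b} \<eta>"
    and K: "mdist X (\<eta> a) (\<gamma> s) \<le> K" "mdist X (\<eta> b) (\<gamma> t) \<le> K" and v: "v \<in> {s..t}"
  shows "\<exists>u\<in>{a..b}. mdist X (\<eta> u) (\<gamma> v) \<le> track_const B q0 Q0 q Q K"
proof -
  define D where "D = max (B q (Q + 2 * K)) K"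
  have I': "x \<in> I" if "x \<in> {s..t}" for x
    using that mem_is_interval_1_I[OF I st(1,2)] by simp
  note mem = quasi_geodesic_mem[OF \<gamma>] quasi_geodesic_mem[OF \<eta>]
  have "\<forall>u\<in>{a..b}. \<exists>v\<in>{s..t}. mdist X (\<eta> u) (\<gamma> v) \<le> D"
    unfolding D_def using morse_on_near[OF M _ st q \<eta> K] mem by blast
  then obtain \<tau>0 where \<tau>0: "\<And>u. u \<in> {a..b} \<Longrightarrow> \<tau>0 u \<in> {s..t} \<and> mdist X (\<eta> u) (\<gamma> (\<tau>0 u)) \<le> D"
    by metis
  show ?thesis
  proof (cases "a = b")
    \<comment> \<open>One parameter cannot be sent to both \<open>s\<close> and \<open>t\<close>.
      But then \<open>\<gamma> s\<close> and \<open>\<gamma> t\<close> are within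
      \<open>2 * K\<close>, so all of \<open>\<gamma>\<close> between them is near the point
      \<open>\<eta> a\<close>.\<close>
    case True
    have "mdist X (\<gamma> v) (\<gamma> s) \<le> q0 * (q0 * (2 * D + q + Q + Q0)) + Q0"
    proof -
      have "mdist X (\<gamma> s) (\<gamma> t) \<le> 2 * K"
        using mdist_triangle[of "\<gamma> s" X "\<eta> a" "\<gamma> t"] K True mem(1)[of s] mem(1)[of t] mem(2)[of a] st q
        by (simp add: mdist_commute[of X "\<gamma> s"])
      also have "\<dots> \<le> 2 * D + q + Q" using q by (auto simp: D_def)
      finally have "\<bar>s - t\<bar> \<le> q0 * (2 * D + q + Q + Q0)"
        using quasi_geodesic_lower[OF \<gamma> st(1,2) q0(1)] q0 q
        by (smt (verit, best) mult_left_mono)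
      then have "\<bar>v - s\<bar> \<le> q0 * (2 * D + q + Q + Q0)" using v by auto
      then have "q0 * \<bar>v - s\<bar> \<le> q0 * (q0 * (2 * D + q + Q + Q0))" using q0 by (intro mult_left_mono)
          auto
      then show ?thesis using quasi_geodesic_upper[OF \<gamma> I'[OF v] st(1)] by linarith
    qed
    moreover have "mdist X (\<eta> a) (\<gamma> v) \<le> mdist X (\<eta> a) (\<gamma> s) + mdist X (\<gamma> v) (\<gamma> s)"
      using mdist_triangle[of "\<eta> a" X "\<gamma> s" "\<gamma> v"] mem(1)[of s] mem(1)[OF I'[OF v]] mem(2)[of a] st q
      by (simp add: mdist_commute[of X "\<gamma> s" "\<gamma> v"])
    moreover have "K \<le> D" by (simp add: D_def)
    ultimately show ?thesis using K q unfolding track_const_def Let_def D_def[symmetric]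
      by (intro bexI[of _ a]) auto
  next
    case False
    define \<tau> where "\<tau> = \<tau>0(a := s, b := t)"
    have \<tau>: "\<tau> u \<in> {s..t} \<and> mdist X (\<eta> u) (\<gamma> (\<tau> u)) \<le> D" if "u \<in> {a..b}" for u
      using \<tau>0[OF that] st K by (auto simp: \<tau>_def D_def)
    obtain u u' where u: "u \<in> {a..b}" "u' \<in> {a..b}" "\<bar>u - u'\<bar> \<le> 1" "\<tau> u \<le> v" "v \<le> \<tau> u'"
      using real_crossing[of a b \<tau> v] v q False by (auto simp: \<tau>_def)
    have tu: "\<tau> u \<in> I" "\<tau> u' \<in> I" "\<gamma> (\<tau> u) \<in> mspace X" "\<gamma> (\<tau> u') \<in> mspace X" "\<eta> u \<in> mspace X" "\<eta> u'
        \<in> mspace X"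
      "\<gamma> v \<in> mspace X" "v \<in> I"
      using u \<tau> I' mem v by auto
    have "q * \<bar>u - u'\<bar> \<le> q" using u q by (simp add: mult_left_le)
    then have "mdist X (\<gamma> (\<tau> u)) (\<gamma> (\<tau> u')) \<le> 2 * D + q + Q"
      using mdist_triangle4[of "\<gamma> (\<tau> u)" X "\<eta> u" "\<eta> u'" "\<gamma> (\<tau> u')"] tu \<tau>[OF u(1)] \<tau>[OF u(2)]
        quasi_geodesic_upper[OF \<eta> u(1,2)]
      by (simp add: mdist_commute[of X "\<gamma> (\<tau> u)" "\<eta> u"])
    then have "\<bar>\<tau> u - \<tau> u'\<bar> \<le> q0 * (2 * D + q + Q + Q0)"
      using quasi_geodesic_lower[OF \<gamma> tu(1,2) q0(1)] q0
        mult_left_mono[of "mdist X (\<gamma> (\<tau> u)) (\<gamma> (\<tau> u')) + Q0" "2 * D + q + Q + Q0" q0] by linarith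
    then have "\<bar>\<tau> u - v\<bar> \<le> q0 * (2 * D + q + Q + Q0)" using u by auto
    then have "q0 * \<bar>\<tau> u - v\<bar> \<le> q0 * (q0 * (2 * D + q + Q + Q0))" using q0 by (intro mult_left_mono)
        auto
    then have "mdist X (\<gamma> (\<tau> u)) (\<gamma> v) \<le> q0 * (q0 * (2 * D + q + Q + Q0)) + Q0"
      using quasi_geodesic_upper[OF \<gamma> tu(1) tu(8)] by linarith
    then have "mdist X (\<eta> u) (\<gamma> v) \<le> D + (q0 * (q0 * (2 * D + q + Q + Q0)) + Q0)"
      using mdist_triangle[of "\<eta> u" X "\<gamma> (\<tau> u)" "\<gamma> v"] tu \<tau>[OF u(1)] by linarith
    then show ?thesis using u unfolding track_const_def Let_def D_def[symmetric]
      by (intro bexI[of _ u]) auto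
  qed
qed

text \<open>Stability in both directions, for endpoints in either order, since test paths may run
  against the direction of \<open>\<gamma>\<close>.\<close>

lemma morse_on_track:
  assumes M: "morse_on X B I \<gamma>" and \<gamma>: "quasi_geodesic X q0 Q0 I \<gamma>" and I: "is_interval I"
    and st: "s \<in> I" "t \<in> I" and q0: "q0 \<ge> 1" "Q0 \<ge> 0"
    and q: "q \<ge> 1" "Q \<ge> 0" "K \<ge> 0" "a \<le> b" and \<eta>: "quasi_geodesic X q Q {a..b} \<eta>"
    and K: "mdist X (\<eta> a) (\<gamma> s) \<le> K" "mdist X (\<eta> b) (\<gamma> t) \<le> K"
  shows "\<And>u. u \<in> {a..b} \<Longrightarrow> \<exists>v\<in>{min s t..max s t}. mdist X (\<eta> u) (\<gamma> v) \<le> track_const B q0 Q0 q Q K"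
    and "\<And>v. v \<in> {min s t..max s t} \<Longrightarrow> \<exists>u\<in>{a..b}. mdist X (\<eta> u) (\<gamma> v) \<le> track_const B q0 Q0 q Q K"
proof -
  show "\<exists>v\<in>{min s t..max s t}. mdist X (\<eta> u) (\<gamma> v) \<le> track_const B q0 Q0 q Q K" if "u \<in> {a..b}" for u
  proof -
    have "\<gamma> \<in> I \<rightarrow> mspace X" using quasi_geodesic_mem[OF \<gamma>] by auto
    from morse_on_near'[OF M this st q \<eta> K that] obtain v
      where "v \<in> {min s t..max s t}" "mdist X (\<eta> u) (\<gamma> v) \<le> max (B q (Q + 2 * K)) K" ..
    then show ?thesis
      using track_const_ge(1)[OF q0 q(1-3), of B] by (intro bexI[of _ v]) linarith+
  qed
  show "\<exists>u\<in>{a..b}. mdist X (\<eta> u) (\<gamma> v) \<le> track_const B q0 Q0 q Q K" if v: "v \<in> {min s t..max s t}" for v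
  proof (cases "s \<le> t")
    case True
    then show ?thesis using morse_on_track_aux[OF M \<gamma> I st True q0 q \<eta> K] v by simp
  next
    case False
    have "quasi_geodesic X q Q {a..b} (\<lambda>x. \<eta> (a + b - x))"
      using \<eta> by (rule quasi_geodesic_reflect) auto
    from morse_on_track_aux[OF M \<gamma> I st(2,1) _ q0 q this, of v] False K v
    obtain u where "u \<in> {a..b}" "mdist X (\<eta> (a + b - u)) (\<gamma> v) \<le> track_const B q0 Q0 q Q K"
      by auto
    then show ?thesis by (intro bexI[of _ "a + b - u"]) auto
  qed
qed

text \<open>A test path with endpoints on \<open>\<gamma>'\<close> has endpoints near
  \<open>\<gamma>\<close>, so it stays near \<open>\<gamma>\<close>. To return to
  \<open>\<gamma>'\<close>, use the piece of \<open>\<gamma>'\<close> between the endpoints as a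
  second test path: the reverse direction of tracking says that \<open>\<gamma>\<close> stays near
  it.\<close>

lemma morse_on_close:
  assumes M: "morse_on X B I \<gamma>" and \<gamma>: "quasi_geodesic X q0 Q0 I \<gamma>" and I: "is_interval I"
    and q0: "q0 \<ge> 1" "Q0 \<ge> 0" and \<gamma>': "quasi_geodesic X q1 Q1 I' \<gamma>'" and I': "is_interval I'"
    and q1: "q1 \<ge> 1" "Q1 \<ge> 0" and K: "K \<ge> 0" "\<And>x. x \<in> I' \<Longrightarrow> \<exists>y\<in>I. mdist X (\<gamma>' x) (\<gamma> y) \<le> K"
  shows "morse_on X (\<lambda>q Q. track_const B q0 Q0 q Q K + track_const B q0 Q0 q1 Q1 K) I' \<gamma>'"
  unfolding morse_on_def
proof (intro ballI allI impI; elim conjE)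
  fix s' t' q Q a b \<eta> u
  assume *: "s' \<in> I'" "t' \<in> I'" "s' \<le> t'" "(1::real) \<le> q" "(0::real) \<le> Q" "a \<le> b"
    "quasi_geodesic X q Q {a..b} \<eta>" "\<eta> a = \<gamma>' s'" "\<eta> b = \<gamma>' t'" "u \<in> {a..b}"
  obtain s t where st: "s \<in> I" "t \<in> I" "mdist X (\<gamma>' s') (\<gamma> s) \<le> K" "mdist X (\<gamma>' t') (\<gamma> t) \<le> K"
    using K(2) * by blast
  have sub: "{s'..t'} \<subseteq> I'" using mem_is_interval_1_I[OF I' *(1,2)] by auto
  obtain v where v: "v \<in> {min s t..max s t}" "mdist X (\<eta> u) (\<gamma> v) \<le> track_const B q0 Q0 q Q K"
    using morse_on_track(1)[OF M \<gamma> I st(1,2) q0 *(4,5) K(1) *(6,7), of u] * st by auto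
  obtain w where w: "w \<in> {s'..t'}" "mdist X (\<gamma>' w) (\<gamma> v) \<le> track_const B q0 Q0 q1 Q1 K"
    using morse_on_track(2)[OF M \<gamma> I st(1,2) q0 q1 K(1) *(3) quasi_geodesic_subset[OF \<gamma>' sub]
        st(3,4) v(1)] by auto
  have "v \<in> I" using v(1) mem_is_interval_1_I[OF I, of "min s t" "max s t" v] st by (auto simp:
      min_def max_def split: if_splits)
  then have "mdist X (\<eta> u) (\<gamma>' w) \<le> mdist X (\<eta> u) (\<gamma> v) + mdist X (\<gamma>' w) (\<gamma> v)"
    using mdist_triangle[of "\<eta> u" X "\<gamma> v" "\<gamma>' w"] quasi_geodesic_mem[OF \<gamma>, of v]
      quasi_geodesic_mem[OF \<gamma>', of w] quasi_geodesic_mem[OF *(7,10)] sub w(1)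
    by (auto simp: mdist_commute[of X "\<gamma> v"])
  then show "\<exists>w\<in>{s'..t'}. mdist X (\<eta> u) (\<gamma>' w) \<le> track_const B q0 Q0 q Q K + track_const B q0 Q0 q1
      Q1 K"
    using v w by force
qed

section \<open>Nearest points, spliced paths and joined Morse paths\<close>

definition geodesic_metric :: "'p metric \<Rightarrow> bool" where
  "geodesic_metric X \<longleftrightarrow> (\<forall>x\<in>mspace X. \<forall>y\<in>mspace X. \<exists>c. c \<in> {0..mdist X x y} \<rightarrow> mspace X \<and>
     c 0 = x \<and> c (mdist X x y) = y \<and>
     (\<forall>s\<in>{0..mdist X x y}. \<forall>t\<in>{0..mdist X x y}. mdist X (c s) (c t) = \<bar>s - t\<bar>))"

lemma geodesic_metricE:
  assumes "geodesic_metric X" "x \<in> mspace X" "y \<in> mspace X"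
  obtains c where "c \<in> {0..mdist X x y} \<rightarrow> mspace X" "c 0 = x" "c (mdist X x y) = y"
    "\<And>s t. s \<in> {0..mdist X x y} \<Longrightarrow> t \<in> {0..mdist X x y} \<Longrightarrow> mdist X (c s) (c t) = \<bar>s - t\<bar>"
  using assms unfolding geodesic_metric_def by blast

text \<open>A path with jumps need not attain its distance to \<open>x\<close>. The slack 1
  reappears in the constant \<open>Q + 1\<close> of spliced paths.\<close>

lemma almost_nearest_point:
  assumes "I \<noteq> {}"
  shows "\<exists>u\<in>I. \<forall>v\<in>I. mdist X x (\<eta> u) \<le> mdist X x (\<eta> v) + 1"
proof -
  define A where "A = (\<lambda>u. mdist X x (\<eta> u)) ` I"
  have A: "A \<noteq> {}" "bdd_below A" using assms by (auto simp: A_def intro!: bdd_belowI[of _ 0])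
  obtain a where "a \<in> A" "a < Inf A + 1" using cInf_lessD[OF A(1), of "Inf A + 1"] by auto
  moreover have "Inf A \<le> b" if "b \<in> A" for b using that A(2) by (rule cInf_lower)
  ultimately show ?thesis unfolding A_def by force
qed

text \<open>A geodesic \<open>c\<close> of length \<open>L\<close> from \<open>x\<close> to an almost nearest point \<open>\<eta> u\<close>, followed by \<open>\<eta>\<close>.\<close>

definition splice :: "(real \<Rightarrow> 'p) \<Rightarrow> real \<Rightarrow> real \<Rightarrow> (real \<Rightarrow> 'p) \<Rightarrow> real \<Rightarrow> 'p" where
  "splice c L u \<eta> y = (if y < L then c y else \<eta> (y - L + u))"

text \<open>Let \<open>d\<close> be the distance from \<open>c s\<close> to \<open>\<eta> w\<close>.
  Since \<open>\<eta> u\<close> is almost nearest to \<open>x\<close>, the remaining part of the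
  geodesic has length \<open>L - s \<le> d + 1\<close>, so \<open>\<eta> u\<close> and
  \<open>\<eta> w\<close> are within \<open>2 * d + 1\<close>. Turning the latter into parameters
  gives the factor \<open>2 * q + 1\<close>. The domain \<open>J\<close> may be a compact interval
  or a half-line.\<close>

lemma quasi_geodesic_splice:
  assumes \<eta>: "quasi_geodesic X q Q I \<eta>" and q: "q \<ge> 1" "Q \<ge> 0" and u: "u \<in> I"
    and near: "\<And>v. v \<in> I \<Longrightarrow> mdist X x (\<eta> u) \<le> mdist X x (\<eta> v) + 1"
    and L: "L = mdist X x (\<eta> u)" and c: "c \<in> {0..L} \<rightarrow> mspace X" "c 0 = x" "c L = \<eta> u"
      "\<And>s t. s \<in> {0..L} \<Longrightarrow> t \<in> {0..L} \<Longrightarrow> mdist X (c s) (c t) = \<bar>s - t\<bar>"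
    and J: "\<And>y. y \<in> J \<Longrightarrow> 0 \<le> y \<and> (L \<le> y \<longrightarrow> y - L + u \<in> I)"
  shows "quasi_geodesic X (2 * q + 1) (Q + 1) J (splice c L u \<eta>)"
proof (rule quasi_geodesicI)
  have L0: "0 \<le> L" by (simp add: L)
  have qq: "q \<ge> 0" using q by simp
  fix s t assume st: "s \<in> J" "t \<in> J" "s \<le> t"
  have s0: "0 \<le> s" using J st by auto
  have mixed: "t - s \<le> (2 * q + 1) * (mdist X (splice c L u \<eta> s) (splice c L u \<eta> t) + (Q + 1)) \<and>
     mdist X (splice c L u \<eta> s) (splice c L u \<eta> t) \<le> (2 * q + 1) * (t - s) + (Q + 1)"
  proof -
    consider "t < L" | "L \<le> s" | "s < L" "L \<le> t" by linarith
    then show ?thesis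
    proof cases
      case 1
      then have d: "mdist X (splice c L u \<eta> s) (splice c L u \<eta> t) = t - s"
        using c(4)[of s t] s0 st by (auto simp: splice_def)
      have "t - s \<le> (2 * q + 1) * (t - s)" using mult_right_mono[of 1 "2 * q + 1" "t - s"] q st by simp
      moreover have "(2 * q + 1) * (t - s) \<le> (2 * q + 1) * (t - s + (Q + 1))"
        using q by (intro mult_left_mono) auto
      ultimately show ?thesis unfolding d using q by linarith
    next
      case 2
      have I: "s - L + u \<in> I" "t - L + u \<in> I" using J st 2 by auto
      have sp: "splice c L u \<eta> s = \<eta> (s - L + u)" "splice c L u \<eta> t = \<eta> (t - L + u)"
        using 2 st by (auto simp: splice_def)
      define d where "d = mdist X (\<eta> (s - L + u)) (\<eta> (t - L + u))"
      have "0 \<le> d" by (simp add: d_def)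
      have "t - s \<le> q * (d + Q)"
        using quasi_geodesic_lower[OF \<eta> I q(1)] st by (simp add: d_def)
      also have "\<dots> \<le> (2 * q + 1) * (d + (Q + 1))" using q \<open>0 \<le> d\<close> by (intro mult_mono) auto
      finally have 1: "t - s \<le> (2 * q + 1) * (d + (Q + 1))" .
      have "d \<le> q * (t - s) + Q" using quasi_geodesic_upper[OF \<eta> I] st by (simp add: d_def)
      also have "\<dots> \<le> (2 * q + 1) * (t - s) + (Q + 1)"
        using q st by (intro add_mono mult_right_mono) auto
      finally show ?thesis using 1 by (simp add: sp d_def)
    next
      case 3
      define w where "w = t - L + u"
      have w: "w \<in> I" "u \<le> w" "t - s = (L - s) + (w - u)" using J st 3 by (auto simp: w_def)
      have sp: "splice c L u \<eta> s = c s" "splice c L u \<eta> t = \<eta> w"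
        using 3 st by (auto simp: splice_def w_def)
      have mem: "x \<in> mspace X" "c s \<in> mspace X" "\<eta> u \<in> mspace X" "\<eta> w \<in> mspace X"
        using c(1,2) L0 s0 3 quasi_geodesic_mem[OF \<eta>] u w by (auto simp: Pi_iff)
      define d where "d = mdist X (c s) (\<eta> w)"
      have d0: "0 \<le> d" by (simp add: d_def)
      have xs: "mdist X x (c s) = s" using c(4)[of 0 s] c(2) s0 3 by auto
      have su: "mdist X (c s) (\<eta> u) = L - s" using c(4)[of s L] c(3) s0 3 by auto
      have 1: "L - s \<le> d + 1"
        using near[OF w(1)] mdist_triangle[OF mem(1,2,4)] xs L by (simp add: d_def)
      have 2: "mdist X (\<eta> u) (\<eta> w) \<le> 2 * d + 1"
        using mdist_triangle[OF mem(3,2,4)] 1 su by (simp add: d_def mdist_commute[of X "\<eta> u"])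
      have "w - u \<le> q * (mdist X (\<eta> u) (\<eta> w) + Q)"
        using quasi_geodesic_lower[OF \<eta> u w(1) q(1)] w by simp
      also have "\<dots> \<le> q * (2 * d + 1 + Q)" using 2 qq by (intro mult_left_mono) auto
      finally have "t - s \<le> (d + 1) + q * (2 * d + 1 + Q)" using w(3) 1 by linarith
      also have "\<dots> \<le> (2 * q + 1) * (d + (Q + 1))"
        using q mult_nonneg_nonneg[of q Q] by (simp add: algebra_simps)
      finally have 3: "t - s \<le> (2 * q + 1) * (d + (Q + 1))" .
      have "d \<le> (L - s) + mdist X (\<eta> u) (\<eta> w)"
        using mdist_triangle[OF mem(2,3,4)] su by (simp add: d_def)
      also have "\<dots> \<le> (L - s) + (q * (w - u) + Q)"
        using quasi_geodesic_upper[OF \<eta> u w(1)] w by simp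
      also have "\<dots> \<le> (2 * q + 1) * (L - s) + (2 * q + 1) * (w - u) + (Q + 1)"
      proof -
        have "L - s \<le> (2 * q + 1) * (L - s)"
          using mult_right_mono[of 1 "2 * q + 1" "L - s"] q \<open>s < L\<close> by simp
        moreover have "q * (w - u) \<le> (2 * q + 1) * (w - u)" using q w by (intro mult_right_mono) auto
        ultimately show ?thesis by linarith
      qed
      finally show ?thesis using 3 unfolding w(3) sp d_def[symmetric] by (simp add: distrib_left)
    qed
  qed
  then show "t - s \<le> (2 * q + 1) * (mdist X (splice c L u \<eta> s) (splice c L u \<eta> t) + (Q + 1))"
    "mdist X (splice c L u \<eta> s) (splice c L u \<eta> t) \<le> (2 * q + 1) * (t - s) + (Q + 1)" by auto
next
  fix s assume "s \<in> J"
  then show "splice c L u \<eta> s \<in> mspace X"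
    using J[of s] c(1) quasi_geodesic_mem[OF \<eta>] by (auto simp: splice_def Pi_iff)
qed (use q in auto)

lemma nearest_point_path:
  assumes X: "geodesic_metric X" and x: "x \<in> mspace X" and \<eta>: "quasi_geodesic X q Q {a..b} \<eta>"
    and q: "q \<ge> 1" "Q \<ge> 0" and u: "u \<in> {a..b}"
    and near: "\<And>v. v \<in> {a..b} \<Longrightarrow> mdist X x (\<eta> u) \<le> mdist X x (\<eta> v) + 1"
  obtains \<zeta> L where "L = mdist X x (\<eta> u)" "quasi_geodesic X (2 * q + 1) (Q + 1) {0..L + (b - u)} \<zeta>"
      "\<zeta> 0 = x"
    "\<And>w. w \<in> {u..b} \<Longrightarrow> \<zeta> (L + (w - u)) = \<eta> w"
proof -
  define L where "L = mdist X x (\<eta> u)"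
  obtain c where c: "c \<in> {0..L} \<rightarrow> mspace X" "c 0 = x" "c L = \<eta> u"
      "\<And>s t. s \<in> {0..L} \<Longrightarrow> t \<in> {0..L} \<Longrightarrow> mdist X (c s) (c t) = \<bar>s - t\<bar>"
    using geodesic_metricE[OF X x quasi_geodesic_mem[OF \<eta> u]] unfolding L_def by metis
  have "quasi_geodesic X (2 * q + 1) (Q + 1) {0..L + (b - u)} (splice c L u \<eta>)"
    by (rule quasi_geodesic_splice[OF \<eta> q u near L_def c]) (use u in auto)
  moreover have "splice c L u \<eta> 0 = x"
    using c(2,3) by (cases "L = 0") (auto simp: splice_def L_def order_less_le)
  moreover have "splice c L u \<eta> (L + (w - u)) = \<eta> w" if "w \<in> {u..b}" for w
    using that by (auto simp: splice_def)
  ultimately show ?thesis using that L_def by blast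
qed

text \<open>A test path \<open>\<eta>\<close> across \<open>T\<close> is cut at an almost nearest
  point to \<open>r T\<close>. A geodesic from \<open>r T\<close> to this point, followed by either
  half of \<open>\<eta>\<close>, is again quasi-geodesic and has both endpoints on one of the two
  Morse pieces.\<close>

lemma morse_on_join:
  assumes X: "geodesic_metric X" and r: "r \<in> I \<rightarrow> mspace X" and I: "is_interval I" and T: "T \<in> I"
    and M1: "morse_on X B (I \<inter> {..T}) r" and M2: "morse_on X B (I \<inter> {T..}) r"
  shows "morse_on X (\<lambda>q Q. max (max (B (2 * q + 1) (Q + 1)) 0) (B q Q)) I r"
  unfolding morse_on_def
proof (intro ballI allI impI; elim conjE)
  fix s t q Q a b \<eta> w
  assume *: "s \<in> I" "t \<in> I" "s \<le> t" and q: "(1::real) \<le> q" "(0::real) \<le> Q" and ab: "a \<le> b"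
    and \<eta>: "quasi_geodesic X q Q {a..b} \<eta>" and ends: "\<eta> a = r s" "\<eta> b = r t" and w: "w \<in> {a..b}"
  define B' where "B' = max (max (B (2 * q + 1) (Q + 1)) 0) (B q Q)"
  consider "t \<le> T" | "T \<le> s" | "s \<le> T" "T \<le> t" by linarith
  then have "\<exists>v\<in>{s..t}. mdist X (\<eta> w) (r v) \<le> B'"
  proof cases
    case 1
    obtain v where "v \<in> {s..t}" "mdist X (\<eta> w) (r v) \<le> B q Q"
      by (rule morse_onD[OF M1 _ _ *(3) q ab \<eta> ends w]) (use * 1 in auto)
    then show ?thesis unfolding B'_def by force
  next
    case 2
    obtain v where "v \<in> {s..t}" "mdist X (\<eta> w) (r v) \<le> B q Q"
      by (rule morse_onD[OF M2 _ _ *(3) q ab \<eta> ends w]) (use * 2 in auto)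
    then show ?thesis unfolding B'_def by force
  next
    case 3
    have rT: "r T \<in> mspace X" using r T by auto
    obtain u where u: "u \<in> {a..b}" "\<And>v. v \<in> {a..b} \<Longrightarrow> mdist X (r T) (\<eta> u) \<le> mdist X (r T) (\<eta> v) + 1"
      using almost_nearest_point[of "{a..b}" X "r T" \<eta>] ab by auto
    show ?thesis
    proof (cases "u \<le> w")
      case True
      obtain \<zeta> L where \<zeta>: "L = mdist X (r T) (\<eta> u)" "quasi_geodesic X (2 * q + 1) (Q + 1) {0..L + (b
          - u)} \<zeta>"
        "\<zeta> 0 = r T" "\<And>w. w \<in> {u..b} \<Longrightarrow> \<zeta> (L + (w - u)) = \<eta> w"
        using nearest_point_path[OF X rT \<eta> q u] by metis
      have L0: "L \<ge> 0" by (simp add: \<zeta>)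
      obtain v where v: "v \<in> {T..t}" "mdist X (\<zeta> (L + (w - u))) (r v) \<le> B (2 * q + 1) (Q + 1)"
        by (rule morse_onD[OF M2 _ _ 3(2) _ _ _ \<zeta>(2), of "L + (w - u)"])
          (use * 3 T q L0 u w True \<zeta>(3) \<zeta>(4)[of b] ends in auto)
      then show ?thesis using \<zeta>(4)[of w] w True 3
        by (intro bexI[of _ v]) (auto simp: B'_def)
    next
      case False
      define \<eta>' where "\<eta>' = (\<lambda>x. \<eta> (a + b - x))"
      have \<eta>': "quasi_geodesic X q Q {a..b} \<eta>'"
        unfolding \<eta>'_def using \<eta> by (rule quasi_geodesic_reflect) auto
      define u' where "u' = a + b - u"
      have u': "u' \<in> {a..b}" "\<And>v. v \<in> {a..b} \<Longrightarrow> mdist X (r T) (\<eta>' u') \<le> mdist X (r T) (\<eta>' v) + 1"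
        using u(1) u(2)[of "a + b - _"] by (auto simp: u'_def \<eta>'_def)
      obtain \<zeta> L where \<zeta>: "L = mdist X (r T) (\<eta>' u')" "quasi_geodesic X (2 * q + 1) (Q + 1) {0..L +
          (b - u')} \<zeta>"
        "\<zeta> 0 = r T" "\<And>w. w \<in> {u'..b} \<Longrightarrow> \<zeta> (L + (w - u')) = \<eta>' w"
        using nearest_point_path[OF X rT \<eta>' q u'] by metis
      have L0: "L \<ge> 0" by (simp add: \<zeta>)
      have ze: "\<zeta> (L + (b - u')) = r s" using \<zeta>(4)[of b] u' ends by (auto simp: \<eta>'_def)
      have rs: "r s \<in> mspace X" using r * by auto
      \<comment> \<open>The reversed half runs from \<open>r T\<close> back to \<open>r s\<close>.
        The version for unordered endpoints is applied with endpoint error 0, which is where the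
        maximum with 0 comes from.\<close>
      have "\<exists>v\<in>{min T s..max T s}. mdist X (\<zeta> (L + (a + b - w - u'))) (r v)
          \<le> max (B (2 * q + 1) (Q + 1 + 2 * 0)) 0"
        by (rule morse_on_near'[OF M1 _ _ _ _ _ _ _ \<zeta>(2)])
          (use * T q L0 u' w False \<zeta>(3) ze rT rs 3 r in \<open>auto simp: u'_def\<close>)
      then obtain v where "v \<in> {s..T}" "mdist X (\<zeta> (L + (a + b - w - u'))) (r v)
          \<le> max (B (2 * q + 1) (Q + 1)) 0" using 3 by auto
      then show ?thesis using \<zeta>(4)[of "a + b - w"] w False 3
        by (intro bexI[of _ v]) (auto simp: B'_def u'_def \<eta>'_def)
    qed
  qed
  then show "\<exists>v\<in>{s..t}. mdist X (\<eta> w) (r v) \<le> max (max (B (2 * q + 1) (Q + 1)) 0) (B q Q)"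
    by (simp add: B'_def)
qed

section \<open>Quasi-isometries\<close>

text \<open>A symmetric encoding of quasi-isometries: coarsely Lipschitz maps both ways that are
  inverse up to \<open>Q\<close>. The lower bounds follow by going back through the other
  map.\<close>

definition qi_pair :: "'p metric \<Rightarrow> 'q metric \<Rightarrow> ('p \<Rightarrow> 'q) \<Rightarrow> ('q \<Rightarrow> 'p) \<Rightarrow> real \<Rightarrow> real \<Rightarrow> bool" where
  "qi_pair X Y f g q Q \<longleftrightarrow> q \<ge> 1 \<and> Q \<ge> 0 \<and> f \<in> mspace X \<rightarrow> mspace Y \<and> g \<in> mspace Y \<rightarrow> mspace X \<and>
     (\<forall>x\<in>mspace X. \<forall>y\<in>mspace X. mdist Y (f x) (f y) \<le> q * mdist X x y + Q) \<and>
     (\<forall>x\<in>mspace Y. \<forall>y\<in>mspace Y. mdist X (g x) (g y) \<le> q * mdist Y x y + Q) \<and>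
     (\<forall>x\<in>mspace X. mdist X (g (f x)) x \<le> Q) \<and> (\<forall>y\<in>mspace Y. mdist Y (f (g y)) y \<le> Q)"

lemma qi_pair_sym: "qi_pair X Y f g q Q \<Longrightarrow> qi_pair Y X g f q Q"
  by (auto simp: qi_pair_def)

lemma qi_pairD:
  assumes "qi_pair X Y f g q Q"
  shows "q \<ge> 1" "Q \<ge> 0" "\<And>x. x \<in> mspace X \<Longrightarrow> f x \<in> mspace Y" "\<And>y. y \<in> mspace Y \<Longrightarrow> g y \<in> mspace X"
    "\<And>x y. x \<in> mspace X \<Longrightarrow> y \<in> mspace X \<Longrightarrow> mdist Y (f x) (f y) \<le> q * mdist X x y + Q"
    "\<And>x y. x \<in> mspace Y \<Longrightarrow> y \<in> mspace Y \<Longrightarrow> mdist X (g x) (g y) \<le> q * mdist Y x y + Q"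
    "\<And>x. x \<in> mspace X \<Longrightarrow> mdist X (g (f x)) x \<le> Q" "\<And>y. y \<in> mspace Y \<Longrightarrow> mdist Y (f (g y)) y \<le> Q"
  using assms by (auto simp: qi_pair_def)

lemma qi_pair_lower:
  assumes f: "qi_pair X Y f g q Q" and "x \<in> mspace X" "y \<in> mspace X"
  shows "mdist X x y \<le> q * mdist Y (f x) (f y) + 3 * Q"
  using mdist_triangle4[of x X "g (f x)" "g (f y)" y] qi_pairD(3-8)[OF f] assms(2,3)
  by (smt (verit, best) mdist_commute)

lemma quasi_isometric_imp_qi_pair:
  assumes "quasi_isometric X Y"
  obtains f g q Q where "qi_pair X Y f g q Q"
proof -
  obtain f q Q where q: "q \<ge> 1" "Q \<ge> 0" and f: "f \<in> mspace X \<rightarrow> mspace Y"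
    and fl: "\<And>x y. x \<in> mspace X \<Longrightarrow> y \<in> mspace X \<Longrightarrow> mdist X x y / q - Q \<le> mdist Y (f x) (f y)"
    and fu: "\<And>x y. x \<in> mspace X \<Longrightarrow> y \<in> mspace X \<Longrightarrow> mdist Y (f x) (f y) \<le> q * mdist X x y + Q"
    and fs: "\<forall>y\<in>mspace Y. \<exists>x\<in>mspace X. mdist Y (f x) y \<le> Q"
    using assms unfolding quasi_isometric_def by blast
  obtain g where g: "\<And>y. y \<in> mspace Y \<Longrightarrow> g y \<in> mspace X" "\<And>y. y \<in> mspace Y \<Longrightarrow> mdist Y (f (g y)) y \<le> Q"
    using fs by metis
  have fl: "mdist X x y \<le> q * mdist Y (f x) (f y) + q * Q" if "x \<in> mspace X" "y \<in> mspace X" for x y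
    using fl[OF that] q by (simp add: field_simps)
  have qQ: "Q \<le> q * Q" "0 \<le> q * Q" using q mult_right_mono[of 1 q Q] by auto
  have gg: "mdist X (g x) (g y) \<le> q * mdist Y x y + 3 * (q * Q)" if "x \<in> mspace Y" "y \<in> mspace Y"
      for x y
  proof -
    have "mdist Y (f (g x)) (f (g y)) \<le> mdist Y x y + 2 * Q"
      using mdist_triangle4[of "f (g x)" Y x y "f (g y)"] that g f
      by (smt (verit, best) PiE mdist_commute)
    then have "q * mdist Y (f (g x)) (f (g y)) \<le> q * (mdist Y x y + 2 * Q)"
      using q by (intro mult_left_mono) auto
    then show ?thesis using fl[of "g x" "g y"] g that by (simp add: algebra_simps)
  qed
  have gf: "mdist X (g (f x)) x \<le> 3 * (q * Q)" if "x \<in> mspace X" for x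
  proof -
    have "f x \<in> mspace Y" using f that by auto
    then have "q * mdist Y (f (g (f x))) (f x) \<le> q * Q" using g q by (intro mult_left_mono) auto
    then show ?thesis using fl[of "g (f x)" x] g(1) \<open>f x \<in> mspace Y\<close> that qQ by force
  qed
  \<comment> \<open>The constant comes from the Lipschitz bound for \<open>g\<close>:
    \<open>2 * Q\<close> from comparing with \<open>f\<close>-images, multiplied by
    \<open>q\<close>, and another \<open>q * Q\<close> from inverting the lower bound for
    \<open>f\<close>.\<close>
  have "qi_pair X Y f g q (3 * (q * Q))"
    unfolding qi_pair_def
  proof (intro conjI ballI)
    show "mdist Y (f x) (f y) \<le> q * mdist X x y + 3 * (q * Q)" if "x \<in> mspace X" "y \<in> mspace X" for x y
      using fu[OF that] qQ by linarith
    show "mdist Y (f (g y)) y \<le> 3 * (q * Q)" if "y \<in> mspace Y" for y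
      using g(2)[OF that] qQ by linarith
  qed (use q f g gg gf qQ in auto)
  then show ?thesis using that by blast
qed

lemma quasi_geodesic_image:
  assumes f: "qi_pair X Y f g q Q" and \<eta>: "quasi_geodesic X p P I \<eta>" and p: "p \<ge> 1" "P \<ge> 0"
  shows "quasi_geodesic Y (q * p) (q * P + 3 * Q) I (\<lambda>x. f (\<eta> x))"
proof (rule quasi_geodesicI)
  note fd = qi_pairD[OF f] and mem = quasi_geodesic_mem[OF \<eta>]
  show "q * p \<ge> 1" using mult_mono[of 1 q 1 p] fd p by simp
  fix s t assume st: "s \<in> I" "t \<in> I" "s \<le> t"
  define d where "d = mdist Y (f (\<eta> s)) (f (\<eta> t))"
  have "0 \<le> d" by (simp add: d_def)
  have nn: "0 \<le> p * P" "0 \<le> p * Q" "0 \<le> q * P" "0 \<le> p * q" using fd(1,2) p by auto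
  have "t - s \<le> p * (mdist X (\<eta> s) (\<eta> t) + P)"
    using quasi_geodesic_lower[OF \<eta> st(1,2) p(1)] st by simp
  also have "\<dots> \<le> p * (q * d + 3 * Q + P)"
    using qi_pair_lower[OF f mem[OF st(1)] mem[OF st(2)]] p by (intro mult_left_mono) (auto simp: d_def)
  also have "\<dots> \<le> (p * q) * (d + (q * P + 3 * Q))"
  proof -
    have "p * (3 * Q + P) \<le> p * (q * (q * P + 3 * Q))"
    proof (intro mult_left_mono)
      have "P \<le> q * P" using mult_right_mono[of 1 q P] fd(1) p by simp
      then have "3 * Q + P \<le> 1 * (q * P + 3 * Q)" by simp
      also have "\<dots> \<le> q * (q * P + 3 * Q)" using fd(1,2) nn by (intro mult_right_mono) auto
      finally show "3 * Q + P \<le> q * (q * P + 3 * Q)" .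
    qed (use p in auto)
    then show ?thesis by (simp add: algebra_simps)
  qed
  finally show "t - s \<le> (q * p) * (d + (q * P + 3 * Q))" by (simp add: mult.commute)
  have "d \<le> q * mdist X (\<eta> s) (\<eta> t) + Q" using fd(5)[OF mem[OF st(1)] mem[OF st(2)]] by (simp add:
      d_def)
  also have "\<dots> \<le> q * (p * (t - s) + P) + Q"
    using quasi_geodesic_upper[OF \<eta> st(1,2)] st(3) fd(1) by (intro add_mono mult_left_mono) auto
  also have "\<dots> \<le> (q * p) * (t - s) + (q * P + 3 * Q)" using fd(2) by (simp add: algebra_simps)
  finally show "d \<le> (q * p) * (t - s) + (q * P + 3 * Q)" .
qed (use quasi_geodesic_mem[OF \<eta>] qi_pairD[OF f] in auto)

text \<open>Test paths in \<open>Y\<close> are pulled back by \<open>g\<close>: this gives the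
  constants \<open>q * p\<close> and \<open>q * P + 3 * Q\<close>, with endpoints within
  \<open>Q\<close> of \<open>\<gamma>\<close>, hence the extra \<open>2 * Q\<close> and the maximum
  with \<open>Q\<close>. Pushing forward by \<open>f\<close> multiplies by \<open>q\<close> and adds
  \<open>Q\<close>, and the error of \<open>f\<close> after \<open>g\<close> is another
  \<open>Q\<close>.\<close>

definition image_bound :: "real \<Rightarrow> real \<Rightarrow> (real \<Rightarrow> real \<Rightarrow> real) \<Rightarrow> real \<Rightarrow> real \<Rightarrow> real" where
  "image_bound q Q B = (\<lambda>p P. q * max (B (q * p) (q * P + 3 * Q + 2 * Q)) Q + 2 * Q)"

lemma morse_on_image:
  assumes f: "qi_pair X Y f g q Q" and M: "morse_on X B I \<gamma>" and \<gamma>: "\<gamma> \<in> I \<rightarrow> mspace X" and I: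
      "is_interval I"
  shows "morse_on Y (image_bound q Q B) I (\<lambda>t. f (\<gamma> t))"
  unfolding morse_on_def
proof (intro ballI allI impI; elim conjE)
  note fd = qi_pairD[OF f]
  fix s t p P a b \<eta> w
  assume *: "s \<in> I" "t \<in> I" "s \<le> t" and p: "(1::real) \<le> p" "(0::real) \<le> P" and ab: "a \<le> b"
    and \<eta>: "quasi_geodesic Y p P {a..b} \<eta>" and ends: "\<eta> a = f (\<gamma> s)" "\<eta> b = f (\<gamma> t)" and w: "w \<in> {a..b}"
  define D where "D = max (B (q * p) (q * P + 3 * Q + 2 * Q)) Q"
  have qg: "quasi_geodesic X (q * p) (q * P + 3 * Q) {a..b} (\<lambda>x. g (\<eta> x))"
    by (rule quasi_geodesic_image[OF qi_pair_sym[OF f] \<eta> p])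
  have "1 \<le> q * p" using mult_mono[of 1 q 1 p] fd(1) p by simp
  moreover have "0 \<le> q * P + 3 * Q" using fd(1,2) p by auto
  moreover have "mdist X (g (\<eta> a)) (\<gamma> s) \<le> Q" "mdist X (g (\<eta> b)) (\<gamma> t) \<le> Q"
    using ends fd(7) \<gamma> * by auto
  ultimately obtain v where v: "v \<in> {s..t}" "mdist X (g (\<eta> w)) (\<gamma> v) \<le> D"
    using morse_on_near[OF M \<gamma> * _ _ fd(2) ab qg _ _ w] unfolding D_def by blast
  have vI: "v \<in> I" using mem_is_interval_1_I[OF I *(1,2)] v(1) by auto
  have mem: "\<eta> w \<in> mspace Y" "\<gamma> v \<in> mspace X" "g (\<eta> w) \<in> mspace X"
    using quasi_geodesic_mem[OF \<eta> w] \<gamma> vI fd(4) by auto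
  have "mdist Y (\<eta> w) (f (\<gamma> v)) \<le> mdist Y (f (g (\<eta> w))) (\<eta> w) + mdist Y (f (g (\<eta> w))) (f (\<gamma> v))"
    using mdist_triangle[of "\<eta> w" Y "f (g (\<eta> w))" "f (\<gamma> v)"] mem fd(3) by (simp add:
        mdist_commute[of Y "\<eta> w"])
  also have "\<dots> \<le> Q + (q * D + Q)"
    using fd(8)[OF mem(1)] fd(5)[OF mem(3,2)] mult_left_mono[OF v(2), of q] fd(1) by linarith
  finally show "\<exists>v\<in>{s..t}. mdist Y (\<eta> w) (f (\<gamma> v)) \<le> image_bound q Q B p P"
    using v(1) by (intro bexI[of _ v]) (auto simp: image_bound_def D_def)
qed

section \<open>Morse gauges\<close>

text \<open>An arbitrary \<open>B\<close> can be unbounded on compact intervals, so only its values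
  at integers are dominated: their absolute values are summed to a monotone step function, which is
  then integrated to become continuous. The bound on \<open>M 3 0\<close> will make
  \<open>morse_delta M\<close> as large as desired.\<close>

lemma morse_gauge_above:
  "\<exists>M. morse_gauge M \<and> (\<forall>q. \<forall>Q\<ge>0. B q (real_of_int \<lceil>Q\<rceil>) \<le> M q Q) \<and> K \<le> M 3 0"
proof -
  define F where "F q x = (\<Sum>i\<le>nat \<lceil>x\<rceil>. \<bar>B q (real i)\<bar>) + \<bar>K\<bar>" for q x :: real
  have F0: "0 \<le> F q x" for q x unfolding F_def by (intro add_nonneg_nonneg sum_nonneg) auto
  have Fmono: "F q x \<le> F q y" if "x \<le> y" for q x y
    unfolding F_def using nat_mono[OF ceiling_mono[OF that]] by (intro add_mono sum_mono2) auto
  have FK: "K \<le> F q x" for q x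
    unfolding F_def using sum_nonneg[of "{..nat \<lceil>x\<rceil>}" "\<lambda>i. \<bar>B q (real i)\<bar>"] by linarith
  have FB: "B q (real_of_int \<lceil>x\<rceil>) \<le> F q x" if "x \<ge> 0" for q x
  proof -
    have "\<bar>B q (real (nat \<lceil>x\<rceil>))\<bar> \<le> (\<Sum>i\<le>nat \<lceil>x\<rceil>. \<bar>B q (real i)\<bar>)"
      by (rule member_le_sum) auto
    then show ?thesis using that by (simp add: F_def)
  qed
  have int: "F q integrable_on {a..b}" for q a b
    by (intro integrable_on_mono_on mono_onI Fmono)
  \<comment> \<open>Integrating up to \<open>Q + 1\<close> keeps \<open>M q Q\<close> above
    \<open>F q Q\<close>: already the last unit interval contributes that much, by
    monotonicity.\<close>
  define M where "M q Q = integral {0..Q + 1} (F q)" for q Q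
  have F_le: "F q Q \<le> M q Q" if "Q \<ge> 0" for q Q
  proof -
    have "F q Q = integral {Q..Q + 1} (\<lambda>_. F q Q)" by simp
    also have "\<dots> \<le> integral {Q..Q + 1} (F q)" by (intro integral_le int) (auto intro: Fmono)
    also have "\<dots> \<le> M q Q" unfolding M_def using that F0 by (intro integral_subset_le int) auto
    finally show ?thesis .
  qed
  have "morse_gauge M"
    unfolding morse_gauge_def
  proof (intro allI impI conjI)
    fix q Q :: real assume "Q \<ge> 0"
    then show "0 \<le> M q Q" using F_le[of Q q] F0[of q Q] by linarith
  next
    fix q :: real
    show "mono_on {0..} (M q)"
      unfolding M_def by (intro mono_onI integral_subset_le int) (use F0 in auto)
    have "continuous_on {0..b} (M q)" for b
    proof -
      have "continuous_on {0..b + 1} (\<lambda>x. integral {0..x} (F q))"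
        by (intro indefinite_integral_continuous_1 int)
      moreover have "continuous_on {0..b} (\<lambda>x. x + 1 :: real)" by (intro continuous_intros)
      ultimately have "continuous_on {0..b} (\<lambda>x. integral {0..x + 1} (F q))"
        by (rule continuous_on_compose2) auto
      then show ?thesis by (simp add: M_def)
    qed
    then have *: "continuous_on ({0..} \<inter> {..<b}) (M q)" for b
      by (rule continuous_on_subset[of "{0..b}"]) auto
    show "continuous_on {0..} (M q)"
    proof -
      have "continuous (at x within {0..}) (M q)" if "x \<ge> 0" for x
      proof -
        have "continuous (at x within ({0..} \<inter> {..<x + 1})) (M q)"
          using *[of "x + 1"] that by (auto simp: continuous_on_eq_continuous_within)
        moreover have "at x within ({0..} \<inter> {..<x + 1}) = at x within {0..}"
          by (rule at_within_nhd[of x "{..<x + 1}"]) auto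
        ultimately show ?thesis by simp
      qed
      then show ?thesis by (auto simp: continuous_on_eq_continuous_within)
    qed
  qed
  moreover have "B q (real_of_int \<lceil>Q\<rceil>) \<le> M q Q" if "Q \<ge> 0" for q Q
    using FB[OF that] F_le[OF that] by (rule order_trans)
  moreover have "K \<le> M 3 0" using FK F_le[of 0 3] by (rule order_trans) simp
  ultimately show ?thesis by blast
qed

section \<open>From Morse gauges to arbitrary bounds and back\<close>

lemma closed_nbhd_iff:
  assumes "A \<subseteq> mspace X"
  shows "x \<in> closed_nbhd X r A \<longleftrightarrow> x \<in> mspace X \<and> A \<noteq> {} \<and> (\<forall>\<epsilon>>0. \<exists>a\<in>A. mdist X x a < r + \<epsilon>)"
proof -
  have bdd: "bdd_below ((\<lambda>a. mdist X x a) ` A)" by (intro bdd_belowI[of _ 0]) auto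
  have "(INF a\<in>A. mdist X x a) \<le> r \<longleftrightarrow> (\<forall>\<epsilon>>0. \<exists>a\<in>A. mdist X x a < r + \<epsilon>)" if "A \<noteq> {}"
  proof
    assume *: "(INF a\<in>A. mdist X x a) \<le> r"
    show "\<forall>\<epsilon>>0. \<exists>a\<in>A. mdist X x a < r + \<epsilon>"
    proof (intro allI impI)
      fix \<epsilon> :: real assume "\<epsilon> > 0"
      then have "(INF a\<in>A. mdist X x a) < r + \<epsilon>" using * by linarith
      then show "\<exists>a\<in>A. mdist X x a < r + \<epsilon>" using cInf_lessD[of "(\<lambda>a. mdist X x a) ` A"] that by blast
    qed
  next
    assume *: "\<forall>\<epsilon>>0. \<exists>a\<in>A. mdist X x a < r + \<epsilon>"
    show "(INF a\<in>A. mdist X x a) \<le> r"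
    proof (rule field_le_epsilon)
      fix \<epsilon> :: real assume "\<epsilon> > 0"
      then obtain a where "a \<in> A" "mdist X x a < r + \<epsilon>" using * by blast
      then show "(INF a\<in>A. mdist X x a) \<le> r + \<epsilon>" using cINF_lower[OF bdd \<open>a \<in> A\<close>] by linarith
    qed
  qed
  then show ?thesis by (auto simp: closed_nbhd_def)
qed

text \<open>The infimum in \<open>closed_nbhd\<close> need not be attained; the added 1 buys an
  actual point.\<close>

lemma is_morse_imp_morse_on:
  assumes "is_morse X M I \<gamma>" "\<gamma> \<in> I \<rightarrow> mspace X" "is_interval I"
  shows "morse_on X (\<lambda>q Q. M q Q + 1) I \<gamma>"
  unfolding morse_on_def
proof (intro ballI allI impI; elim conjE)
  fix s t q Q a b \<eta> u
  assume *: "s \<in> I" "t \<in> I" "s \<le> t" "(1::real) \<le> q" "(0::real) \<le> Q" "a \<le> b"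
    "quasi_geodesic X q Q {a..b} \<eta>" "\<eta> a = \<gamma> s" "\<eta> b = \<gamma> t" "u \<in> {a..b}"
  have "\<eta> u \<in> closed_nbhd X (M q Q) (\<gamma> ` {s..t})"
    using assms(1) * unfolding is_morse_def by blast
  moreover have "\<gamma> ` {s..t} \<subseteq> mspace X"
    using mem_is_interval_1_I[OF assms(3) *(1,2)] assms(2) by auto
  ultimately obtain v where "v \<in> {s..t}" "mdist X (\<eta> u) (\<gamma> v) < M q Q + 1"
    unfolding closed_nbhd_iff[OF \<open>\<gamma> ` {s..t} \<subseteq> mspace X\<close>] using zero_less_one by blast
  then show "\<exists>v\<in>{s..t}. mdist X (\<eta> u) (\<gamma> v) \<le> M q Q + 1" by force
qed

text \<open>The gauge is chosen before space and path, so a family with a common bound lands in one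
  stratum. The additive constant of a test path is first rounded up to an integer, where the gauge
  dominates \<open>B\<close>.\<close>

lemma morse_on_imp_is_morse:
  "\<exists>M. morse_gauge M \<and> K \<le> M 3 0 \<and> (\<forall>(X :: 'p metric) I \<gamma>.
     morse_on X B I \<gamma> \<longrightarrow> \<gamma> \<in> I \<rightarrow> mspace X \<longrightarrow> is_interval I \<longrightarrow> is_morse X M I \<gamma>)"
proof -
  obtain M where M: "morse_gauge M" "\<And>q Q. Q \<ge> 0 \<Longrightarrow> B q (real_of_int \<lceil>Q\<rceil>) \<le> M q Q" "K \<le> M 3 0"
    using morse_gauge_above[where B = B and K = K] by blast
  have "is_morse X M I \<gamma>" if \<gamma>: "morse_on X B I \<gamma>" "\<gamma> \<in> I \<rightarrow> mspace X" "is_interval I"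
    for X :: "'p metric" and I \<gamma>
    unfolding is_morse_def
  proof (intro ballI allI impI subsetI; elim conjE imageE)
    fix s t q Q a b \<eta> u y
    assume *: "s \<in> I" "t \<in> I" "s \<le> t" "(1::real) \<le> q" "(0::real) \<le> Q" "a \<le> b"
      "quasi_geodesic X q Q {a..b} \<eta>" "\<eta> a = \<gamma> s" "\<eta> b = \<gamma> t" "u \<in> {a..b}" and y: "y = \<eta> u"
    have "quasi_geodesic X q (real_of_int \<lceil>Q\<rceil>) {a..b} \<eta>"
      using *(7) *(4) by (rule quasi_geodesic_weaken) auto
    moreover have "0 \<le> real_of_int \<lceil>Q\<rceil>" using *(5) by linarith
    ultimately obtain v where v: "v \<in> {s..t}" "mdist X (\<eta> u) (\<gamma> v) \<le> B q (real_of_int \<lceil>Q\<rceil>)"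
      using morse_onD[OF \<gamma>(1) *(1-4) _ *(6) _ *(8-10)] by blast
    then have "mdist X (\<eta> u) (\<gamma> v) \<le> M q Q" using M(2)[OF *(5), of q] by linarith
    moreover have "\<gamma> ` {s..t} \<subseteq> mspace X"
      using mem_is_interval_1_I[OF \<gamma>(3) *(1,2)] \<gamma>(2) by auto
    ultimately show "y \<in> closed_nbhd X (M q Q) (\<gamma> ` {s..t})"
      using v(1) quasi_geodesic_mem[OF *(7,10)] by (force simp: closed_nbhd_iff y)
  qed
  then show ?thesis using M(1,3) by blast
qed

section \<open>Limits of geodesic rays\<close>

definition proper_metric :: "'p metric \<Rightarrow> bool" where
  "proper_metric X \<longleftrightarrow> (\<forall>x\<in>mspace X. \<forall>r. compactin (mtopology_of X) (mcball_of X x r))"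

text \<open>In a product with uncountably many factors compactness does not provide convergent
  subsequences, but a cluster point exists: otherwise finitely many open sets, each avoided from
  some index on, would cover \<open>K\<close>.\<close>

lemma compactin_cluster_point:
  assumes K: "compactin T K" and f: "\<And>n::nat. f n \<in> K"
  shows "\<exists>g\<in>K. \<forall>U. openin T U \<and> g \<in> U \<longrightarrow> (\<forall>m. \<exists>n\<ge>m. f n \<in> U)"
proof (rule ccontr)
  assume "\<not> ?thesis"
  then obtain U m where U: "\<And>g. g \<in> K \<Longrightarrow> openin T (U g) \<and> g \<in> U g \<and> (\<forall>n\<ge>m g. f n \<notin> U g)"
    by metis
  then have "(\<forall>V\<in>U ` K. openin T V) \<and> K \<subseteq> \<Union>(U ` K)" by blast
  from conjunct2[OF K[unfolded compactin_def], THEN spec, THEN mp, OF this]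
  obtain G where G: "finite G" "G \<subseteq> K" "K \<subseteq> (\<Union>g\<in>G. U g)"
    by (metis finite_subset_image)
  define n where "n = Max (insert 0 (m ` G))"
  have "m g \<le> n" if "g \<in> G" for g using that G(1) by (auto simp: n_def intro!: Max_ge)
  then have "f n \<notin> (\<Union>g\<in>G. U g)" using U G(2) by blast
  then show False using f[of n] G(3) by blast
qed

lemma strict_mono_choice:
  assumes "\<And>n m. \<exists>k\<ge>m. P n (k::nat)"
  obtains \<rho> :: "nat \<Rightarrow> nat" where "strict_mono \<rho>" "\<And>n. P n (\<rho> n)"
proof -
  have "\<exists>\<rho>. \<forall>n. P n (\<rho> n) \<and> \<rho> n < \<rho> (Suc n)"
  proof (rule dependent_nat_choice)
    show "\<exists>x. P 0 x" using assms by blast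
    show "\<exists>y. P (Suc n) y \<and> x < y" for x n using assms[of "Suc x" "Suc n"] by (auto simp: Suc_le_eq)
  qed
  then show ?thesis using that by (auto simp: strict_mono_Suc_iff)
qed

text \<open>Arzela-Ascoli from Tychonoff: the paths lie in the product of the balls of radius
  \<open>t\<close> about \<open>e\<close>. A cluster point is approximated at finitely many times by
  arbitrarily late paths; the Lipschitz bounds turn a fine finite set of times into a whole
  interval, and a diagonal choice gives the subsequence.\<close>

lemma Lipschitz_paths_subsequence:
  assumes X: "proper_metric X" and e: "e \<in> mspace X"
    and f: "\<And>n t. t \<ge> 0 \<Longrightarrow> f n t \<in> mspace X" "\<And>n. f n 0 = e"
      "\<And>n s t. s \<ge> 0 \<Longrightarrow> t \<ge> 0 \<Longrightarrow> mdist X (f n s) (f n t) \<le> \<bar>s - t\<bar>"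
  obtains g and \<rho> :: "nat \<Rightarrow> nat" where "g \<in> {0..} \<rightarrow> mspace X" "g 0 = e" "strict_mono \<rho>"
    "\<And>s t. s \<ge> 0 \<Longrightarrow> t \<ge> 0 \<Longrightarrow> mdist X (g s) (g t) \<le> \<bar>s - t\<bar>"
    "\<And>n t. t \<in> {0..real n} \<Longrightarrow> mdist X (f (\<rho> n) t) (g t) \<le> 1 / (real n + 1)"
proof -
  define C where "C t = mcball_of X e t" for t
  define P where "P = product_topology (\<lambda>_::real. mtopology_of X) {0..}"
  have "compactin P (PiE {0..} C)"
    unfolding P_def compactin_PiE using X e by (auto simp: C_def proper_metric_def)
  moreover have "restrict (f n) {0..} \<in> PiE {0..} C" for n
    using f(1)[of _ n] f(3)[of 0 _ n] f(2)[of n] e by (auto simp: C_def)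
  ultimately obtain g where g: "g \<in> PiE {0..} C"
    and cl: "\<And>U m. openin P U \<Longrightarrow> g \<in> U \<Longrightarrow> \<exists>n\<ge>m. restrict (f n) {0..} \<in> U"
    using compactin_cluster_point[of P "PiE {0..} C" "\<lambda>n. restrict (f n) {0..}"] by metis
  have gm: "g t \<in> mspace X" if "t \<ge> 0" for t using g that by (auto simp: C_def PiE_iff)
  have fin: "\<exists>n\<ge>m. \<forall>t\<in>T. mdist X (f n t) (g t) < \<epsilon>"
    if T: "finite T" "T \<subseteq> {0..}" and \<epsilon>: "\<epsilon> > 0" for T \<epsilon> and m :: nat
  proof -
    define V where "V t = (if t \<in> T then mball_of X (g t) \<epsilon> else mspace X)" for t
    have "finite {t \<in> {0..}. V t \<noteq> topspace (mtopology_of X)}"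
      by (rule finite_subset[OF _ T(1)]) (auto simp: V_def)
    moreover have "openin (mtopology_of X) (V t)" for t
    proof (cases "t \<in> T")
      case True
      then show ?thesis
        by (simp add: V_def mball_of_def mtopology_of_def Metric_space.openin_mball)
    next
      case False
      have "openin (mtopology_of X) (topspace (mtopology_of X))" by (rule openin_topspace)
      then show ?thesis using False by (simp add: V_def)
    qed
    ultimately have "openin P (PiE {0..} V)" unfolding P_def openin_PiE_gen by auto
    moreover have "g \<in> PiE {0..} V" using g gm T \<epsilon> by (auto simp: V_def PiE_iff)
    ultimately obtain n where "n \<ge> m" "restrict (f n) {0..} \<in> PiE {0..} V" using cl by blast
    have "mdist X (f n t) (g t) < \<epsilon>" if t: "t \<in> T" for t
    proof -
      have "f n t \<in> V t" using \<open>restrict (f n) {0..} \<in> PiE {0..} V\<close> t T(2) by (auto simp: PiE_iff)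
      then show ?thesis using t by (simp add: V_def mdist_commute)
    qed
    then show ?thesis using \<open>n \<ge> m\<close> by blast
  qed
  have gL: "mdist X (g s) (g t) \<le> \<bar>s - t\<bar>" if st: "s \<ge> 0" "t \<ge> 0" for s t
  proof (rule field_le_epsilon)
    fix \<epsilon> :: real assume "\<epsilon> > 0"
    then obtain n where n: "\<forall>t\<in>{s, t}. mdist X (f n t) (g t) < \<epsilon> / 2"
      using fin[of "{s, t}" "\<epsilon> / 2" 0] st by auto
    then show "mdist X (g s) (g t) \<le> \<bar>s - t\<bar> + \<epsilon>"
      using mdist_triangle4[of "g s" X "f n s" "f n t" "g t"] gm f(1) f(3)[of s t n] st
      by (auto simp: mdist_commute[of X "g s" "f n s"])
  qed
  have "\<exists>k\<ge>m. \<forall>t\<in>{0..real n}. mdist X (f k t) (g t) \<le> 1 / (real n + 1)" for n m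
  proof -
    \<comment> \<open>A third of the tolerance: one share each for moving along \<open>f k\<close>
      to the grid, for the error at the grid point, and for moving back along
      \<open>g\<close>.\<close>
    define \<delta> where "\<delta> = 1 / (3 * (real n + 1))"
    have \<delta>: "\<delta> > 0" "1 / (real n + 1) = 3 * \<delta>" by (auto simp: \<delta>_def divide_simps)
    define T where "T = (\<lambda>i. real i * \<delta>) ` {..nat \<lceil>real n / \<delta>\<rceil>}"
    have "finite T" "T \<subseteq> {0..}" using \<delta> by (auto simp: T_def)
    then obtain k where k: "k \<ge> m" "\<forall>t\<in>T. mdist X (f k t) (g t) < \<delta>"
      using fin \<delta>(1) by blast
    have "mdist X (f k t) (g t) \<le> 3 * \<delta>" if t: "t \<in> {0..real n}" for t
    proof -
      define s where "s = real (nat \<lfloor>t / \<delta>\<rfloor>) * \<delta>"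
      have "t / \<delta> \<le> real n / \<delta>" using t \<delta> by (simp add: divide_right_mono)
      then have "nat \<lfloor>t / \<delta>\<rfloor> \<le> nat \<lceil>real n / \<delta>\<rceil>" by linarith
      then have sT: "s \<in> T" by (auto simp: s_def T_def)
      have s0: "0 \<le> s" "0 \<le> t" using \<delta> t by (auto simp: s_def)
      have fl: "real (nat \<lfloor>t / \<delta>\<rfloor>) = real_of_int \<lfloor>t / \<delta>\<rfloor>" using t \<delta> by (simp add: zero_le_divide_iff)
      have "real_of_int \<lfloor>t / \<delta>\<rfloor> * \<delta> \<le> t / \<delta> * \<delta>" using \<delta> by (intro mult_right_mono) auto
      moreover have "t / \<delta> * \<delta> \<le> (real_of_int \<lfloor>t / \<delta>\<rfloor> + 1) * \<delta>" using \<delta> by (intro mult_right_mono)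
          linarith+
      ultimately have "\<bar>t - s\<bar> \<le> \<delta>" using \<delta> unfolding s_def fl by (auto simp: distrib_right)
      then show ?thesis
        using mdist_triangle4[of "f k t" X "f k s" "g s" "g t"] gm s0 f(1) f(3)[OF s0(2,1), of k]
            gL[OF s0] k(2) sT
        by (auto simp: abs_minus_commute)
    qed
    then show ?thesis using k(1) \<delta>(2) by auto
  qed
  then obtain \<rho> where "strict_mono \<rho>" "\<And>n. \<forall>t\<in>{0..real n}. mdist X (f (\<rho> n) t) (g t) \<le> 1 / (real n + 1)"
    using strict_mono_choice[of "\<lambda>n k. \<forall>t\<in>{0..real n}. mdist X (f k t) (g t) \<le> 1 / (real n + 1)"] by
        metis
  moreover have "g 0 = e"
  proof -
    have "mdist X e (g 0) \<le> 0"
    proof (rule field_le_epsilon)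
      fix \<epsilon> :: real assume "\<epsilon> > 0"
      then show "mdist X e (g 0) \<le> 0 + \<epsilon>" using fin[of "{0}" \<epsilon> 0] f(2) by auto
    qed
    then have "mdist X e (g 0) = 0" using mdist_nonneg[of X e "g 0"] by linarith
    then show ?thesis using gm[of 0] e by simp
  qed
  ultimately show ?thesis using that[of g \<rho>] gm gL by auto
qed

lemma geodesic_rayD:
  assumes "geodesic_ray X c"
  shows "\<And>t. t \<ge> 0 \<Longrightarrow> c t \<in> mspace X" "\<And>s t. s \<ge> 0 \<Longrightarrow> t \<ge> 0 \<Longrightarrow> mdist X (c s) (c t) = \<bar>s - t\<bar>"
    "c \<in> {0..} \<rightarrow> mspace X"
  using assms by (auto simp: geodesic_ray_def)

lemma geodesic_ray_quasi_geodesic: "geodesic_ray X c \<Longrightarrow> quasi_geodesic X 1 0 {0..} c"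
  by (auto simp: geodesic_ray_def quasi_geodesic_def)

lemma geodesic_rays_limit:
  assumes c: "\<And>n. geodesic_ray X (c n)" and g: "g \<in> {0..} \<rightarrow> mspace X"
    and lim: "\<And>n t. t \<in> {0..real n} \<Longrightarrow> mdist X (c n t) (g t) \<le> 1 / (real n + 1)"
  shows "geodesic_ray X g"
  unfolding geodesic_ray_def
proof (intro conjI g allI impI)
  fix s t :: real assume st: "s \<ge> 0" "t \<ge> 0"
  have "\<bar>mdist X (g s) (g t) - \<bar>s - t\<bar>\<bar> \<le> 0"
  proof (rule field_le_epsilon)
    fix \<epsilon> :: real assume \<epsilon>: "\<epsilon> > 0"
    obtain n where n: "real n > max (max s t) (2 / \<epsilon>)" using reals_Archimedean2 by blast
    have "2 / \<epsilon> < real n + 1" using n by simp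
    then have "1 / (real n + 1) \<le> \<epsilon> / 2" using \<epsilon> by (simp add: field_simps)
    then have "mdist X (c n s) (g s) \<le> \<epsilon> / 2" "mdist X (c n t) (g t) \<le> \<epsilon> / 2"
      using lim[of s n] lim[of t n] st n by auto
    moreover have "g s \<in> mspace X" "g t \<in> mspace X" using g st by auto
    ultimately show "\<bar>mdist X (g s) (g t) - \<bar>s - t\<bar>\<bar> \<le> 0 + \<epsilon>"
      using mdist_triangle4[of "g s" X "c n s" "c n t" "g t"] mdist_triangle4[of "c n s" X "g s" "g
          t" "c n t"]
        geodesic_rayD(1)[OF c[of n]] geodesic_rayD(2)[OF c[of n] st] st
      by (auto simp: mdist_commute[of X "g s" "c n s"] mdist_commute[of X "g t" "c n t"])
  qed
  then show "mdist X (g s) (g t) = \<bar>s - t\<bar>" by simp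
qed

text \<open>Between the given times some \<open>c n\<close> is within 1 of \<open>g\<close>.
  Endpoint error 1 costs \<open>Q + 2\<close> and the maximum with 1; returning to \<open>g\<close>
  costs another 1.\<close>

lemma morse_rays_limit:
  assumes c: "\<And>n. geodesic_ray X (c n)" "\<And>n. morse_on X B {0..} (c n)" and g: "g \<in> {0..} \<rightarrow> mspace X"
    and lim: "\<And>n t. t \<in> {0..real n} \<Longrightarrow> mdist X (c n t) (g t) \<le> 1 / (real n + 1)"
  shows "morse_on X (\<lambda>q Q. max (B q (Q + 2)) 1 + 1) {0..} g"
  unfolding morse_on_def
proof (intro ballI allI impI; elim conjE)
  fix s t q Q a b \<eta> u
  assume *: "s \<in> {0..}" "t \<in> {0..}" "s \<le> t" "(1::real) \<le> q" "(0::real) \<le> Q" "a \<le> b"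
    "quasi_geodesic X q Q {a..b} \<eta>" "\<eta> a = g s" "\<eta> b = g t" "u \<in> {a..b}"
  obtain n where n: "real n > t" using reals_Archimedean2 by blast
  have l: "mdist X (g x) (c n x) \<le> 1" if "x \<in> {0..t}" for x
  proof -
    have "1 / (real n + 1) \<le> 1" by simp
    moreover have "mdist X (c n x) (g x) \<le> 1 / (real n + 1)" using lim[of x n] that n by auto
    ultimately show ?thesis unfolding mdist_commute[of X "g x"] by (rule order_trans[rotated])
  qed
  obtain v where v: "v \<in> {s..t}" "mdist X (\<eta> u) (c n v) \<le> max (B q (Q + 2 * 1)) 1"
    using morse_on_near[OF c(2) geodesic_rayD(3)[OF c(1)] *(1-5) _ *(6,7) _ _ *(10), of 1 n] * l by auto
  have "mdist X (\<eta> u) (g v) \<le> mdist X (\<eta> u) (c n v) + mdist X (c n v) (g v)"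
    using quasi_geodesic_mem[OF *(7,10)] v(1) * geodesic_rayD(1)[OF c(1)] g by (intro
        mdist_triangle) auto
  then have "mdist X (\<eta> u) (g v) \<le> max (B q (Q + 2)) 1 + 1"
    using v l[of v] * by (auto simp: mdist_commute[of X "c n v"])
  then show "\<exists>v\<in>{s..t}. mdist X (\<eta> u) (g v) \<le> max (B q (Q + 2)) 1 + 1" using v(1) by blast
qed

text \<open>Hausdorff closeness with an explicit constant and without matching the times, so that
  uniform statements about families of rays can be made.\<close>

definition fellow :: "'p metric \<Rightarrow> real \<Rightarrow> (real \<Rightarrow> 'p) \<Rightarrow> (real \<Rightarrow> 'p) \<Rightarrow> bool" where
  "fellow X D \<alpha> \<beta> \<longleftrightarrow> (\<forall>t\<ge>0. \<exists>u\<ge>0. mdist X (\<alpha> t) (\<beta> u) \<le> D) \<and> (\<forall>u\<ge>0. \<exists>t\<ge>0. mdist X (\<alpha> t) (\<beta> u) \<le> D)"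

text \<open>Geodesics have constants 1 and 0, so \<open>track_const\<close> bounds their distance to
  \<open>r\<close> when the starting points differ by \<open>K\<close>; the added 1 pays for passing
  to the limit. \<open>realisation_bound\<close> is then the bound that
  \<open>morse_on_close\<close> gives at this distance.\<close>

definition realisation_const :: "(real \<Rightarrow> real \<Rightarrow> real) \<Rightarrow> real \<Rightarrow> real \<Rightarrow> real \<Rightarrow> real" where
  "realisation_const B q Q K = track_const B q Q 1 0 K + 1"

definition realisation_bound :: "(real \<Rightarrow> real \<Rightarrow> real) \<Rightarrow> real \<Rightarrow> real \<Rightarrow> real \<Rightarrow> real \<Rightarrow> real \<Rightarrow> real" where
  "realisation_bound B q Q K = (\<lambda>p P. track_const B q Q p P (realisation_const B q Q K)
     + track_const B q Q 1 0 (realisation_const B q Q K))"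

definition morse_ray_from :: "'p metric \<Rightarrow> 'p \<Rightarrow> (real \<Rightarrow> real \<Rightarrow> real) \<Rightarrow> (real \<Rightarrow> 'p) \<Rightarrow> bool" where
  "morse_ray_from X e B c \<longleftrightarrow> geodesic_ray X c \<and> c 0 = e \<and> morse_on X B {0..} c"

text \<open>The ray is a limit of geodesics from \<open>e\<close> to \<open>r n\<close>, which stay uniformly close to \<open>r\<close>.\<close>

lemma morse_ray_realisation:
  assumes X: "proper_metric X" "geodesic_metric X" and r: "quasi_geodesic X q Q {0..} r"
    and M: "morse_on X B {0..} r" and q: "q \<ge> 1" "Q \<ge> 0" and K: "K \<ge> 0" "mdist X e (r 0) \<le> K"
    and e: "e \<in> mspace X"
  obtains c where "morse_ray_from X e (realisation_bound B q Q K) c" "fellow X (realisation_const B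
      q Q K) c r"
proof -
  define D where "D = track_const B q Q 1 0 K"
  define L where "L n = mdist X e (r (real n))" for n
  note rm = quasi_geodesic_mem[OF r]
  have L0: "0 \<le> L n" for n by (simp add: L_def)
  have "\<exists>c. c \<in> {0..L n} \<rightarrow> mspace X \<and> c 0 = e \<and> c (L n) = r (real n) \<and>
     (\<forall>s\<in>{0..L n}. \<forall>t\<in>{0..L n}. mdist X (c s) (c t) = \<bar>s - t\<bar>)" for n
    using X(2) e rm[of "real n"] unfolding geodesic_metric_def L_def by auto
  then obtain c where c: "\<And>n. c n \<in> {0..L n} \<rightarrow> mspace X" "\<And>n. c n 0 = e" "\<And>n. c n (L n) = r (real n)"
    "\<And>n s t. s \<in> {0..L n} \<Longrightarrow> t \<in> {0..L n} \<Longrightarrow> mdist X (c n s) (c n t) = \<bar>s - t\<bar>" by metis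
  have qc: "quasi_geodesic X 1 0 {0..L n} (c n)" for n
    using c(1)[of n] c(4)[of _ n] by (auto simp: quasi_geodesic_def)
  have ends: "mdist X (c n 0) (r 0) \<le> K" "mdist X (c n (L n)) (r (real n)) \<le> K" for n
    using K rm[of "real n"] c(2,3)[of n] by auto
  have track1: "\<exists>v\<ge>0. mdist X (c n t) (r v) \<le> D" if "t \<in> {0..L n}" for n t
    using morse_on_track(1)[OF M r is_interval_ci _ _ q _ _ K(1) L0 qc ends that] by (force simp: D_def)
  have track2: "\<exists>t\<in>{0..L n}. mdist X (c n t) (r v) \<le> D" if "v \<in> {0..real n}" for n v
    using morse_on_track(2)[OF M r is_interval_ci _ _ q _ _ K(1) L0 qc ends, where v = v] that by
        (auto simp: D_def)
  \<comment> \<open>The geodesics stop at their endpoints, so that all of them are 1-Lipschitz paths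
    on the half-line.\<close>
  define f where "f n t = c n (min t (L n))" for n t
  have f1: "f n t \<in> mspace X" if "t \<ge> 0" for n t using c(1)[of n] that L0[of n] by (auto simp: f_def
      Pi_iff)
  have f2: "f n 0 = e" for n using c(2)[of n] L0[of n] by (auto simp: f_def min_def)
  have f3: "mdist X (f n s) (f n t) \<le> \<bar>s - t\<bar>" if "s \<ge> 0" "t \<ge> 0" for n s t
    using c(4)[of "min s (L n)" n "min t (L n)"] that L0[of n] by (auto simp: f_def)
  obtain g \<rho> where g: "g \<in> {0..} \<rightarrow> mspace X" and g0: "g 0 = e" and g': "strict_mono \<rho>"
    "\<And>s t. s \<ge> 0 \<Longrightarrow> t \<ge> 0 \<Longrightarrow> mdist X (g s) (g t) \<le> \<bar>s - t\<bar>"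
    "\<And>n t. t \<in> {0..real n} \<Longrightarrow> mdist X (f (\<rho> n) t) (g t) \<le> 1 / (real n + 1)"
    by (rule Lipschitz_paths_subsequence[OF X(1) e, of f]) (use f1 f2 f3 in auto)
  have near: "mdist X (f (\<rho> n) t) (g t) \<le> 1" if "t \<in> {0..real n}" for n t
  proof -
    have "1 / (real n + 1) \<le> 1" by simp
    then show ?thesis using g'(3)[OF that] by linarith
  qed
  have \<rho>: "n \<le> \<rho> n" for n using g'(1) by (rule strict_mono_imp_increasing)
  have gd: "mdist X (g s) (g t) \<ge> \<bar>s - t\<bar>" if st: "s \<ge> 0" "t \<ge> 0" for s t
  proof (rule field_le_epsilon)
    fix \<epsilon> :: real assume \<epsilon>: "\<epsilon> > 0"
    \<comment> \<open>The last requirement pushes \<open>L (\<rho> n)\<close> beyond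
      \<open>s\<close> and \<open>t\<close>, as \<open>r\<close> leaves every ball at a linear rate.
      So the path has not yet stopped at these times and is still geodesic.\<close>
    obtain n where n: "real n > max (max s t) (max (2 / \<epsilon>) (q * (max s t + K + Q)))" using
        reals_Archimedean2 by blast
    have "2 / \<epsilon> < real n + 1" using n by simp
    then have "1 / (real n + 1) \<le> \<epsilon> / 2" using \<epsilon> by (simp add: field_simps)
    then have 1: "mdist X (f (\<rho> n) s) (g s) \<le> \<epsilon> / 2" "mdist X (f (\<rho> n) t) (g t) \<le> \<epsilon> / 2"
      using g'(3)[of s n] g'(3)[of t n] st n by auto
    have "real n \<le> real (\<rho> n)" using \<rho> by simp
    also have "\<dots> \<le> q * (mdist X (r 0) (r (real (\<rho> n))) + Q)"
      using quasi_geodesic_lower[OF r, of 0 "real (\<rho> n)"] q by simp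
    also have "\<dots> \<le> q * (L (\<rho> n) + K + Q)"
      using mdist_triangle[of "r 0" X e "r (real (\<rho> n))"] e rm[of 0] rm[of "real (\<rho> n)"] K q
      by (intro mult_left_mono) (auto simp: L_def mdist_commute[of X "r 0" e])
    finally have "q * (max s t + K + Q) < q * (L (\<rho> n) + K + Q)" using n by linarith
    then have "max s t < L (\<rho> n)" using q by simp
    then have "mdist X (f (\<rho> n) s) (f (\<rho> n) t) = \<bar>s - t\<bar>"
      using c(4)[of s "\<rho> n" t] st by (auto simp: f_def)
    moreover have "g s \<in> mspace X" "g t \<in> mspace X" using g st by auto
    ultimately show "\<bar>s - t\<bar> \<le> mdist X (g s) (g t) + \<epsilon>"
      using mdist_triangle4[of "f (\<rho> n) s" X "g s" "g t" "f (\<rho> n) t"] f1 st 1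
      by (auto simp: mdist_commute[of X "g t" "f (\<rho> n) t"])
  qed
  have ray: "geodesic_ray X g"
    unfolding geodesic_ray_def using g g'(2) gd by (auto intro: order_antisym)
  have gr: "\<exists>v\<ge>0. mdist X (g t) (r v) \<le> D + 1" if t0: "t \<ge> 0" for t
  proof -
    obtain n where n: "real n > t" using reals_Archimedean2 by blast
    obtain v where v: "v \<ge> 0" "mdist X (f (\<rho> n) t) (r v) \<le> D"
      using track1[of "min t (L (\<rho> n))" "\<rho> n"] t0 L0[of "\<rho> n"] by (auto simp: f_def)
    have "mdist X (g t) (r v) \<le> D + 1"
      using mdist_triangle[of "g t" X "f (\<rho> n) t" "r v"] near[of t n] v f1[OF t0] rm[of v] Pi_mem[OF
          g, of t] t0 n
      by (auto simp: mdist_commute[of X "g t" "f (\<rho> n) t"])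
    then show ?thesis using v by blast
  qed
  have rg: "\<exists>t\<ge>0. mdist X (g t) (r v) \<le> D + 1" if v0: "v \<ge> 0" for v
  proof -
    \<comment> \<open>The geodesic is near \<open>r v\<close> at a time of at most
      \<open>mdist X e (r v) + D\<close>. This does not depend on the geodesic, so it falls into the
      interval where the approximation of \<open>g\<close> holds.\<close>
    obtain n where n: "real n > max v (mdist X e (r v) + D)" using reals_Archimedean2 by blast
    then obtain t where t: "t \<in> {0..L (\<rho> n)}" "mdist X (c (\<rho> n) t) (r v) \<le> D"
      using track2[of v "\<rho> n"] v0 \<rho>[of n] by fastforce
    have cm: "c (\<rho> n) t \<in> mspace X" using c(1)[of "\<rho> n"] t by auto
    have "t = mdist X e (c (\<rho> n) t)" using c(4)[of 0 "\<rho> n" t] c(2)[of "\<rho> n"] t L0 by auto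
    also have "\<dots> \<le> mdist X e (r v) + D"
      using mdist_triangle[of e X "r v" "c (\<rho> n) t"] t e rm[of v] v0 cm by (auto simp:
          mdist_commute[of X "r v"])
    finally have "t \<in> {0..real n}" using n t by auto
    then have "mdist X (g t) (r v) \<le> D + 1"
      using near[of t n] mdist_triangle[of "g t" X "f (\<rho> n) t" "r v"] t Pi_mem[OF g, of t] rm[of v]
          v0 cm
      by (auto simp: f_def mdist_commute[of X "g t"])
    then show ?thesis using t by auto
  qed
  have D: "D \<ge> 0" unfolding D_def using track_const_ge(2)[OF q, of 1 0 K B] K by simp
  have "morse_on X (realisation_bound B q Q K) {0..} g"
    unfolding realisation_bound_def
    by (rule morse_on_close[OF M r _ q geodesic_ray_quasi_geodesic[OF ray]])
      (use D gr in \<open>auto simp: realisation_const_def D_def[symmetric] is_interval_ci\<close>)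
  then show ?thesis using that[of g] ray g0 gr rg
    by (auto simp: fellow_def realisation_const_def D_def[symmetric] morse_ray_from_def)
qed

section \<open>Boundary points\<close>

definition asymptotic :: "'p metric \<Rightarrow> (real \<Rightarrow> 'p) \<Rightarrow> (real \<Rightarrow> 'p) \<Rightarrow> bool" where
  "asymptotic X \<alpha> \<beta> \<longleftrightarrow> (\<exists>D. fellow X D \<alpha> \<beta>)"

lemma fellow_sym: "fellow X D \<alpha> \<beta> \<Longrightarrow> fellow X D \<beta> \<alpha>"
  by (auto simp: fellow_def mdist_commute)

lemma asymptotic_sym: "asymptotic X \<alpha> \<beta> \<Longrightarrow> asymptotic X \<beta> \<alpha>"
  by (auto simp: asymptotic_def intro: fellow_sym)

lemma asymptotic_refl: "\<alpha> \<in> {0..} \<rightarrow> mspace X \<Longrightarrow> asymptotic X \<alpha> \<alpha>"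
  unfolding asymptotic_def fellow_def by (intro exI[of _ 0]) (auto simp: Pi_iff intro!: exI)

lemma asymptotic_trans:
  assumes "asymptotic X \<alpha> \<beta>" "asymptotic X \<beta> \<gamma>"
    and m: "\<alpha> \<in> {0..} \<rightarrow> mspace X" "\<beta> \<in> {0..} \<rightarrow> mspace X" "\<gamma> \<in> {0..} \<rightarrow> mspace X"
  shows "asymptotic X \<alpha> \<gamma>"
proof -
  obtain D E where D: "fellow X D \<alpha> \<beta>" and E: "fellow X E \<beta> \<gamma>"
    using assms by (auto simp: asymptotic_def)
  have tri: "mdist X (\<alpha> t) (\<gamma> v) \<le> D + E"
    if "t \<ge> 0" "u \<ge> 0" "v \<ge> 0" "mdist X (\<alpha> t) (\<beta> u) \<le> D" "mdist X (\<beta> u) (\<gamma> v) \<le> E" for t u v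
    using mdist_triangle[of "\<alpha> t" X "\<beta> u" "\<gamma> v"] that m by fastforce
  have "fellow X (D + E) \<alpha> \<gamma>"
    unfolding fellow_def
  proof (intro conjI allI impI)
    fix t :: real assume t: "t \<ge> 0"
    obtain u where u: "u \<ge> 0" "mdist X (\<alpha> t) (\<beta> u) \<le> D" using D t by (auto simp: fellow_def)
    obtain v where "v \<ge> 0" "mdist X (\<beta> u) (\<gamma> v) \<le> E" using E u by (auto simp: fellow_def)
    then show "\<exists>v\<ge>0. mdist X (\<alpha> t) (\<gamma> v) \<le> D + E" using tri t u by blast
  next
    fix v :: real assume v: "v \<ge> 0"
    obtain u where u: "u \<ge> 0" "mdist X (\<beta> u) (\<gamma> v) \<le> E" using E v by (auto simp: fellow_def)
    obtain t where "t \<ge> 0" "mdist X (\<alpha> t) (\<beta> u) \<le> D" using D u by (auto simp: fellow_def)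
    then show "\<exists>t\<ge>0. mdist X (\<alpha> t) (\<gamma> v) \<le> D + E" using tri v u by blast
  qed
  then show ?thesis by (auto simp: asymptotic_def)
qed

lemma hausdorff_close_iff_asymptotic:
  assumes m: "\<alpha> \<in> {0..} \<rightarrow> mspace X" "\<beta> \<in> {0..} \<rightarrow> mspace X"
  shows "hausdorff_close X (\<alpha> ` {0..}) (\<beta> ` {0..}) \<longleftrightarrow> asymptotic X \<alpha> \<beta>"
proof
  have sub: "\<alpha> ` {0..} \<subseteq> mspace X" "\<beta> ` {0..} \<subseteq> mspace X" using m by auto
  assume "hausdorff_close X (\<alpha> ` {0..}) (\<beta> ` {0..})"
  then obtain K where K: "\<alpha> ` {0..} \<subseteq> closed_nbhd X K (\<beta> ` {0..})" "\<beta> ` {0..} \<subseteq> closed_nbhd X K (\<alpha> `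
      {0..})"
    by (auto simp: hausdorff_close_def)
  have "\<exists>u\<ge>0. mdist X (\<alpha> t) (\<beta> u) \<le> K + 1" if "t \<ge> 0" for t
  proof -
    have "\<exists>a\<in>\<beta> ` {0..}. mdist X (\<alpha> t) a < K + 1" using K(1) that closed_nbhd_iff[OF sub(2)]
        zero_less_one by blast
    then show ?thesis by force
  qed
  moreover have "\<exists>u\<ge>0. mdist X (\<alpha> u) (\<beta> t) \<le> K + 1" if "t \<ge> 0" for t
  proof -
    have "\<exists>a\<in>\<alpha> ` {0..}. mdist X (\<beta> t) a < K + 1" using K(2) that closed_nbhd_iff[OF sub(1)]
        zero_less_one by blast
    then show ?thesis by (force simp: mdist_commute)
  qed
  ultimately show "asymptotic X \<alpha> \<beta>" by (auto simp: asymptotic_def fellow_def)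
next
  have sub: "\<alpha> ` {0..} \<subseteq> mspace X" "\<beta> ` {0..} \<subseteq> mspace X" using m by auto
  assume "asymptotic X \<alpha> \<beta>"
  then obtain D where D: "\<And>t. t \<ge> 0 \<Longrightarrow> \<exists>u\<ge>0. mdist X (\<alpha> t) (\<beta> u) \<le> D"
    "\<And>u. u \<ge> 0 \<Longrightarrow> \<exists>t\<ge>0. mdist X (\<alpha> t) (\<beta> u) \<le> D" by (auto simp: asymptotic_def fellow_def)
  have "\<alpha> t \<in> closed_nbhd X D (\<beta> ` {0..})" "\<beta> t \<in> closed_nbhd X D (\<alpha> ` {0..})" if "t \<ge> 0" for t
    using D(1)[OF that] D(2)[OF that] m that unfolding closed_nbhd_iff[OF sub(1)] closed_nbhd_iff[OF
        sub(2)]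
    by (force simp: mdist_commute)+
  then show "hausdorff_close X (\<alpha> ` {0..}) (\<beta> ` {0..})" by (auto simp: hausdorff_close_def)
qed

text \<open>For rays with a common start, times are distances to the start, so the times of two
  points within \<open>D\<close> differ by at most \<open>D\<close>.\<close>

lemma geodesic_rays_synchronise:
  assumes "geodesic_ray X \<alpha>" "geodesic_ray X \<beta>" "\<alpha> 0 = \<beta> 0" "t \<ge> 0" "u \<ge> 0" "mdist X (\<alpha> t) (\<beta> u) \<le> D"
  shows "mdist X (\<alpha> t) (\<beta> t) \<le> 2 * D"
proof -
  note a = geodesic_rayD[OF assms(1)] and b = geodesic_rayD[OF assms(2)]
  have m: "\<alpha> 0 \<in> mspace X" "\<alpha> t \<in> mspace X" "\<beta> u \<in> mspace X" "\<beta> t \<in> mspace X" using a b assms by auto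
  have "\<bar>t - u\<bar> \<le> D"
    using mdist_triangle[of "\<alpha> 0" X "\<alpha> t" "\<beta> u"] mdist_triangle[of "\<alpha> 0" X "\<beta> u" "\<alpha> t"] m
      a(2)[of 0 t] b(2)[of 0 u] assms by (auto simp: mdist_commute[of X "\<beta> u" "\<alpha> t"])
  then show ?thesis using mdist_triangle[of "\<alpha> t" X "\<beta> u" "\<beta> t"] m b(2)[of u t] assms by auto
qed

lemma morse_ray_from_mem: "morse_ray_from X e B \<gamma> \<Longrightarrow> \<gamma> \<in> {0..} \<rightarrow> mspace X"
  by (auto simp: morse_ray_from_def dest: geodesic_rayD(3))

lemma morse_geodesic_ray_iff:
  "morse_geodesic_ray X \<gamma>' \<and> \<gamma>' 0 = e \<longleftrightarrow> (\<exists>B. morse_ray_from X e B \<gamma>')"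
proof
  assume *: "morse_geodesic_ray X \<gamma>' \<and> \<gamma>' 0 = e"
  then obtain M where "geodesic_ray X \<gamma>'" "is_morse X M {0..} \<gamma>'" by (auto simp: morse_geodesic_ray_def)
  then show "\<exists>B. morse_ray_from X e B \<gamma>'"
    using is_morse_imp_morse_on[of X M "{0..}" \<gamma>'] geodesic_rayD(3) * by (auto simp:
        morse_ray_from_def is_interval_ci)
next
  assume "\<exists>B. morse_ray_from X e B \<gamma>'"
  then obtain B where B: "geodesic_ray X \<gamma>'" "\<gamma>' 0 = e" "morse_on X B {0..} \<gamma>'" by (auto simp:
      morse_ray_from_def)
  obtain M where "morse_gauge M" "is_morse X M {0..} \<gamma>'"
    using morse_on_imp_is_morse[of 0 B] B(3) geodesic_rayD(3)[OF B(1)] is_interval_ci by metis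
  then show "morse_geodesic_ray X \<gamma>' \<and> \<gamma>' 0 = e"
    using B by (auto simp: morse_geodesic_ray_def)
qed

lemma morse_class_alt:
  assumes "\<gamma> \<in> {0..} \<rightarrow> mspace X"
  shows "morse_class X e \<gamma> = {\<gamma>'. (\<exists>B. morse_ray_from X e B \<gamma>') \<and> asymptotic X \<gamma>' \<gamma>}"
proof -
  have "hausdorff_close X (\<gamma>' ` {0..}) (\<gamma> ` {0..}) \<longleftrightarrow> asymptotic X \<gamma>' \<gamma>"
    if "morse_ray_from X e B \<gamma>'" for \<gamma>' B
    using hausdorff_close_iff_asymptotic[OF morse_ray_from_mem[OF that] assms] .
  then show ?thesis unfolding morse_class_def using morse_geodesic_ray_iff[of X _ e] by blast
qed

lemma morse_class_cong:
  assumes "asymptotic X \<alpha> \<beta>" "\<alpha> \<in> {0..} \<rightarrow> mspace X" "\<beta> \<in> {0..} \<rightarrow> mspace X"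
  shows "morse_class X e \<alpha> = morse_class X e \<beta>"
  unfolding morse_class_alt[OF assms(2)] morse_class_alt[OF assms(3)]
  using asymptotic_trans[of X _ \<alpha> \<beta>] asymptotic_trans[of X _ \<beta> \<alpha>] assms asymptotic_sym[OF assms(1)]
  by (auto simp: morse_ray_from_def dest: geodesic_rayD(3))

lemma morse_ray_in_class: "morse_ray_from X e B \<gamma> \<Longrightarrow> \<gamma> \<in> morse_class X e \<gamma>"
  by (auto simp: morse_class_alt morse_ray_from_mem asymptotic_refl)

lemma morse_class_eqD:
  assumes "morse_class X e \<alpha> = morse_class X e \<beta>" "morse_ray_from X e B \<alpha>" "\<beta> \<in> {0..} \<rightarrow> mspace X"
  shows "asymptotic X \<alpha> \<beta>"
  using morse_ray_in_class[OF assms(2)] assms(1) morse_class_alt[OF assms(3)] by auto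

lemma morse_ray_from_is_morse:
  assumes "N \<in> {N. morse_gauge N}" "\<gamma> \<in> morse_rays X e N"
  shows "morse_ray_from X e (\<lambda>q Q. N q Q + 1) \<gamma>"
  using assms is_morse_imp_morse_on[of X N "{0..}" \<gamma>] geodesic_rayD(3)
  by (auto simp: morse_ray_from_def is_interval_ci morse_rays_def)

text \<open>All rays with bound \<open>B\<close> lie in one stratum whose \<open>morse_delta\<close>
  is at least \<open>K\<close>, since that constant is at least \<open>8 * N 3 0\<close>.\<close>

lemma morse_ray_from_gauge:
  "\<exists>N. morse_gauge N \<and> K \<le> N 3 0 \<and>
     (\<forall>(X :: 'p metric) e \<gamma>. morse_ray_from X e B \<gamma> \<longrightarrow> \<gamma> \<in> morse_rays X e N)"
proof -
  obtain N where N: "morse_gauge N" "K \<le> N 3 0"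
    and M: "\<forall>(X :: 'p metric) I \<gamma>. morse_on X B I \<gamma> \<longrightarrow> \<gamma> \<in> I \<rightarrow> mspace X \<longrightarrow> is_interval I \<longrightarrow> is_morse X
        N I \<gamma>"
    using morse_on_imp_is_morse[of K B] by blast
  have "\<gamma> \<in> morse_rays X e N" if "morse_ray_from X e B \<gamma>" for X :: "'p metric" and e \<gamma>
    using M that geodesic_rayD(3)[of X \<gamma>] is_interval_ci[of 0] by (auto simp: morse_rays_def
        morse_ray_from_def)
  then show ?thesis using N by blast
qed

lemma in_topspace_morse_boundary:
  "x \<in> topspace (morse_boundary X e) \<longleftrightarrow> (\<exists>B \<gamma>. morse_ray_from X e B \<gamma> \<and> x = morse_class X e \<gamma>)"
proof
  assume "x \<in> topspace (morse_boundary X e)"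
  then show "\<exists>B \<gamma>. morse_ray_from X e B \<gamma> \<and> x = morse_class X e \<gamma>"
    using morse_ray_from_is_morse by (fastforce simp: topspace_morse_boundary morse_stratum_def)
next
  assume "\<exists>B \<gamma>. morse_ray_from X e B \<gamma> \<and> x = morse_class X e \<gamma>"
  then obtain B \<gamma> where *: "morse_ray_from X e B \<gamma>" "x = morse_class X e \<gamma>" by blast
  obtain N where "morse_gauge N" "\<gamma> \<in> morse_rays X e N"
    using morse_ray_from_gauge[of 0 B] *(1) by metis
  then show "x \<in> topspace (morse_boundary X e)"
    using *(2) by (auto simp: topspace_morse_boundary morse_stratum_def)
qed

text \<open>Since \<open>morse_delta N\<close> is unbounded as \<open>N\<close> grows, the topology of the direct limit can be
  described with any constant \<open>K\<close> in its place.\<close>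

lemma openin_morse_boundary_iff:
  fixes X :: "'p metric"
  shows "openin (morse_boundary X e) U \<longleftrightarrow> U \<subseteq> topspace (morse_boundary X e) \<and>
     (\<forall>B K \<gamma>. morse_ray_from X e B \<gamma> \<and> morse_class X e \<gamma> \<in> U \<longrightarrow>
       (\<exists>k::nat. \<forall>c. morse_ray_from X e B c \<and> (\<forall>t\<in>{0..real k}. mdist X (\<gamma> t) (c t) \<le> K) \<longrightarrow>
           morse_class X e c \<in> U))"
    (is "_ \<longleftrightarrow> _ \<and> ?R")
proof
  assume U: "openin (morse_boundary X e) U"
  have ?R
  proof (intro allI impI; elim conjE)
    fix B K \<gamma> assume \<gamma>: "morse_ray_from X e B \<gamma>" "morse_class X e \<gamma> \<in> U"
    obtain N where N: "morse_gauge N" "K \<le> N 3 0" "\<And>\<gamma>. morse_ray_from X e B \<gamma> \<Longrightarrow> \<gamma> \<in> morse_rays X e N"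
      using morse_ray_from_gauge[of K B, where 'p = 'p] by blast
    have "0 \<le> N 3 0" using N(1) by (auto simp: morse_gauge_def)
    then have K: "K \<le> morse_delta N" using N(2) by (auto simp: morse_delta_def)
    have "openin (stratum_topology X e N) (U \<inter> morse_stratum X e N)"
      using U N(1) by (auto simp: openin_morse_boundary)
    moreover have "morse_class X e \<gamma> \<in> U \<inter> morse_stratum X e N"
      using \<gamma> N(3) by (auto simp: morse_stratum_def)
    ultimately obtain k where k: "stratum_nbhd X e N k \<gamma> \<subseteq> U"
      using N(3)[OF \<gamma>(1)] unfolding openin_stratum_topology by blast
    have "morse_class X e c \<in> U"
      if c: "morse_ray_from X e B c" "\<forall>t\<in>{0..real k}. mdist X (\<gamma> t) (c t) \<le> K" for c
      using k c(2) K N(3)[OF c(1)] unfolding stratum_nbhd_def by fastforce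
    then show "\<exists>k::nat. \<forall>c. morse_ray_from X e B c \<and> (\<forall>t\<in>{0..real k}. mdist X (\<gamma> t) (c t) \<le> K) \<longrightarrow>
        morse_class X e c \<in> U"
      by blast
  qed
  then show "U \<subseteq> topspace (morse_boundary X e) \<and> ?R" using openin_subset[OF U] by blast
next
  assume U: "U \<subseteq> topspace (morse_boundary X e) \<and> ?R"
  show "openin (morse_boundary X e) U"
    unfolding openin_morse_boundary openin_stratum_topology
  proof (intro conjI allI impI ballI)
    show "U \<subseteq> (\<Union>N\<in>Collect morse_gauge. morse_stratum X e N)" using U by (simp add:
        topspace_morse_boundary)
    fix N \<gamma> assume N: "morse_gauge N" and \<gamma>: "\<gamma> \<in> morse_rays X e N" "morse_class X e \<gamma> \<in> U \<inter>
        morse_stratum X e N"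
    \<comment> \<open>Here the criterion is used with the bound \<open>N + 1\<close>, which all rays
      of the stratum satisfy, and with \<open>K = morse_delta N\<close>.\<close>
    obtain k :: nat where k: "\<And>c. morse_ray_from X e (\<lambda>q Q. N q Q + 1) c \<Longrightarrow>
        (\<forall>t\<in>{0..real k}. mdist X (\<gamma> t) (c t) \<le> morse_delta N) \<Longrightarrow> morse_class X e c \<in> U"
      using U morse_ray_from_is_morse[of N \<gamma> X e] N \<gamma> by blast
    have "stratum_nbhd X e N k \<gamma> \<subseteq> U \<inter> morse_stratum X e N"
      using k morse_ray_from_is_morse[of N _ X e] N by (auto simp: stratum_nbhd_def morse_stratum_def)
    then show "\<exists>k. stratum_nbhd X e N k \<gamma> \<subseteq> U \<inter> morse_stratum X e N" ..
  qed auto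
qed

section \<open>Maps induced by quasi-isometries\<close>

text \<open>All representatives of a boundary point yield the same class, which is therefore the
  union. The form is that of \<open>boundary_action\<close>, which becomes the case of a
  translation.\<close>

definition boundary_map :: "'q metric \<Rightarrow> 'q \<Rightarrow> ('p \<Rightarrow> 'q) \<Rightarrow> (real \<Rightarrow> 'p) set \<Rightarrow> (real \<Rightarrow> 'q) set" where
  "boundary_map Y e' f c = (\<Union>\<gamma>\<in>c. morse_class Y e' (\<lambda>t. f (\<gamma> t)))"

lemma fellow_map:
  assumes "fellow X D \<alpha> \<beta>"
    and "\<And>t u. t \<ge> 0 \<Longrightarrow> u \<ge> 0 \<Longrightarrow> mdist X (\<alpha> t) (\<beta> u) \<le> D \<Longrightarrow> mdist Y (\<alpha>' t) (\<beta>' u) \<le> D'"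
  shows "fellow Y D' \<alpha>' \<beta>'"
  unfolding fellow_def
proof (intro conjI allI impI)
  fix t :: real assume t: "t \<ge> 0"
  then obtain u where "u \<ge> 0" "mdist X (\<alpha> t) (\<beta> u) \<le> D" using assms(1) by (auto simp: fellow_def)
  then show "\<exists>u\<ge>0. mdist Y (\<alpha>' t) (\<beta>' u) \<le> D'" using assms(2) t by blast
next
  fix u :: real assume u: "u \<ge> 0"
  then obtain t where "t \<ge> 0" "mdist X (\<alpha> t) (\<beta> u) \<le> D" using assms(1) by (auto simp: fellow_def)
  then show "\<exists>t\<ge>0. mdist Y (\<alpha>' t) (\<beta>' u) \<le> D'" using assms(2) u by blast
qed

lemma asymptotic_image:
  assumes f: "qi_pair X Y f g q Q" and a: "asymptotic X \<alpha> \<beta>"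
    and m: "\<alpha> \<in> {0..} \<rightarrow> mspace X" "\<beta> \<in> {0..} \<rightarrow> mspace X"
  shows "asymptotic Y (\<lambda>t. f (\<alpha> t)) (\<lambda>t. f (\<beta> t))"
proof -
  obtain D where D: "fellow X D \<alpha> \<beta>" using a by (auto simp: asymptotic_def)
  have "mdist Y (f (\<alpha> t)) (f (\<beta> u)) \<le> q * D + Q"
    if "t \<ge> 0" "u \<ge> 0" "mdist X (\<alpha> t) (\<beta> u) \<le> D" for t u
  proof -
    have "q * mdist X (\<alpha> t) (\<beta> u) \<le> q * D" using that qi_pairD(1)[OF f] by (intro mult_left_mono) auto
    then show ?thesis using qi_pairD(5)[OF f, of "\<alpha> t" "\<beta> u"] that m by fastforce
  qed
  then have "fellow Y (q * D + Q) (\<lambda>t. f (\<alpha> t)) (\<lambda>t. f (\<beta> t))"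
    by (rule fellow_map[OF D])
  then show ?thesis by (auto simp: asymptotic_def)
qed

lemma boundary_map_class:
  assumes f: "qi_pair X Y f g q Q" and \<gamma>: "\<gamma> \<in> {0..} \<rightarrow> mspace X" "morse_class X e \<gamma> \<noteq> {}"
  shows "boundary_map Y e' f (morse_class X e \<gamma>) = morse_class Y e' (\<lambda>t. f (\<gamma> t))"
proof -
  have "morse_class Y e' (\<lambda>t. f (\<gamma>' t)) = morse_class Y e' (\<lambda>t. f (\<gamma> t))" if c: "\<gamma>' \<in> morse_class X
      e \<gamma>" for \<gamma>'
  proof (rule morse_class_cong)
    obtain B where "morse_ray_from X e B \<gamma>'" "asymptotic X \<gamma>' \<gamma>"
      using c unfolding morse_class_alt[OF \<gamma>(1)] by blast
    then have *: "asymptotic X \<gamma>' \<gamma>" "\<gamma>' \<in> {0..} \<rightarrow> mspace X" by (auto dest: morse_ray_from_mem)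
    then show "asymptotic Y (\<lambda>t. f (\<gamma>' t)) (\<lambda>t. f (\<gamma> t))" by (intro asymptotic_image[OF f] \<gamma>)
    show "(\<lambda>t. f (\<gamma>' t)) \<in> {0..} \<rightarrow> mspace Y" "(\<lambda>t. f (\<gamma> t)) \<in> {0..} \<rightarrow> mspace Y"
      using * \<gamma> qi_pairD(3)[OF f] by auto
  qed
  then show ?thesis using \<gamma>(2) unfolding boundary_map_def by blast
qed

text \<open>\<open>B'\<close> and \<open>D\<close> serve all rays with bound \<open>B\<close> at
  once, as continuity on a stratum requires.\<close>

lemma morse_ray_image:
  assumes f: "qi_pair X Y f g q Q" and Y: "proper_metric Y" "geodesic_metric Y" and e: "e \<in> mspace
      X" "e' \<in> mspace Y"
  shows "\<exists>B' D. \<forall>\<gamma>. morse_ray_from X e B \<gamma> \<longrightarrow>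
    (\<exists>\<gamma>'. morse_ray_from Y e' B' \<gamma>' \<and> fellow Y D \<gamma>' (\<lambda>t. f (\<gamma> t)))"
proof (rule exI, rule exI, intro allI impI)
  fix \<gamma> assume \<gamma>: "morse_ray_from X e B \<gamma>"
  note fd = qi_pairD[OF f]
  have qg: "quasi_geodesic Y (q * 1) (q * 0 + 3 * Q) {0..} (\<lambda>t. f (\<gamma> t))"
    by (rule quasi_geodesic_image[OF f geodesic_ray_quasi_geodesic]) (use \<gamma> in \<open>auto simp:
        morse_ray_from_def\<close>)
  have M: "morse_on Y (image_bound q Q B) {0..} (\<lambda>t. f (\<gamma> t))"
    using \<gamma> by (intro morse_on_image[OF f] morse_ray_from_mem[OF \<gamma>] is_interval_ci) (auto simp:
        morse_ray_from_def)
  have K: "mdist Y e' (f (\<gamma> 0)) \<le> mdist Y e' (f e)" using \<gamma> by (simp add: morse_ray_from_def)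
  show "\<exists>\<gamma>'. morse_ray_from Y e' (realisation_bound (image_bound q Q B) (q * 1) (q * 0 + 3 * Q)
      (mdist Y e' (f e))) \<gamma>' \<and>
     fellow Y (realisation_const (image_bound q Q B) (q * 1) (q * 0 + 3 * Q) (mdist Y e' (f e))) \<gamma>'
         (\<lambda>t. f (\<gamma> t))"
    by (rule morse_ray_realisation[OF Y qg M _ _ mdist_nonneg K e(2)]) (use fd in auto)
qed

lemma fellow_imp_asymptotic: "fellow X D \<alpha> \<beta> \<Longrightarrow> asymptotic X \<alpha> \<beta>"
  by (auto simp: asymptotic_def)

lemma boundary_map_ray:
  assumes f: "qi_pair X Y f g q Q" and \<gamma>: "morse_ray_from X e B \<gamma>"
    and \<gamma>': "morse_ray_from Y e' B' \<gamma>'" "asymptotic Y \<gamma>' (\<lambda>t. f (\<gamma> t))"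
  shows "boundary_map Y e' f (morse_class X e \<gamma>) = morse_class Y e' \<gamma>'"
proof -
  have "boundary_map Y e' f (morse_class X e \<gamma>) = morse_class Y e' (\<lambda>t. f (\<gamma> t))"
    using morse_ray_in_class[OF \<gamma>] by (intro boundary_map_class[OF f] morse_ray_from_mem[OF \<gamma>]) auto
  also have "\<dots> = morse_class Y e' \<gamma>'"
    using morse_ray_from_mem[OF \<gamma>] morse_ray_from_mem[OF \<gamma>'(1)] qi_pairD(3)[OF f]
    by (intro morse_class_cong[OF asymptotic_sym[OF \<gamma>'(2)]]) auto
  finally show ?thesis .
qed

text \<open>If two rays with bound \<open>B\<close> stay within \<open>K\<close> for a long time,
  the rays realising their images stay within a constant for a long time. This constant is fixed
  before the time, so the description of open sets with an arbitrary constant applies.\<close>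

lemma continuous_boundary_map:
  assumes f: "qi_pair X Y f g q Q" and Y: "proper_metric Y" "geodesic_metric Y" and e: "e \<in> mspace
      X" "e' \<in> mspace Y"
  shows "continuous_map (morse_boundary X e) (morse_boundary Y e') (boundary_map Y e' f)"
  unfolding continuous_map_def
proof (intro conjI allI impI)
  note fd = qi_pairD[OF f]
  show "boundary_map Y e' f \<in> topspace (morse_boundary X e) \<rightarrow> topspace (morse_boundary Y e')"
  proof
    fix x assume "x \<in> topspace (morse_boundary X e)"
    then obtain B \<gamma> where \<gamma>: "morse_ray_from X e B \<gamma>" "x = morse_class X e \<gamma>"
      by (auto simp: in_topspace_morse_boundary)
    obtain B' D \<gamma>' where \<gamma>': "morse_ray_from Y e' B' \<gamma>'" "fellow Y D \<gamma>' (\<lambda>t. f (\<gamma> t))"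
      using morse_ray_image[OF f Y e, of B] \<gamma>(1) by blast
    then show "boundary_map Y e' f x \<in> topspace (morse_boundary Y e')"
      using boundary_map_ray[OF f \<gamma>(1) \<gamma>'(1) fellow_imp_asymptotic[OF \<gamma>'(2)]]
      unfolding in_topspace_morse_boundary \<gamma>(2) by blast
  qed
  fix U assume U: "openin (morse_boundary Y e') U"
  show "openin (morse_boundary X e) {x \<in> topspace (morse_boundary X e). boundary_map Y e' f x \<in> U}"
    unfolding openin_morse_boundary_iff
  proof (intro conjI allI impI; (elim conjE)?)
    fix B K \<gamma> assume \<gamma>: "morse_ray_from X e B \<gamma>"
      and \<gamma>U: "morse_class X e \<gamma> \<in> {x \<in> topspace (morse_boundary X e). boundary_map Y e' f x \<in> U}"
    obtain B' D where BD: "\<And>\<gamma>. morse_ray_from X e B \<gamma> \<Longrightarrow>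
        \<exists>\<gamma>'. morse_ray_from Y e' B' \<gamma>' \<and> fellow Y D \<gamma>' (\<lambda>t. f (\<gamma> t))"
      using morse_ray_image[OF f Y e, of B] by blast
    obtain \<gamma>' where \<gamma>': "morse_ray_from Y e' B' \<gamma>'" "fellow Y D \<gamma>' (\<lambda>t. f (\<gamma> t))" using BD[OF \<gamma>] by
        blast
    define R where "R = D + (q * K + Q) + D"
    have "morse_class Y e' \<gamma>' \<in> U"
      using \<gamma>U boundary_map_ray[OF f \<gamma> \<gamma>'(1) fellow_imp_asymptotic[OF \<gamma>'(2)]] by simp
    with U \<gamma>'(1) obtain k' :: nat where k': "\<And>c'. morse_ray_from Y e' B' c' \<Longrightarrow>
        (\<And>t. t \<in> {0..real k'} \<Longrightarrow> mdist Y (\<gamma>' t) (c' t) \<le> 2 * R) \<Longrightarrow> morse_class Y e' c' \<in> U"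
      unfolding openin_morse_boundary_iff by blast
    \<comment> \<open>If \<open>f (\<gamma> u)\<close> is within \<open>D\<close> of a point of
      \<open>\<gamma>'\<close> at time at most \<open>k'\<close>, then \<open>u \<le> k\<close> by
      the lower bound for \<open>f\<close>. So the given closeness up to \<open>k\<close> reaches
      far enough.\<close>
    define k where "k = nat \<lceil>q * (mdist Y (f e) e' + real k' + D) + 3 * Q\<rceil>"
    have k: "q * (mdist Y (f e) e' + real k' + D) + 3 * Q \<le> real k" unfolding k_def by linarith
    have "morse_class X e c \<in> {x \<in> topspace (morse_boundary X e). boundary_map Y e' f x \<in> U}"
      if c: "morse_ray_from X e B c" "\<forall>t\<in>{0..real k}. mdist X (\<gamma> t) (c t) \<le> K" for c
    proof -
      obtain c' where c': "morse_ray_from Y e' B' c'" "fellow Y D c' (\<lambda>t. f (c t))" using BD[OF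
          c(1)] by blast
      note mem = morse_ray_from_mem[OF \<gamma>] morse_ray_from_mem[OF \<gamma>'(1)] morse_ray_from_mem[OF c(1)]
          morse_ray_from_mem[OF c'(1)]
      have g\<gamma>: "geodesic_ray X \<gamma>" "\<gamma> 0 = e" "geodesic_ray Y \<gamma>'" "\<gamma>' 0 = e'" "geodesic_ray Y c'" "c'
          0 = e'"
        using \<gamma> \<gamma>'(1) c'(1) by (auto simp: morse_ray_from_def)
      have "morse_class Y e' c' \<in> U"
      proof (rule k'[OF c'(1)])
        fix t assume t: "t \<in> {0..real k'}"
        obtain u where u: "u \<ge> 0" "mdist Y (\<gamma>' t) (f (\<gamma> u)) \<le> D" using \<gamma>'(2) t by (auto simp:
            fellow_def)
        obtain w where w: "w \<ge> 0" "mdist Y (c' w) (f (c u)) \<le> D" using c'(2) u by (auto simp: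
            fellow_def)
        have m: "\<gamma>' t \<in> mspace Y" "\<gamma> u \<in> mspace X" "c u \<in> mspace X" "c' w \<in> mspace Y" using mem t u
            w by auto
        have "mdist Y (f e) (f (\<gamma> u)) \<le> mdist Y (f e) e' + real k' + D"
          using mdist_triangle4[of "f e" Y e' "\<gamma>' t" "f (\<gamma> u)"] e fd(3) m u geodesic_rayD(2)[OF
              g\<gamma>(3), of 0 t] g\<gamma>(4) t by auto
        then have "q * mdist Y (f e) (f (\<gamma> u)) \<le> q * (mdist Y (f e) e' + real k' + D)"
          using fd(1) by (intro mult_left_mono) auto
        then have "u \<le> real k"
          using qi_pair_lower[OF f e(1) m(2)] geodesic_rayD(2)[OF g\<gamma>(1), of 0 u] g\<gamma>(2) u k by auto
        then have "q * mdist X (\<gamma> u) (c u) \<le> q * K" using c(2) u fd(1) by (intro mult_left_mono) auto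
        then have "mdist Y (f (\<gamma> u)) (f (c u)) \<le> q * K + Q" using fd(5)[OF m(2,3)] by linarith
        then have "mdist Y (\<gamma>' t) (c' w) \<le> R"
          using mdist_triangle4[of "\<gamma>' t" Y "f (\<gamma> u)" "f (c u)" "c' w"] m fd(3) u w
          by (auto simp: R_def mdist_commute[of Y "c' w"])
        then show "mdist Y (\<gamma>' t) (c' t) \<le> 2 * R"
          using geodesic_rays_synchronise[OF g\<gamma>(3,5) _ _ w(1)] g\<gamma>(4,6) t by auto
      qed
      then show ?thesis
        using boundary_map_ray[OF f c(1) c'(1) fellow_imp_asymptotic[OF c'(2)]] c(1)
        by (auto simp: in_topspace_morse_boundary)
    qed
    then show "\<exists>k::nat. \<forall>c. morse_ray_from X e B c \<and> (\<forall>t\<in>{0..real k}. mdist X (\<gamma> t) (c t) \<le> K) \<longrightarrow>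
      morse_class X e c \<in> {x \<in> topspace (morse_boundary X e). boundary_map Y e' f x \<in> U}" by blast
  qed auto
qed

lemma morse_class_image_nonempty:
  assumes f: "qi_pair X Y f g q Q" and Y: "proper_metric Y" "geodesic_metric Y"
    and e: "e \<in> mspace X" "e' \<in> mspace Y" and \<gamma>: "morse_ray_from X e B \<gamma>"
  shows "morse_class Y e' (\<lambda>t. f (\<gamma> t)) \<noteq> {}"
proof -
  obtain B' D \<gamma>' where \<gamma>': "morse_ray_from Y e' B' \<gamma>'" "fellow Y D \<gamma>' (\<lambda>t. f (\<gamma> t))"
    using morse_ray_image[OF f Y e, of B] \<gamma> by blast
  have "(\<lambda>t. f (\<gamma> t)) \<in> {0..} \<rightarrow> mspace Y" using morse_ray_from_mem[OF \<gamma>] qi_pairD(3)[OF f] by auto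
  from morse_class_alt[OF this] show ?thesis using \<gamma>' fellow_imp_asymptotic by blast
qed

text \<open>Going to \<open>Y\<close> and back moves each point of a ray by at most
  \<open>Q\<close>, so quasi-inverse maps become honest inverses on the boundary.\<close>

lemma boundary_map_inverse:
  assumes f: "qi_pair X Y f g q Q" and X: "proper_metric Y" "geodesic_metric Y"
    and e: "e \<in> mspace X" "e' \<in> mspace Y" and x: "x \<in> topspace (morse_boundary X e)"
  shows "boundary_map X e g (boundary_map Y e' f x) = x"
proof -
  obtain B \<gamma> where \<gamma>: "morse_ray_from X e B \<gamma>" "x = morse_class X e \<gamma>"
    using x by (auto simp: in_topspace_morse_boundary)
  note mem = morse_ray_from_mem[OF \<gamma>(1)] and fd = qi_pairD[OF f]
  have "boundary_map Y e' f x = morse_class Y e' (\<lambda>t. f (\<gamma> t))"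
    unfolding \<gamma>(2) using morse_ray_in_class[OF \<gamma>(1)] by (intro boundary_map_class[OF f] mem) auto
  moreover have "boundary_map X e g (morse_class Y e' (\<lambda>t. f (\<gamma> t))) = morse_class X e (\<lambda>t. g (f (\<gamma>
      t)))"
    using mem fd by (intro boundary_map_class[OF qi_pair_sym[OF f]] morse_class_image_nonempty[OF f
        X e \<gamma>(1)]) auto
  moreover have "\<dots> = morse_class X e \<gamma>"
  proof (rule morse_class_cong)
    have "fellow X Q (\<lambda>t. g (f (\<gamma> t))) \<gamma>" using fd(7) mem unfolding fellow_def by fastforce
    then show "asymptotic X (\<lambda>t. g (f (\<gamma> t))) \<gamma>" by (rule fellow_imp_asymptotic)
  qed (use mem fd in auto)
  ultimately show ?thesis using \<gamma>(2) by simp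
qed

lemma homeomorphic_boundary_map:
  assumes f: "qi_pair X Y f g q Q" and X: "proper_metric X" "geodesic_metric X"
    and Y: "proper_metric Y" "geodesic_metric Y" and e: "e \<in> mspace X" "e' \<in> mspace Y"
  shows "homeomorphic_map (morse_boundary X e) (morse_boundary Y e') (boundary_map Y e' f)"
proof -
  have "homeomorphic_maps (morse_boundary X e) (morse_boundary Y e') (boundary_map Y e' f)
      (boundary_map X e g)"
    unfolding homeomorphic_maps_def
    using continuous_boundary_map[OF f Y e] continuous_boundary_map[OF qi_pair_sym[OF f] X e(2,1)]
      boundary_map_inverse[OF f Y e] boundary_map_inverse[OF qi_pair_sym[OF f] X e(2,1)] by blast
  then show ?thesis by (rule homeomorphic_maps_map[THEN iffD1, THEN conjunct1])
qed

section \<open>Morse lines\<close>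

lemma morse_on_mono: "morse_on X B I \<gamma> \<Longrightarrow> (\<And>q Q. B q Q \<le> B' q Q) \<Longrightarrow> morse_on X B' I \<gamma>"
  unfolding morse_on_def by (meson order_trans)

lemma morse_on_cong:
  assumes "morse_on X B I \<gamma>" "is_interval I" "\<And>x. x \<in> I \<Longrightarrow> \<gamma>' x = \<gamma> x"
  shows "morse_on X B I \<gamma>'"
  unfolding morse_on_def
proof (intro ballI allI impI; elim conjE)
  fix s t q Q a b \<eta> u
  assume *: "s \<in> I" "t \<in> I" "s \<le> t" "(1::real) \<le> q" "(0::real) \<le> Q" "a \<le> b"
    "quasi_geodesic X q Q {a..b} \<eta>" "\<eta> a = \<gamma>' s" "\<eta> b = \<gamma>' t" "u \<in> {a..b}"
  obtain v where "v \<in> {s..t}" "mdist X (\<eta> u) (\<gamma> v) \<le> B q Q"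
    by (rule morse_onD[OF assms(1) *(1-7) _ _ *(10)]) (use * assms(3) in auto)
  then show "\<exists>v\<in>{s..t}. mdist X (\<eta> u) (\<gamma>' v) \<le> B q Q"
    using mem_is_interval_1_I[OF assms(2) *(1,2)] assms(3) by (intro bexI[of _ v]) auto
qed

lemma morse_ray_from_mono: "morse_ray_from X e B \<gamma> \<Longrightarrow> (\<And>q Q. B q Q \<le> B' q Q) \<Longrightarrow> morse_ray_from X e B' \<gamma>"
  using morse_on_mono by (fastforce simp: morse_ray_from_def)

text \<open>The common bound \<open>B\<close> is essential to the argument: an open set then
  contains all rays with this bound that stay within \<open>K\<close> of \<open>\<gamma>\<close> up
  to a single time.\<close>

lemma limitin_morse_boundary:
  assumes \<gamma>: "morse_ray_from X e B \<gamma>" and c: "\<And>n. morse_ray_from X e B (c n)"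
    and conv: "\<And>n t. t \<in> {0..real n} \<Longrightarrow> mdist X (c n t) (\<gamma> t) \<le> K"
  shows "limitin (morse_boundary X e) (\<lambda>n. morse_class X e (c n)) (morse_class X e \<gamma>) sequentially"
  unfolding limitin_def
proof (intro conjI allI impI; (elim conjE)?)
  show "morse_class X e \<gamma> \<in> topspace (morse_boundary X e)" using \<gamma> by (auto simp:
      in_topspace_morse_boundary)
  fix U assume "openin (morse_boundary X e) U" "morse_class X e \<gamma> \<in> U"
  then obtain k :: nat where k: "\<And>c. morse_ray_from X e B c \<Longrightarrow> \<forall>t\<in>{0..real k}. mdist X (\<gamma> t) (c t) \<le>
      K \<Longrightarrow> morse_class X e c \<in> U"
    using \<gamma> unfolding openin_morse_boundary_iff by blast
  show "\<forall>\<^sub>F n in sequentially. morse_class X e (c n) \<in> U"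
  proof (rule eventually_sequentiallyI[of k])
    fix n assume "k \<le> n"
    then show "morse_class X e (c n) \<in> U"
      using conv[of _ n] by (intro k c) (auto simp: mdist_commute[of X "\<gamma> _"])
  qed
qed

text \<open>Rays from \<open>e\<close> with a fixed Morse bound are sequentially compact up to a
  controlled loss in the bound.\<close>

lemma morse_rays_subsequence:
  assumes X: "proper_metric X" and e: "e \<in> mspace X" and c: "\<And>n. morse_ray_from X e B (c n)"
  obtains \<rho> g where "strict_mono (\<rho> :: nat \<Rightarrow> nat)" "morse_ray_from X e (\<lambda>q Q. max (B q (Q + 2)) 1 +
      1) g"
    "\<And>n t. t \<in> {0..real n} \<Longrightarrow> mdist X (c (\<rho> n) t) (g t) \<le> 1"
proof -
  have ray: "geodesic_ray X (c n)" "c n 0 = e" "morse_on X B {0..} (c n)" for n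
    using c[of n] by (auto simp: morse_ray_from_def)
  obtain g \<rho> where g: "g \<in> {0..} \<rightarrow> mspace X" and g0: "g 0 = e" and g': "strict_mono (\<rho> :: nat \<Rightarrow> nat)"
    "\<And>n t. t \<in> {0..real n} \<Longrightarrow> mdist X (c (\<rho> n) t) (g t) \<le> 1 / (real n + 1)"
    by (rule Lipschitz_paths_subsequence[OF X e, of c]) (use geodesic_rayD(1,2)[OF ray(1)] ray(2) in
        auto)
  have gray: "geodesic_ray X g" by (rule geodesic_rays_limit[OF ray(1) g g'(2)])
  have "morse_on X (\<lambda>q Q. max (B q (Q + 2)) 1 + 1) {0..} g" by (rule morse_rays_limit[OF ray(1,3) g
      g'(2)])
  moreover have "mdist X (c (\<rho> n) t) (g t) \<le> 1" if "t \<in> {0..real n}" for n t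
  proof -
    have "1 / (real n + 1) \<le> 1" by simp
    then show ?thesis using g'(2)[OF that] by (rule order_trans[rotated])
  qed
  ultimately show ?thesis using that g'(1) g0 gray by (auto simp: morse_ray_from_def)
qed

text \<open>Both ends are replaced by rays from \<open>e\<close> with a common bound and these
  converge along a subsequence. If the limits were asymptotic, points of a line far out on either
  side would be within a fixed distance, but the common constants \<open>q\<close> and
  \<open>Q\<close> force such points to have bounded parameters.\<close>

lemma morse_lines_limits:
  assumes X: "proper_metric X" "geodesic_metric X" and q: "q \<ge> 1" "Q \<ge> 0" "K \<ge> 0" and e: "e \<in> mspace X"
    and \<sigma>: "\<And>n. quasi_geodesic X q Q UNIV (\<sigma> n)" "\<And>n. morse_on X B UNIV (\<sigma> n)" "\<And>n. mdist X e (\<sigma> n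
        0) \<le> K"
  shows "\<exists>\<rho> x y. strict_mono (\<rho> :: nat \<Rightarrow> nat) \<and> x \<noteq> y \<and>
    limitin (morse_boundary X e) (\<lambda>n. morse_class X e (\<sigma> (\<rho> n))) x sequentially \<and>
    limitin (morse_boundary X e) (\<lambda>n. morse_class X e (\<lambda>t. \<sigma> (\<rho> n) (- t))) y sequentially"
proof -
  define B1 where "B1 = realisation_bound B q Q K"
  define D where "D = realisation_const B q Q K"
  have \<sigma>m: "\<sigma> n t \<in> mspace X" for n t using quasi_geodesic_mem[OF \<sigma>(1)] by simp
  have "\<exists>c. morse_ray_from X e B1 c \<and> fellow X D c (\<sigma> n)" for n
    by (rule morse_ray_realisation[OF X quasi_geodesic_subset[OF \<sigma>(1)[of n]] morse_on_subset[OF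
        \<sigma>(2)[of n]] q \<sigma>(3)[of n] e])
      (auto simp: B1_def D_def)
  then obtain \<alpha> where \<alpha>: "\<And>n. morse_ray_from X e B1 (\<alpha> n)" "\<And>n. fellow X D (\<alpha> n) (\<sigma> n)" by metis
  have "\<exists>c. morse_ray_from X e B1 c \<and> fellow X D c (\<lambda>t. \<sigma> n (- t))" for n
  proof -
    have "quasi_geodesic X q Q {0..} (\<lambda>t. \<sigma> n (0 - t))" by (rule quasi_geodesic_reflect[OF \<sigma>(1)]) auto
    moreover have "morse_on X B {0..} (\<lambda>t. \<sigma> n (0 - t))" by (rule morse_on_reflect[OF \<sigma>(2)]) auto
    ultimately have *: "quasi_geodesic X q Q {0..} (\<lambda>t. \<sigma> n (- t))" "morse_on X B {0..} (\<lambda>t. \<sigma> n (-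
        t))" by auto
    show ?thesis
      by (rule morse_ray_realisation[OF X * q _ e]) (use \<sigma>(3) in \<open>auto simp: B1_def D_def\<close>)
  qed
  then obtain \<beta> where \<beta>: "\<And>n. morse_ray_from X e B1 (\<beta> n)" "\<And>n. fellow X D (\<beta> n) (\<lambda>t. \<sigma> n (- t))" by
      metis
  define B2 where "B2 = (\<lambda>q Q. max (B1 q (Q + 2)) 1 + 1)"
  obtain \<rho>1 a where a: "strict_mono (\<rho>1 :: nat \<Rightarrow> nat)" "morse_ray_from X e B2 a"
    "\<And>n t. t \<in> {0..real n} \<Longrightarrow> mdist X (\<alpha> (\<rho>1 n) t) (a t) \<le> 1"
    by (rule morse_rays_subsequence[where c = \<alpha>, OF X(1) e \<alpha>(1)]) (auto simp: B2_def)
  \<comment> \<open>A subsequence of the first subsequence, so that both kinds of ends converge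
    along it.\<close>
  obtain \<rho>2 b where b: "strict_mono (\<rho>2 :: nat \<Rightarrow> nat)" "morse_ray_from X e B2 b"
    "\<And>n t. t \<in> {0..real n} \<Longrightarrow> mdist X (\<beta> (\<rho>1 (\<rho>2 n)) t) (b t) \<le> 1"
    by (rule morse_rays_subsequence[where c = "\<lambda>n. \<beta> (\<rho>1 n)", OF X(1) e \<beta>(1)]) (auto simp: B2_def)
  define \<rho> where "\<rho> n = \<rho>1 (\<rho>2 n)" for n
  have \<rho>: "strict_mono \<rho>" using a(1) b(1) by (auto simp: \<rho>_def strict_mono_def)
  have \<rho>2: "n \<le> \<rho>2 n" for n using b(1) by (rule strict_mono_imp_increasing)
  have near_a: "mdist X (\<alpha> (\<rho> n) t) (a t) \<le> 1" if "t \<in> {0..real n}" for n t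
  proof -
    have "real n \<le> real (\<rho>2 n)" using \<rho>2 by simp
    then show ?thesis unfolding \<rho>_def using that by (intro a(3)) auto
  qed
  have near_b: "mdist X (\<beta> (\<rho> n) t) (b t) \<le> 1" if "t \<in> {0..real n}" for n t
    using b(3)[OF that] by (simp add: \<rho>_def)
  \<comment> \<open>Approximating rays and limits need one common bound for convergence in the
    boundary.\<close>
  define B3 where "B3 = (\<lambda>q Q. max (B1 q Q) (B2 q Q))"
  have rays: "morse_ray_from X e B3 (\<alpha> n)" "morse_ray_from X e B3 (\<beta> n)" "morse_ray_from X e B3 a"
      "morse_ray_from X e B3 b" for n
    using morse_ray_from_mono[OF \<alpha>(1), of B3] morse_ray_from_mono[OF \<beta>(1), of B3]
      morse_ray_from_mono[OF a(2), of B3] morse_ray_from_mono[OF b(2), of B3] by (auto simp: B3_def)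
  have "morse_class X e (\<sigma> n) = morse_class X e (\<alpha> n)" for n
    using \<sigma>m morse_ray_from_mem[OF \<alpha>(1)] by (intro morse_class_cong asymptotic_sym[OF
        fellow_imp_asymptotic[OF \<alpha>(2)]]) auto
  then have lim1: "limitin (morse_boundary X e) (\<lambda>n. morse_class X e (\<sigma> (\<rho> n))) (morse_class X e a)
      sequentially"
    using limitin_morse_boundary[OF rays(3) rays(1)[of "\<rho> _"] near_a] by simp
  have "morse_class X e (\<lambda>t. \<sigma> n (- t)) = morse_class X e (\<beta> n)" for n
    using \<sigma>m morse_ray_from_mem[OF \<beta>(1)] by (intro morse_class_cong asymptotic_sym[OF
        fellow_imp_asymptotic[OF \<beta>(2)]]) auto
  then have lim2: "limitin (morse_boundary X e) (\<lambda>n. morse_class X e (\<lambda>t. \<sigma> (\<rho> n) (- t)))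
      (morse_class X e b) sequentially"
    using limitin_morse_boundary[OF rays(4) rays(2)[of "\<rho> _"] near_b] by simp
  have "morse_class X e a \<noteq> morse_class X e b"
  proof
    assume "morse_class X e a = morse_class X e b"
    then have "asymptotic X a b" using a(2) morse_ray_from_mem[OF b(2)] by (rule morse_class_eqD)
    then obtain E where E: "fellow X E a b" by (auto simp: asymptotic_def)
    have ab: "geodesic_ray X a" "geodesic_ray X b" "a 0 = b 0" using a(2) b(2) by (auto simp:
        morse_ray_from_def)
    have abE: "mdist X (a t) (b t) \<le> 2 * E" if t: "t \<ge> 0" for t
      using E t geodesic_rays_synchronise[OF ab t] by (auto simp: fellow_def)
    \<comment> \<open>\<open>R\<close> bounds the parameter distance of two points, one on each
      side, that are near the two rays at the same time. It does not depend on this time, so a late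
      time \<open>n\<close> contradicts that \<open>\<sigma> (\<rho> n) x\<close> is within
      \<open>K + (q * R + Q)\<close> of \<open>e\<close>.\<close>
    define R where "R = q * (2 * E + 2 + 2 * D + Q)"
    obtain n where n: "real n > K + (q * R + Q) + D" using reals_Archimedean2 by blast
    obtain x where x: "x \<ge> 0" "mdist X (\<alpha> (\<rho> n) (real n)) (\<sigma> (\<rho> n) x) \<le> D" using \<alpha>(2)[of "\<rho> n"]
        of_nat_0_le_iff[of n] unfolding fellow_def by blast
    obtain y where y: "y \<ge> 0" "mdist X (\<beta> (\<rho> n) (real n)) (\<sigma> (\<rho> n) (- y)) \<le> D" using \<beta>(2)[of "\<rho> n"]
        of_nat_0_le_iff[of n] unfolding fellow_def by blast
    have m: "\<alpha> (\<rho> n) (real n) \<in> mspace X" "\<beta> (\<rho> n) (real n) \<in> mspace X" "a (real n) \<in> mspace X" "b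
        (real n) \<in> mspace X"
      using morse_ray_from_mem[OF \<alpha>(1)[of "\<rho> n"]] morse_ray_from_mem[OF \<beta>(1)[of "\<rho> n"]]
          morse_ray_from_mem[OF a(2)] morse_ray_from_mem[OF b(2)] by auto
    have "mdist X (\<alpha> (\<rho> n) (real n)) (\<beta> (\<rho> n) (real n)) \<le> 2 * E + 2"
      using mdist_triangle4[OF m(1,3,4,2)] near_a[of "real n" n] near_b[of "real n" n] abE[of "real n"]
      by (auto simp: mdist_commute[of X "b (real n)"])
    then have "mdist X (\<sigma> (\<rho> n) x) (\<sigma> (\<rho> n) (- y)) \<le> 2 * E + 2 + 2 * D"
      using mdist_triangle4[OF \<sigma>m[of "\<rho> n" x] m(1,2) \<sigma>m[of "\<rho> n" "- y"]] x y
      by (auto simp: mdist_commute[of X "\<sigma> (\<rho> n) x"])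
    then have "q * (mdist X (\<sigma> (\<rho> n) x) (\<sigma> (\<rho> n) (- y)) + Q) \<le> R"
      unfolding R_def using q by (intro mult_left_mono) auto
    then have "x \<le> R" using quasi_geodesic_lower[OF \<sigma>(1), of x "- y" "\<rho> n"] q x y by auto
    then have "q * x \<le> q * R" using q by (intro mult_left_mono) auto
    then have "mdist X (\<sigma> (\<rho> n) 0) (\<sigma> (\<rho> n) x) \<le> q * R + Q"
      using quasi_geodesic_upper[OF \<sigma>(1), of 0 x "\<rho> n"] x by auto
    moreover have "mdist X e (\<alpha> (\<rho> n) (real n)) = real n"
      using \<alpha>(1)[of "\<rho> n"] geodesic_rayD(2)[of X "\<alpha> (\<rho> n)" 0 "real n"] by (auto simp:
          morse_ray_from_def)
    ultimately have "real n \<le> K + (q * R + Q) + D"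
      using mdist_triangle4[OF e \<sigma>m[of "\<rho> n" 0] \<sigma>m[of "\<rho> n" x] m(1)] x \<sigma>(3)[of "\<rho> n"]
      by (auto simp: mdist_commute[of X "\<sigma> (\<rho> n) x"])
    then show False using n by simp
  qed
  with \<rho> lim1 lim2 show ?thesis by blast
qed

text \<open>If \<open>a\<close> came within \<open>D\<close> of \<open>b\<close> at arbitrarily late
  times, its initial segments would be tracked by \<open>b\<close> with a constant independent of
  their length, and the rays would be asymptotic.\<close>

lemma morse_rays_diverge:
  assumes a: "morse_ray_from X e B a" and b: "morse_ray_from X e B b" and na: "\<not> asymptotic X a b"
  shows "\<exists>C\<ge>0. \<forall>u\<ge>0. \<forall>v\<ge>0. mdist X (a u) (b v) \<le> D \<longrightarrow> u \<le> C"
proof (rule ccontr)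
  assume "\<not> ?thesis"
  then have far: "\<exists>u\<ge>0. \<exists>v\<ge>0. mdist X (a u) (b v) \<le> D \<and> C < u" if "C \<ge> 0" for C
    using that by (meson not_le)
  have ab: "geodesic_ray X a" "geodesic_ray X b" "a 0 = e" "b 0 = e" and Mb: "morse_on X B {0..} b"
    using a b by (auto simp: morse_ray_from_def)
  note ad = geodesic_rayD[OF ab(1)] and bd = geodesic_rayD[OF ab(2)]
  define E where "E = track_const B 1 0 1 0 D"
  have track: "(\<exists>v\<ge>0. mdist X (a t) (b v) \<le> E) \<and> (\<exists>u\<ge>0. mdist X (a u) (b t) \<le> E)" if t: "t \<ge> 0" for t
  proof -
    \<comment> \<open>The margin of \<open>\<bar>D\<bar>\<close> makes \<open>v\<close> at least
      \<open>t\<close> too, so both \<open>a t\<close> and \<open>b t\<close> lie on the tracked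
      segments.\<close>
    obtain u v where uv: "u \<ge> 0" "v \<ge> 0" "mdist X (a u) (b v) \<le> D" "t + \<bar>D\<bar> < u" using far[of "t +
        \<bar>D\<bar>"] t by auto
    have D: "0 \<le> D" using uv(3) mdist_nonneg[of X "a u" "b v"] by linarith
    have em: "e \<in> mspace X" using ad(1)[of 0] ab by simp
    have "u \<le> v + D"
      using mdist_triangle[of e X "b v" "a u"] ad(1)[of u] bd(1)[of v] ad(2)[of 0 u] bd(2)[of 0 v]
          em ab uv
      by (auto simp: mdist_commute[of X "b v"])
    then have v: "t \<le> v" using uv by auto
    have qa: "quasi_geodesic X 1 0 {0..u} a"
      using geodesic_ray_quasi_geodesic[OF ab(1)] by (rule quasi_geodesic_subset) auto
    have ends: "mdist X (a 0) (b 0) \<le> D" using em ab D by simp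
    have "\<exists>w\<in>{min 0 v..max 0 v}. mdist X (a t) (b w) \<le> track_const B 1 0 1 0 D"
      by (rule morse_on_track(1)[OF Mb geodesic_ray_quasi_geodesic[OF ab(2)] is_interval_ci _ _ _ _
          _ _ D uv(1) qa ends uv(3)])
        (use uv t in auto)
    moreover have "\<exists>w\<in>{0..u}. mdist X (a w) (b t) \<le> track_const B 1 0 1 0 D"
      by (rule morse_on_track(2)[OF Mb geodesic_ray_quasi_geodesic[OF ab(2)] is_interval_ci _ _ _ _
          _ _ D uv(1) qa ends uv(3)])
        (use uv t v in auto)
    ultimately show ?thesis using uv(2) unfolding E_def by (auto simp: min_def max_def)
  qed
  then have "fellow X E a b" by (simp add: fellow_def)
  then show False using na by (auto simp: asymptotic_def)
qed

text \<open>Let \<open>a u\<close> be almost nearest to \<open>b t\<close>. The path from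
  \<open>b t\<close> to \<open>a u\<close> and back along \<open>a\<close> to \<open>e\<close> is a
  (3, 1)-quasi-geodesic with endpoints on \<open>b\<close>, so \<open>a u\<close> is near
  \<open>b\<close> and \<open>u\<close> is bounded by divergence. The path from \<open>b t\<close>
  to \<open>a u\<close> and on to \<open>a s\<close> is a (3, 1)-quasi-geodesic as well, which gives
  the estimate.\<close>

lemma morse_rays_separate:
  assumes X: "geodesic_metric X" and a: "morse_ray_from X e B a" and b: "morse_ray_from X e B b" and
      na: "\<not> asymptotic X a b"
  shows "\<exists>Q\<ge>0. \<forall>s\<ge>0. \<forall>t\<ge>0. s + t \<le> 3 * (mdist X (a s) (b t) + Q)"
proof -
  have ab: "geodesic_ray X a" "geodesic_ray X b" "a 0 = e" "b 0 = e" and Mb: "morse_on X B {0..} b"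
    using a b by (auto simp: morse_ray_from_def)
  note ad = geodesic_rayD[OF ab(1)] and bd = geodesic_rayD[OF ab(2)]
  have em: "e \<in> mspace X" using ad(1)[of 0] ab by simp
  define D where "D = max (B 3 1) 0"
  obtain C where C: "C \<ge> 0" "\<And>u v. u \<ge> 0 \<Longrightarrow> v \<ge> 0 \<Longrightarrow> mdist X (a u) (b v) \<le> D \<Longrightarrow> u \<le> C"
    using morse_rays_diverge[OF a b na, of D] by blast
  have "s + t \<le> 3 * (mdist X (a s) (b t) + (1 + C))" if st: "s \<ge> 0" "t \<ge> 0" for s t
  proof -
    have bt: "b t \<in> mspace X" using bd st by auto
    have qa: "quasi_geodesic X 1 0 {0..s} a"
      using geodesic_ray_quasi_geodesic[OF ab(1)] by (rule quasi_geodesic_subset) auto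
    have qa': "quasi_geodesic X 1 0 {0..s} (\<lambda>x. a (s - x))"
      using qa by (rule quasi_geodesic_reflect) auto
    obtain u where u: "u \<in> {0..s}" "\<And>v. v \<in> {0..s} \<Longrightarrow> mdist X (b t) (a u) \<le> mdist X (b t) (a v) + 1"
      using almost_nearest_point[of "{0..s}" X "b t" a] st by auto
    obtain \<zeta> L where \<zeta>: "L = mdist X (b t) (a (s - (s - u)))"
      "quasi_geodesic X (2 * 1 + 1) (0 + 1) {0..L + (s - (s - u))} \<zeta>" "\<zeta> 0 = b t"
      "\<And>w. w \<in> {s - u..s} \<Longrightarrow> \<zeta> (L + (w - (s - u))) = a (s - w)"
      by (rule nearest_point_path[OF X bt qa', of "s - u"]) (use u(1) u(2)[of "s - _"] in auto)
    have L0: "0 \<le> L" by (simp add: \<zeta>)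
    have \<zeta>L: "\<zeta> L = a u" using \<zeta>(4)[of "s - u"] u by simp
    have \<zeta>e: "\<zeta> (L + (s - (s - u))) = e" using \<zeta>(4)[of s] u ab by simp
    have "\<exists>v\<in>{min t 0..max t 0}. mdist X (\<zeta> L) (b v) \<le> max (B (2 * 1 + 1) (0 + 1 + 2 * 0)) 0"
      by (rule morse_on_near'[OF Mb bd(3) _ _ _ _ _ _ \<zeta>(2)]) (use st L0 u bt em ab \<zeta>(3) \<zeta>e in auto)
    then obtain v where v: "v \<ge> 0" "mdist X (a u) (b v) \<le> D" using \<zeta>L st by (auto simp: D_def)
    then have uC: "u \<le> C" using C(2)[of u v] u by auto
    obtain \<zeta>' L' where \<zeta>': "L' = mdist X (b t) (a u)"
      "quasi_geodesic X (2 * 1 + 1) (0 + 1) {0..L' + (s - u)} \<zeta>'" "\<zeta>' 0 = b t"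
      "\<And>w. w \<in> {u..s} \<Longrightarrow> \<zeta>' (L' + (w - u)) = a w"
      by (rule nearest_point_path[OF X bt qa _ _ u]) auto
    have L'0: "0 \<le> L'" by (simp add: \<zeta>')
    have "\<bar>0 - (L' + (s - u))\<bar> \<le> (2 * 1 + 1) * (mdist X (\<zeta>' 0) (\<zeta>' (L' + (s - u))) + (0 + 1))"
      by (rule quasi_geodesic_lower[OF \<zeta>'(2)]) (use L'0 u in auto)
    then have "L' + (s - u) \<le> 3 * (mdist X (a s) (b t) + 1)"
      using \<zeta>'(3) \<zeta>'(4)[of s] u L'0 by (simp add: mdist_commute[of X "a s"])
    moreover have "t \<le> u + L'"
      using mdist_triangle[of e X "a u" "b t"] em bt ad(1)[of u] ad(2)[of 0 u] bd(2)[of 0 t] ab u st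
          \<zeta>'(1)
      by (auto simp: mdist_commute[of X "a u"])
    ultimately show ?thesis using uC C(1) by simp
  qed
  then show ?thesis using C(1) by (intro exI[of _ "1 + C"]) auto
qed

section \<open>Lines made of two rays, and the approach of a ray by lines\<close>

definition two_ended :: "(real \<Rightarrow> 'p) \<Rightarrow> (real \<Rightarrow> 'p) \<Rightarrow> real \<Rightarrow> 'p" where
  "two_ended a b t = (if 0 \<le> t then a t else b (- t))"

text \<open>The lower bound across the origin is \<open>morse_rays_separate\<close>, the source of
  the factor 3; the Morse property comes from joining the two halves at time 0.\<close>

lemma morse_line:
  assumes X: "geodesic_metric X" and a: "morse_ray_from X e B a" and b: "morse_ray_from X e B b" and
      na: "\<not> asymptotic X a b"
  shows "\<exists>Q B'. Q \<ge> 0 \<and> quasi_geodesic X 3 Q UNIV (two_ended a b) \<and> morse_on X B' UNIV (two_ended a b)"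
proof -
  have ab: "geodesic_ray X a" "geodesic_ray X b" "a 0 = e" "b 0 = e" and M: "morse_on X B {0..} a"
      "morse_on X B {0..} b"
    using a b by (auto simp: morse_ray_from_def)
  note ad = geodesic_rayD[OF ab(1)] and bd = geodesic_rayD[OF ab(2)]
  have em: "e \<in> mspace X" using ad(1)[of 0] ab by simp
  obtain Q where Q: "Q \<ge> 0" "\<And>s t. s \<ge> 0 \<Longrightarrow> t \<ge> 0 \<Longrightarrow> s + t \<le> 3 * (mdist X (a s) (b t) + Q)"
    using morse_rays_separate[OF X a b na] by blast
  have qg: "quasi_geodesic X 3 Q UNIV (two_ended a b)"
  proof (rule quasi_geodesicI)
    fix s t :: real assume st: "s \<le> t"
    have *: "t - s \<le> 3 * (mdist X (two_ended a b s) (two_ended a b t) + Q) \<and>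
       mdist X (two_ended a b s) (two_ended a b t) \<le> 3 * (t - s) + Q"
    proof -
      consider "0 \<le> s" | "s < 0" "0 \<le> t" | "t < 0" by linarith
      then show ?thesis
      proof cases
        case 1
        then show ?thesis using st ad(2)[of s t] Q(1) by (auto simp: two_ended_def)
      next
        case 2
        then have "mdist X (b (- s)) (a t) \<le> - s + t"
          using mdist_triangle[of "b (- s)" X e "a t"] em bd(1)[of "- s"] ad(1)[of t] bd(2)[of "- s"
              0] ad(2)[of 0 t] ab by auto
        then show ?thesis using 2 Q(2)[of t "- s"] Q(1) by (auto simp: two_ended_def
            mdist_commute[of X "b (- s)"])
      next
        case 3
        then show ?thesis using st bd(2)[of "- s" "- t"] Q(1) by (auto simp: two_ended_def)
      qed
    qed
    then show "t - s \<le> 3 * (mdist X (two_ended a b s) (two_ended a b t) + Q)"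
      "mdist X (two_ended a b s) (two_ended a b t) \<le> 3 * (t - s) + Q" by auto
  qed (use ad bd in \<open>auto simp: two_ended_def\<close>)
  have "morse_on X B {0..} (two_ended a b)"
    by (rule morse_on_cong[OF M(1)]) (auto simp: two_ended_def is_interval_ci)
  moreover have "morse_on X B {..0} (two_ended a b)"
  proof (rule morse_on_cong)
    show "morse_on X B {..0} (\<lambda>x. b (0 - x))" by (rule morse_on_reflect[OF M(2)]) auto
  qed (use ab in \<open>auto simp: two_ended_def is_interval_ic\<close>)
  ultimately have "morse_on X (\<lambda>q Q. max (max (B (2 * q + 1) (Q + 1)) 0) (B q Q)) UNIV (two_ended a b)"
    using quasi_geodesic_mem[OF qg] by (intro morse_on_join[OF X, of _ _ 0]) auto
  then show ?thesis using qg Q(1) by blast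
qed

text \<open>Go from \<open>e\<close> to an almost nearest point \<open>\<sigma> u\<close> and follow
  \<open>\<sigma>\<close> forward. As \<open>u \<le> 0\<close>, this path passes through
  \<open>\<sigma> 0\<close>, which is near \<open>\<gamma> n\<close>. Up to there it is Morse
  because it tracks \<open>\<gamma>\<close>, afterwards because it lies on \<open>\<sigma>\<close>.
  All constants are fixed before \<open>\<sigma>\<close> and \<open>n\<close>.\<close>

lemma morse_line_approach_aux:
  assumes X: "proper_metric X" "geodesic_metric X" and q: "q \<ge> 1" "Q \<ge> 0" "K \<ge> 0"
    and \<gamma>: "morse_ray_from X e B \<gamma>"
  shows "\<exists>B' K'. \<forall>\<sigma> n u. quasi_geodesic X q Q UNIV \<sigma> \<and> morse_on X B UNIV \<sigma> \<and> n \<ge> 0 \<and> mdist X (\<sigma> 0)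
      (\<gamma> n) \<le> K \<and>
      u \<le> 0 \<and> (\<forall>v. mdist X e (\<sigma> u) \<le> mdist X e (\<sigma> v) + 1) \<longrightarrow>
    (\<exists>c. morse_ray_from X e B' c \<and> asymptotic X c \<sigma> \<and> (\<forall>t. 0 \<le> t \<and> t \<le> n - K' \<longrightarrow> mdist X (\<gamma> t) (c t)
        \<le> K'))"
proof -
  define q' Q' where "q' = 2 * q + 1" and "Q' = Q + 1"
  have q': "q' \<ge> 1" "Q' \<ge> 0" using q by (auto simp: q'_def Q'_def)
  define D1 where "D1 = track_const B 1 0 q' Q' K"
  have D1: "D1 \<ge> 0" unfolding D1_def using track_const_ge(2)[OF _ _ q' q(3), of 1 0] by simp
  define B1 where "B1 = (\<lambda>p P. max (track_const B 1 0 p P D1 + track_const B 1 0 q' Q' D1) (B p P))"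
  define B2 where "B2 = (\<lambda>p P. max (max (B1 (2 * p + 1) (P + 1)) 0) (B1 p P))"
  define D3 where "D3 = realisation_const B2 q' Q' 0"
  define E where "E = D3 + K"
  have D3: "D3 \<ge> 0" unfolding D3_def realisation_const_def using track_const_ge(2)[OF q', of 1 0 0]
      by simp
  define D4 where "D4 = track_const B 1 0 1 0 E"
  \<comment> \<open>\<open>E\<close> is the loss in time, since \<open>c\<close> passes near
    \<open>\<gamma> n\<close> no earlier than \<open>n - E\<close>; \<open>2 * D4\<close> is the
    distance to \<open>\<gamma>\<close> after matching the times.\<close>
  define K' where "K' = max E (2 * D4)"
  have E: "E \<ge> 0" using D3 q by (simp add: E_def)
  have g: "geodesic_ray X \<gamma>" "\<gamma> 0 = e" "morse_on X B {0..} \<gamma>" using \<gamma> by (auto simp: morse_ray_from_def)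
  note gd = geodesic_rayD[OF g(1)] and gq = geodesic_ray_quasi_geodesic[OF g(1)]
  have e: "e \<in> mspace X" using gd(1)[of 0] g by simp
  show ?thesis
  proof (rule exI[of _ "realisation_bound B2 q' Q' 0"], rule exI[of _ K'], intro allI impI; elim conjE)
    fix \<sigma> n u
    assume \<sigma>: "quasi_geodesic X q Q UNIV \<sigma>" "morse_on X B UNIV \<sigma>" and n: "0 \<le> n" "mdist X (\<sigma> 0) (\<gamma>
        n) \<le> K"
      and u: "u \<le> 0" "\<forall>v. mdist X e (\<sigma> u) \<le> mdist X e (\<sigma> v) + 1"
    have \<sigma>m: "\<sigma> t \<in> mspace X" for t using quasi_geodesic_mem[OF \<sigma>(1)] by simp
    define L where "L = mdist X e (\<sigma> u)"
    obtain c0 where c0: "c0 \<in> {0..L} \<rightarrow> mspace X" "c0 0 = e" "c0 L = \<sigma> u"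
        "\<And>s t. s \<in> {0..L} \<Longrightarrow> t \<in> {0..L} \<Longrightarrow> mdist X (c0 s) (c0 t) = \<bar>s - t\<bar>"
      using geodesic_metricE[OF X(2) e \<sigma>m[of u]] unfolding L_def by metis
    define r where "r = splice c0 L u \<sigma>"
    \<comment> \<open>The time at which the spliced path \<open>r\<close> reaches
      \<open>\<sigma> 0\<close>.\<close>
    define T where "T = L - u"
    have L0: "0 \<le> L" by (simp add: L_def)
    then have T: "0 \<le> T" "L \<le> T" using u by (auto simp: T_def)
    have rq: "quasi_geodesic X q' Q' {0..} r"
      unfolding r_def q'_def Q'_def
      by (rule quasi_geodesic_splice[OF \<sigma>(1) q(1,2) _ _ L_def c0]) (use u in auto)
    have r0: "r 0 = e"
      using c0(2,3) L0 by (cases "L = 0") (auto simp: r_def splice_def)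
    have rT: "r x = \<sigma> (- T + x)" if "x \<ge> T" for x
      using that T by (auto simp: r_def splice_def T_def algebra_simps)
    have ends: "mdist X (r 0) (\<gamma> 0) \<le> K" "mdist X (r T) (\<gamma> n) \<le> K"
      using r0 g(2) e q n(2) rT[of T] by auto
    have rq1: "quasi_geodesic X q' Q' {0..T} r" by (rule quasi_geodesic_subset[OF rq]) auto
    have "\<exists>y\<in>{0..}. mdist X (r x) (\<gamma> y) \<le> D1" if "x \<in> {0..T}" for x
      using morse_on_track(1)[OF g(3) gq is_interval_ci _ _ _ _ q' q(3) T(1) rq1 ends that] n(1)
      by (fastforce simp: D1_def)
    then have "morse_on X (\<lambda>p P. track_const B 1 0 p P D1 + track_const B 1 0 q' Q' D1) {0..T} r"
      by (intro morse_on_close[OF g(3) gq is_interval_ci _ _ rq1 _ q' D1]) (auto simp: is_interval_cc)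
    then have "morse_on X B1 {0..T} r" by (rule morse_on_mono) (simp add: B1_def)
    then have M1: "morse_on X B1 ({0..} \<inter> {..T}) r" by (rule morse_on_subset) auto
    have "morse_on X B {T..} (\<lambda>x. \<sigma> (- T + x))" by (rule morse_on_shift[OF \<sigma>(2)]) auto
    then have "morse_on X B {T..} r" by (rule morse_on_cong) (use rT in \<open>auto simp: is_interval_ci\<close>)
    then have "morse_on X B1 {T..} r" by (rule morse_on_mono) (simp add: B1_def)
    then have "morse_on X B1 ({0..} \<inter> {T..}) r" by (rule morse_on_subset) auto
    then have M: "morse_on X B2 {0..} r"
      unfolding B2_def using quasi_geodesic_mem[OF rq] T M1
      by (intro morse_on_join[OF X(2), of _ _ T]) (auto simp: is_interval_ci)
    obtain c where c: "morse_ray_from X e (realisation_bound B2 q' Q' 0) c" "fellow X D3 c r"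
      by (rule morse_ray_realisation[OF X rq M q' order_refl _ e]) (use r0 e in \<open>auto simp: D3_def\<close>)
    have cg: "geodesic_ray X c" "c 0 = e" using c(1) by (auto simp: morse_ray_from_def)
    note cd = geodesic_rayD[OF cg(1)]
    \<comment> \<open>\<open>F\<close> may grow with \<open>\<sigma>\<close>, as only asymptoticity
      is claimed here. Up to time \<open>T\<close> the path \<open>r\<close> stays within
      \<open>F\<close> of \<open>\<sigma> 0\<close>, and then it is \<open>\<sigma>\<close>.\<close>
    define F where "F = q' * T + Q'"
    have F0: "0 \<le> F" using q' T by (simp add: F_def)
    have "fellow X F r \<sigma>"
      unfolding fellow_def
    proof (intro conjI allI impI)
      fix t :: real assume t: "t \<ge> 0"
      show "\<exists>v\<ge>0. mdist X (r t) (\<sigma> v) \<le> F"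
      proof (cases "t \<ge> T")
        case True
        then show ?thesis using rT[OF True] \<sigma>m F0 by (intro exI[of _ "- T + t"]) auto
      next
        case False
        have "mdist X (r t) (r T) \<le> q' * \<bar>t - T\<bar> + Q'" using quasi_geodesic_upper[OF rq, of t T] t T
            by auto
        also have "\<dots> \<le> F" unfolding F_def using q' t False by (intro add_mono mult_left_mono) auto
        finally show ?thesis using rT[of T] by (intro exI[of _ 0]) auto
      qed
    next
      fix v :: real assume "v \<ge> 0"
      then show "\<exists>t\<ge>0. mdist X (r t) (\<sigma> v) \<le> F" using rT[of "T + v"] T \<sigma>m F0 by (intro exI[of _ "T +
          v"]) auto
    qed
    then have as: "asymptotic X c \<sigma>"
      using asymptotic_trans[OF fellow_imp_asymptotic[OF c(2)] fellow_imp_asymptotic] cd(3) \<sigma>m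
          quasi_geodesic_mem[OF rq] by auto
    obtain x where x: "x \<ge> 0" "mdist X (c x) (r T) \<le> D3" using c(2) T by (auto simp: fellow_def)
    have rTm: "r T \<in> mspace X" using rT[of T] \<sigma>m by simp
    have cx: "mdist X (c x) (\<gamma> n) \<le> E"
      using mdist_triangle[of "c x" X "r T" "\<gamma> n"] cd(1)[OF x(1)] rTm gd(1)[OF n(1)] x(2) ends(2) by
          (simp add: E_def)
    have xn: "n - E \<le> x"
      using mdist_triangle[of e X "c x" "\<gamma> n"] e cd(1)[OF x(1)] gd(1)[OF n(1)] cx cd(2)[of 0 x]
          gd(2)[of 0 n] g(2) cg(2) x n by simp
    have qc: "quasi_geodesic X 1 0 {0..x} c"
      using geodesic_ray_quasi_geodesic[OF cg(1)] by (rule quasi_geodesic_subset) auto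
    have ends': "mdist X (c 0) (\<gamma> 0) \<le> E" using cg g e E by simp
    have "mdist X (\<gamma> t) (c t) \<le> K'" if t: "0 \<le> t \<and> t \<le> n - K'" for t
    proof -
      have tx: "t \<in> {0..x}" using t xn by (auto simp: K'_def)
      obtain v where "v \<in> {min 0 n..max 0 n}" "mdist X (c t) (\<gamma> v) \<le> D4"
        using morse_on_track(1)[OF g(3) gq is_interval_ci _ _ _ _ _ _ E x(1) qc ends' cx tx] n(1) by
            (auto simp: D4_def)
      then have "mdist X (c t) (\<gamma> t) \<le> 2 * D4"
        using geodesic_rays_synchronise[OF cg(1) g(1), of t v D4] cg g t n(1) by auto
      then show ?thesis by (simp add: K'_def mdist_commute[of X "\<gamma> t"])
    qed
    then show "\<exists>c. morse_ray_from X e (realisation_bound B2 q' Q' 0) c \<and> asymptotic X c \<sigma> \<and>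
        (\<forall>t. 0 \<le> t \<and> t \<le> n - K' \<longrightarrow> mdist X (\<gamma> t) (c t) \<le> K')"
      using c(1) as by blast
  qed
qed

text \<open>If the almost nearest point lies on the positive half, the reversed line is used. This
  is why only one of the two ends, without control over which, is reached.\<close>

lemma morse_line_approach:
  assumes X: "proper_metric X" "geodesic_metric X" and q: "q \<ge> 1" "Q \<ge> 0" "K \<ge> 0"
    and \<gamma>: "morse_ray_from X e B \<gamma>"
  shows "\<exists>B' K'. \<forall>\<sigma> n. quasi_geodesic X q Q UNIV \<sigma> \<and> morse_on X B UNIV \<sigma> \<and> n \<ge> 0 \<and> mdist X (\<sigma> 0) (\<gamma>
      n) \<le> K \<longrightarrow>
    (\<exists>c. morse_ray_from X e B' c \<and> (asymptotic X c \<sigma> \<or> asymptotic X c (\<lambda>t. \<sigma> (- t))) \<and>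
       (\<forall>t. 0 \<le> t \<and> t \<le> n - K' \<longrightarrow> mdist X (\<gamma> t) (c t) \<le> K'))"
proof -
  obtain B' K' where *: "\<And>\<sigma> n u. quasi_geodesic X q Q UNIV \<sigma> \<Longrightarrow> morse_on X B UNIV \<sigma> \<Longrightarrow> n \<ge> 0 \<Longrightarrow>
      mdist X (\<sigma> 0) (\<gamma> n) \<le> K \<Longrightarrow> u \<le> 0 \<Longrightarrow> (\<forall>v. mdist X e (\<sigma> u) \<le> mdist X e (\<sigma> v) + 1) \<Longrightarrow>
    \<exists>c. morse_ray_from X e B' c \<and> asymptotic X c \<sigma> \<and> (\<forall>t. 0 \<le> t \<and> t \<le> n - K' \<longrightarrow> mdist X (\<gamma> t) (c t) \<le>
        K')"
    using morse_line_approach_aux[OF assms] by blast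
  show ?thesis
  proof (rule exI[of _ B'], rule exI[of _ K'], intro allI impI; elim conjE)
    fix \<sigma> n
    assume \<sigma>: "quasi_geodesic X q Q UNIV \<sigma>" "morse_on X B UNIV \<sigma>" "0 \<le> n" "mdist X (\<sigma> 0) (\<gamma> n) \<le> K"
    have refl: "quasi_geodesic X q Q UNIV (\<lambda>t. \<sigma> (0 - t))" "morse_on X B UNIV (\<lambda>t. \<sigma> (0 - t))"
      by (rule quasi_geodesic_reflect[OF \<sigma>(1)], simp) (rule morse_on_reflect[OF \<sigma>(2)], simp)
    obtain u where u: "\<And>v. mdist X e (\<sigma> u) \<le> mdist X e (\<sigma> v) + 1"
      using almost_nearest_point[of UNIV X e \<sigma>] by auto
    show "\<exists>c. morse_ray_from X e B' c \<and> (asymptotic X c \<sigma> \<or> asymptotic X c (\<lambda>t. \<sigma> (- t))) \<and>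
       (\<forall>t. 0 \<le> t \<and> t \<le> n - K' \<longrightarrow> mdist X (\<gamma> t) (c t) \<le> K')"
    proof (cases "u \<le> 0")
      case True
      then show ?thesis using *[OF \<sigma> True] u by blast
    next
      case False
      then show ?thesis using *[OF refl \<sigma>(3), of "- u"] \<sigma>(4) u by auto
    qed
  qed
qed

section \<open>Cayley graphs\<close>

locale cayley =
  fixes G :: "('a, 'm) monoid_scheme" (structure) and S :: "'a set"
  assumes grp: "group G" and fin_gen: "finite_generating_set G S"
begin

sublocale group G by (rule grp)

abbreviation "X \<equiv> cayley_graph G S"

lemmas mspace_X = mspace_cayley_graph[OF grp fin_gen]
  and mdist_X = mdist_cayley_graph[OF grp fin_gen]

lemma S_carrier: "S \<subseteq> carrier G" and finite_S: "finite S"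
  using fin_gen by (auto simp: finite_generating_set_def)

lemma cell_carrier: "\<sigma> \<in> cayley_cells G S \<Longrightarrow> \<sigma> \<subseteq> carrier G"
  using S_carrier by (auto simp: cayley_cells_def)

lemma cell_finite: "\<sigma> \<in> cayley_cells G S \<Longrightarrow> finite \<sigma>"
  by (auto simp: cayley_cells_def)

lemma cell_nonempty: "\<sigma> \<in> cayley_cells G S \<Longrightarrow> \<sigma> \<noteq> {}"
  by (auto simp: cayley_cells_def)

lemma pl_path_nonneg: "pl_path G S p q l \<Longrightarrow> 0 \<le> l"
  using pl_path_coord[of G S p q l undefined] by linarith

lemma mdist_le_pl_path: "pl_path G S p q l \<Longrightarrow> mdist X p q \<le> l"
  using pl_path_points[of G S p q l] pl_path_nonneg
  by (auto simp: mdist_X cayley_dist_def intro!: cInf_lower bdd_belowI[of _ 0])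

lemma pl_path_near_mdist:
  assumes "p \<in> mspace X" "q \<in> mspace X" "\<epsilon> > 0"
  shows "\<exists>l. pl_path G S p q l \<and> l < mdist X p q + \<epsilon>"
proof -
  have "{l. pl_path G S p q l} \<noteq> {}" using pl_path_exists[OF grp fin_gen] assms by (auto simp: mspace_X)
  from cInf_lessD[OF this, of "mdist X p q + \<epsilon>"] show ?thesis
    using assms by (auto simp: mspace_X mdist_X cayley_dist_def)
qed

lemma vertex_in_X: "g \<in> carrier G \<Longrightarrow> cayley_vertex g \<in> mspace X"
  unfolding mspace_X cayley_points_def cayley_cells_def
  using cayley_vertex_in_cell[of g "{g}"] by blast

lemma mdist_cell:
  assumes "\<sigma> \<in> cayley_cells G S" "p \<in> cell_points \<sigma>" "q \<in> cell_points \<sigma>" "v \<in> \<sigma>"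
  shows "mdist X p q \<le> \<bar>p v - q v\<bar>"
  using pl_path_step1[OF assms] by (rule mdist_le_pl_path)

lemma near_vertex:
  assumes "p \<in> mspace X"
  shows "\<exists>g\<in>carrier G. mdist X (cayley_vertex g) p \<le> 1"
proof -
  obtain \<sigma> where \<sigma>: "\<sigma> \<in> cayley_cells G S" "p \<in> cell_points \<sigma>" using assms by (auto simp: mspace_X
      cayley_points_def)
  obtain g where g: "g \<in> \<sigma>" using cell_nonempty[OF \<sigma>(1)] by blast
  have "mdist X (cayley_vertex g) p \<le> \<bar>cayley_vertex g g - p g\<bar>"
    using \<sigma> g cell_finite by (intro mdist_cell cayley_vertex_in_cell) auto
  moreover have "0 \<le> p g" "p g \<le> 1"
    using \<sigma>(2) g cell_finite[OF \<sigma>(1)] member_le_sum[of g \<sigma> p] by (auto simp: cell_points_def)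
  ultimately show ?thesis using g cell_carrier[OF \<sigma>(1)]
    by (intro bexI[of _ g]) (auto simp: cayley_vertex_def)
qed

subsection \<open>Translations\<close>

lemma translate_cell:
  assumes g: "g \<in> carrier G" and \<sigma>: "\<sigma> \<in> cayley_cells G S"
  shows "(\<otimes>) g ` \<sigma> \<in> cayley_cells G S"
proof -
  consider h where "\<sigma> = {h}" "h \<in> carrier G" | h s where "\<sigma> = {h, h \<otimes> s}" "h \<in> carrier G" "s \<in> S"
    using \<sigma> by (auto simp: cayley_cells_def)
  then show ?thesis
  proof cases
    case 1
    then show ?thesis using g by (auto simp: cayley_cells_def)
  next
    case 2
    then have "(\<otimes>) g ` \<sigma> = {g \<otimes> h, g \<otimes> h \<otimes> s}" using g S_carrier by (auto simp: m_assoc)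
    moreover have "g \<otimes> h \<in> carrier G" using g 2 by auto
    ultimately show ?thesis using 2(3) unfolding cayley_cells_def by blast
  qed
qed

lemma translate_apply:
  assumes "g \<in> carrier G" "x \<in> carrier G" shows "cayley_translate G g p (g \<otimes> x) = p x"
proof -
  have "inv g \<otimes> (g \<otimes> x) = x" using assms by (metis inv_closed l_inv l_one m_assoc)
  then show ?thesis using assms by (simp add: cayley_translate_def)
qed

lemma translate_cell_points:
  assumes g: "g \<in> carrier G" and \<sigma>: "\<sigma> \<in> cayley_cells G S" and p: "p \<in> cell_points \<sigma>"
  shows "cayley_translate G g p \<in> cell_points ((\<otimes>) g ` \<sigma>)"
proof -
  note c = cell_carrier[OF \<sigma>]
  have "cayley_translate G g p x = 0" if "x \<notin> (\<otimes>) g ` \<sigma>" for x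
  proof (cases "x \<in> carrier G")
    case True
    then have "x = g \<otimes> (inv g \<otimes> x)" using g by (metis inv_closed r_inv l_one m_assoc)
    then have "inv g \<otimes> x \<notin> \<sigma>" using that by blast
    then show ?thesis using p by (simp add: cayley_translate_def cell_points_def)
  qed (simp add: cayley_translate_def)
  moreover have "(\<Sum>x\<in>(\<otimes>) g ` \<sigma>. cayley_translate G g p x) = (\<Sum>x\<in>\<sigma>. p x)"
  proof (subst sum.reindex)
    show "inj_on ((\<otimes>) g) \<sigma>" using inj_on_cmult[OF g] c by (rule inj_on_subset)
    show "sum (cayley_translate G g p \<circ> (\<otimes>) g) \<sigma> = sum p \<sigma>"
      using translate_apply[OF g] c by (intro sum.cong) auto
  qed
  ultimately show ?thesis using p by (auto simp: cell_points_def cayley_translate_def)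
qed

lemma translate_mem:
  assumes "g \<in> carrier G" "p \<in> mspace X" shows "cayley_translate G g p \<in> mspace X"
proof -
  obtain \<sigma> where \<sigma>: "\<sigma> \<in> cayley_cells G S" "p \<in> cell_points \<sigma>"
    using assms(2) by (auto simp: mspace_X cayley_points_def)
  then show ?thesis
    using translate_cell[OF assms(1) \<sigma>(1)] translate_cell_points[OF assms(1) \<sigma>]
    by (auto simp: mspace_X cayley_points_def)
qed

lemma translate_pl_path:
  assumes g: "g \<in> carrier G"
  shows "pl_path G S p q l \<Longrightarrow> pl_path G S (cayley_translate G g p) (cayley_translate G g q) l"
proof (induction rule: pl_path.induct)
  case (pl_refl p)
  then show ?case using translate_mem[OF g] by (auto simp: mspace_X intro: pl_path.pl_refl)
next
  case (pl_step p q l \<sigma> r v)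
  from pl_path.pl_step[OF pl_step.IH translate_cell[OF g pl_step(2)]
      translate_cell_points[OF g pl_step(2,3)] translate_cell_points[OF g pl_step(2,4)], of "g \<otimes> v"]
  show ?case using pl_step(2,5) translate_apply[OF g, of v] cell_carrier[OF pl_step(2)] by auto
qed

lemma translate_mdist_le:
  assumes g: "g \<in> carrier G" and "p \<in> mspace X" "q \<in> mspace X"
  shows "mdist X (cayley_translate G g p) (cayley_translate G g q) \<le> mdist X p q"
proof (rule field_le_epsilon)
  fix \<epsilon> :: real assume "\<epsilon> > 0"
  then obtain l where "pl_path G S p q l" "l < mdist X p q + \<epsilon>" using pl_path_near_mdist assms(2,3)
      by blast
  then show "mdist X (cayley_translate G g p) (cayley_translate G g q) \<le> mdist X p q + \<epsilon>"
    using mdist_le_pl_path[OF translate_pl_path[OF g]] by fastforce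
qed

lemma points_zero: "p \<in> mspace X \<Longrightarrow> x \<notin> carrier G \<Longrightarrow> p x = 0"
  using cell_carrier unfolding mspace_X cayley_points_def by (fastforce simp: cell_points_def)

lemma translate_translate:
  assumes "g \<in> carrier G" "h \<in> carrier G"
  shows "cayley_translate G g (cayley_translate G h p) = cayley_translate G (g \<otimes> h) p"
  using assms by (auto simp: cayley_translate_def fun_eq_iff inv_mult_group m_assoc)

lemma translate_one: "p \<in> mspace X \<Longrightarrow> cayley_translate G \<one> p = p"
  using points_zero by (auto simp: cayley_translate_def fun_eq_iff)

lemma translate_inverse:
  assumes "g \<in> carrier G" "p \<in> mspace X"
  shows "cayley_translate G (inv g) (cayley_translate G g p) = p" "cayley_translate G g
      (cayley_translate G (inv g) p) = p"
  using assms by (auto simp: translate_translate translate_one)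

text \<open>Translations do not increase distances; applied to the inverse element this gives
  equality.\<close>

lemma translate_mdist:
  assumes g: "g \<in> carrier G" and pq: "p \<in> mspace X" "q \<in> mspace X"
  shows "mdist X (cayley_translate G g p) (cayley_translate G g q) = mdist X p q"
  using translate_mdist_le[OF g pq] translate_mdist_le[of "inv g" "cayley_translate G g p"
      "cayley_translate G g q"]
    translate_inverse(1)[OF g] translate_mem[OF g] g pq by auto

text \<open>Makes every statement about quasi-isometries available for the action, with constants 1
  and 0.\<close>

lemma translate_qi_pair:
  assumes g: "g \<in> carrier G"
  shows "qi_pair X X (cayley_translate G g) (cayley_translate G (inv g)) 1 0"
  unfolding qi_pair_def using g translate_mem translate_mdist translate_inverse by auto

subsection \<open>Properness\<close>

text \<open>Edges can be traversed both ways and \<open>S\<close> need not be symmetric, so a step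
  multiplies by a generator or by an inverse of one.\<close>

fun word_ball :: "nat \<Rightarrow> 'a set" where
  "word_ball 0 = {\<one>}"
| "word_ball (Suc n) = word_ball n \<union> (\<lambda>(g, s). g \<otimes> s) ` (word_ball n \<times> S) \<union> (\<lambda>(g, s). g \<otimes> inv s) `
    (word_ball n \<times> S)"

lemma finite_word_ball: "finite (word_ball n)"
  by (induction n) (auto intro: finite_S)

lemma word_ball_neighbour:
  assumes "\<sigma> \<in> cayley_cells G S" "u \<in> \<sigma>" "u \<in> word_ball n"
  shows "\<sigma> \<subseteq> word_ball (Suc n)"
proof -
  consider h where "\<sigma> = {h}" | h s where "\<sigma> = {h, h \<otimes> s}" "h \<in> carrier G" "s \<in> S"
    using assms(1) by (auto simp: cayley_cells_def)
  then show ?thesis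
  proof cases
    case 1
    then show ?thesis using assms by auto
  next
    case 2
    then have "h = h \<otimes> s \<otimes> inv s" using S_carrier by (auto simp: m_assoc)
    then have "h \<in> (\<lambda>(g, s). g \<otimes> inv s) ` (word_ball n \<times> S)" if "h \<otimes> s \<in> word_ball n"
      using that 2(3) by (force intro!: image_eqI[of _ _ "(h \<otimes> s, s)"])
    then show ?thesis using 2 assms(2,3) by auto
  qed
qed

text \<open>Here \<open>1 - p v\<close> is the distance from the point \<open>p\<close> to the vertex \<open>v\<close> of its cell.\<close>

lemma pl_path_word_ball:
  "pl_path G S p0 p l \<Longrightarrow> p0 = cayley_vertex \<one> \<Longrightarrow> p v > 0 \<Longrightarrow> \<exists>n. v \<in> word_ball n \<and> real n \<le> l + 1 - p v"
proof (induction arbitrary: v rule: pl_path.induct)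
  case (pl_refl p)
  then have "v = \<one>" by (auto simp: cayley_vertex_def split: if_splits)
  then show ?case using pl_refl by (intro exI[of _ 0]) (auto simp: cayley_vertex_def)
next
  case (pl_step p q l \<sigma> r w)
  have l0: "0 \<le> l" using pl_step(1) by (rule pl_path_nonneg)
  have v\<sigma>: "v \<in> \<sigma>" using pl_step.prems(2) pl_step(4) by (auto simp: cell_points_def)
  have d: "\<bar>q w - r w\<bar> = \<bar>q v - r v\<bar>" using cell_dist_eq[OF pl_step(2,3,4) v\<sigma> pl_step(5)] .
  show ?case
  proof (cases "q v > 0")
    case True
    then show ?thesis using pl_step.IH[OF pl_step.prems(1) True] d by fastforce
  next
    case False
    then have qv: "q v = 0" using pl_step(3) by (auto simp: cell_points_def not_less intro:
        order_antisym)
    have s1: "sum q \<sigma> = 1" and q0: "\<And>x. 0 \<le> q x" using pl_step(3) by (auto simp: cell_points_def)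
    \<comment> \<open>With \<open>q v = 0\<close>, the point \<open>q\<close> is the other vertex
      \<open>u\<close> of the edge. The last step of the path, of length \<open>r v\<close>, pays
      for the additional letter.\<close>
    obtain u where u: "u \<in> \<sigma>" "q u > 0" "q u \<ge> 1"
    proof -
      obtain a b where ab: "\<sigma> = {a, b}" using pl_step(2) by (auto simp: cayley_cells_def)
      then show ?thesis using s1 qv v\<sigma> that[of a] that[of b] by (cases "a = b") auto
    qed
    obtain n where n: "u \<in> word_ball n" "real n \<le> l + 1 - q u" using pl_step.IH[OF pl_step.prems(1)
        u(2)] by blast
    have "v \<in> word_ball (Suc n)" using word_ball_neighbour[OF pl_step(2) u(1) n(1)] v\<sigma> by blast
    moreover have "real (Suc n) \<le> l + \<bar>q w - r w\<bar> + 1 - r v" using n u qv pl_step.prems(2) unfolding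
        d by simp
    ultimately show ?thesis by blast
  qed
qed

lemma word_ball_mono: "m \<le> n \<Longrightarrow> word_ball m \<subseteq> word_ball n"
  by (rule lift_Suc_mono_le[of word_ball]) auto

text \<open>A cell is a Lipschitz image of the unit interval; the case \<open>a = b\<close> of a
  single vertex is covered by a constant map.\<close>

lemma compactin_cell:
  assumes \<sigma>: "\<sigma> \<in> cayley_cells G S"
  shows "compactin (mtopology_of X) (cell_points \<sigma>)"
proof -
  obtain a b where ab: "\<sigma> = {a, b}" using \<sigma> by (auto simp: cayley_cells_def)
  define c where "c t = (\<lambda>x. if x = a then (if a = b then 1 else 1 - t) else if x = b then t else
      (0::real))" for t
  have c\<sigma>: "c t \<in> cell_points \<sigma>" if "t \<in> {0..1}" for t
    using that unfolding ab by (auto simp: c_def cell_points_def)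
  have img: "cell_points \<sigma> = c ` {0..1}"
  proof
    show "c ` {0..1} \<subseteq> cell_points \<sigma>" using c\<sigma> by auto
    show "cell_points \<sigma> \<subseteq> c ` {0..1}"
    proof
      fix p assume p: "p \<in> cell_points \<sigma>"
      show "p \<in> c ` {0..1}"
      proof (cases "a = b")
        case True
        then have "p = c 0" using p unfolding ab by (auto simp: c_def cell_points_def fun_eq_iff)
        then show ?thesis by auto
      next
        case False
        then have s: "p a + p b = 1" "0 \<le> p a" "0 \<le> p b" using p unfolding ab by (auto simp:
            cell_points_def)
        have "p = c (p b)" using p False s unfolding ab by (auto simp: c_def cell_points_def fun_eq_iff)
        moreover have "p b \<in> {0..1}" using s by auto
        ultimately show ?thesis by blast
      qed
    qed
  qed
  have sub: "cell_points \<sigma> \<subseteq> mspace X" using \<sigma> by (auto simp: mspace_X cayley_points_def)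
  have lip: "mdist X (c s) (c t) \<le> \<bar>s - t\<bar>" if "s \<in> {0..1}" "t \<in> {0..1}" for s t
    using mdist_cell[OF \<sigma> c\<sigma>[OF that(1)] c\<sigma>[OF that(2)], of b] by (auto simp: c_def ab split: if_splits)
  have "continuous_map (mtopology_of (submetric euclidean_metric {0..1})) (mtopology_of X) c"
    by (rule Lipschitz_continuous_imp_continuous_map)
      (use lip sub c\<sigma> in \<open>auto simp: Lipschitz_continuous_map_def dist_real_def intro!: exI[of _ 1]\<close>)
  then have "continuous_map (subtopology euclidean {0..1}) (mtopology_of X) c"
    by (simp add: mtopology_of_submetric)
  moreover have "compactin (subtopology euclidean {0..1}) {0..1::real}" by (simp add:
      compactin_subtopology)
  ultimately show ?thesis unfolding img by (rule image_compactin[rotated])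
qed

text \<open>A bounded set meets only cells with a vertex of bounded word length. These are finitely
  many compact sets, and a closed ball is closed in their union.\<close>

lemma proper_X: "proper_metric X"
  unfolding proper_metric_def
proof (intro ballI allI)
  fix x r assume x: "x \<in> mspace X"
  define e where "e = cayley_vertex \<one>"
  have e: "e \<in> mspace X" by (simp add: e_def vertex_in_X)
  define N where "N = nat \<lceil>mdist X e x + r + 3\<rceil>"
  define F where "F = {\<sigma> \<in> cayley_cells G S. \<sigma> \<subseteq> word_ball (Suc N)}"
  have "finite F" by (rule finite_subset[of _ "Pow (word_ball (Suc N))"]) (auto simp: F_def
      finite_word_ball simp del: word_ball.simps)
  then have "compactin (mtopology_of X) (\<Union>\<sigma>\<in>F. cell_points \<sigma>)"
    by (intro compactin_Union) (auto simp: F_def intro: compactin_cell)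
  moreover have "mcball_of X x r \<subseteq> (\<Union>\<sigma>\<in>F. cell_points \<sigma>)"
  proof
    fix p assume "p \<in> mcball_of X x r"
    then have p: "p \<in> mspace X" "mdist X x p \<le> r" by auto
    have "mdist X e p \<le> mdist X e x + r" using mdist_triangle[OF e x p(1)] p(2) by simp
    moreover obtain l where l: "pl_path G S e p l" "l < mdist X e p + 1"
      using pl_path_near_mdist[OF e p(1), of 1] by auto
    ultimately have lN: "l + 1 \<le> real N" unfolding N_def by linarith
    obtain \<sigma> where \<sigma>: "\<sigma> \<in> cayley_cells G S" "p \<in> cell_points \<sigma>" using p(1) by (auto simp: mspace_X
        cayley_points_def)
    have "\<exists>v\<in>\<sigma>. p v > 0"
    proof (rule ccontr)
      assume "\<not> ?thesis"
      then have "sum p \<sigma> \<le> 0" by (intro sum_nonpos) (auto simp: not_less)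
      then show False using \<sigma>(2) by (auto simp: cell_points_def)
    qed
    then obtain v where v: "v \<in> \<sigma>" "p v > 0" by blast
    obtain n where n: "v \<in> word_ball n" "real n \<le> l + 1 - p v" using pl_path_word_ball[OF l(1) e_def
        v(2)] by blast
    have "n \<le> N" using n(2) v(2) lN by linarith
    then have "v \<in> word_ball N" using n(1) word_ball_mono by blast
    then have "\<sigma> \<in> F" using word_ball_neighbour[OF \<sigma>(1) v(1)] \<sigma>(1) by (simp add: F_def)
    then show "p \<in> (\<Union>\<sigma>\<in>F. cell_points \<sigma>)" using \<sigma>(2) by blast
  qed
  moreover have "closedin (mtopology_of X) (mcball_of X x r)"
    by (simp add: mcball_of_def mtopology_of_def Metric_space.closedin_mcball)
  ultimately show "compactin (mtopology_of X) (mcball_of X x r)" by (rule closed_compactin)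
qed

subsection \<open>Geodesics\<close>

text \<open>The path is run through at unit speed, with linear interpolation inside each cell, and
  then rests at its endpoint.\<close>

lemma pl_path_Lipschitz:
  "pl_path G S p q l \<Longrightarrow> \<exists>c. c \<in> {0..} \<rightarrow> mspace X \<and> c 0 = p \<and> (\<forall>t\<ge>l. c t = q) \<and>
     (\<forall>s\<ge>0. \<forall>t\<ge>0. mdist X (c s) (c t) \<le> \<bar>s - t\<bar>)"
proof (induction rule: pl_path.induct)
  case (pl_refl p)
  then show ?case by (intro exI[of _ "\<lambda>_. p"]) (auto simp: mspace_X)
next
  case (pl_step p q l \<sigma> r v)
  obtain c where c: "c \<in> {0..} \<rightarrow> mspace X" "c 0 = p" "\<And>t. t \<ge> l \<Longrightarrow> c t = q"
     "\<And>s t. s \<ge> 0 \<Longrightarrow> t \<ge> 0 \<Longrightarrow> mdist X (c s) (c t) \<le> \<bar>s - t\<bar>"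
    using pl_step.IH by blast
  have l0: "0 \<le> l" using pl_step(1) by (rule pl_path_nonneg)
  define \<delta> where "\<delta> = \<bar>q v - r v\<bar>"
  \<comment> \<open>The fraction of the last segment covered at time \<open>t\<close>. A segment of
    length 0 counts as finished at once, which avoids a division by 0.\<close>
  define \<theta> where "\<theta> t = (if \<delta> = 0 then 1 else min 1 ((t - l) / \<delta>))" for t
  define m where "m t = (\<lambda>x. (1 - \<theta> t) * q x + \<theta> t * r x)" for t
  define c' where "c' t = (if t \<le> l then c t else m t)" for t
  have \<delta>0: "\<delta> \<ge> 0" by (simp add: \<delta>_def)
  have \<theta>: "0 \<le> \<theta> t" "\<theta> t \<le> 1" if "t \<ge> l" for t using that \<delta>0 by (auto simp: \<theta>_def)
  have m\<sigma>: "m t \<in> cell_points \<sigma>" if "t \<ge> l" for t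
  proof -
    have "sum (m t) \<sigma> = (1 - \<theta> t) * sum q \<sigma> + \<theta> t * sum r \<sigma>" by (simp add: m_def sum.distrib
        sum_distrib_left)
    then show ?thesis using pl_step(3,4) \<theta>[OF that] by (auto simp: cell_points_def m_def)
  qed
  have \<sigma>X: "x \<in> mspace X" if "x \<in> cell_points \<sigma>" for x using that pl_step(2) by (auto simp: mspace_X
      cayley_points_def)
  have mm: "mdist X (m s) (m t) \<le> t - s" if "l \<le> s" "s \<le> t" for s t
  proof -
    have "mdist X (m s) (m t) \<le> \<bar>m s v - m t v\<bar>"
      by (rule mdist_cell[OF pl_step(2) m\<sigma> m\<sigma> pl_step(5)]) (use that in auto)
    also have "m s v - m t v = (\<theta> t - \<theta> s) * (q v - r v)" by (simp add: m_def algebra_simps)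
    also have "\<bar>\<dots>\<bar> = \<bar>\<theta> t - \<theta> s\<bar> * \<delta>" by (simp add: abs_mult \<delta>_def)
    also have "\<dots> \<le> t - s"
    proof (cases "\<delta> = 0")
      case False
      then have "\<bar>\<theta> t - \<theta> s\<bar> \<le> (t - l) / \<delta> - (s - l) / \<delta>"
        using that \<delta>0 divide_right_mono[of "s - l" "t - l" \<delta>] by (auto simp: \<theta>_def min_def)
      also have "\<dots> = (t - s) / \<delta>" by (simp add: diff_divide_distrib)
      finally show ?thesis using False \<delta>0 by (simp add: pos_le_divide_eq)
    qed (use that in auto)
    finally show ?thesis .
  qed
  have mq: "mdist X q (m t) \<le> t - l" if "t \<ge> l" for t
  proof (cases "\<delta> = 0")
    case True
    have "mdist X q (m t) \<le> \<bar>q v - m t v\<bar>" by (rule mdist_cell[OF pl_step(2,3) m\<sigma> pl_step(5)]) (use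
        that in auto)
    also have "\<dots> = 0" using True by (simp add: m_def \<theta>_def \<delta>_def)
    finally show ?thesis using that by simp
  next
    case False
    then have "m l = q" by (simp add: m_def \<theta>_def)
    then show ?thesis using mm[of l t] that by simp
  qed
  have ordered: "mdist X (c' s) (c' t) \<le> t - s" if "0 \<le> s" "s \<le> t" for s t
  proof -
    consider "t \<le> l" | "s \<le> l" "l < t" | "l < s" by linarith
    then show ?thesis
    proof cases
      case 1
      then show ?thesis using c(4)[of s t] that by (simp add: c'_def)
    next
      case 2
      have "mdist X (c s) (m t) \<le> mdist X (c s) (c l) + mdist X (c l) (m t)"
        using c(1) l0 that 2 m\<sigma>[of t] \<sigma>X by (intro mdist_triangle) auto
      then show ?thesis using 2 c(3)[of l] c(4)[of s l] mq[of t] l0 that by (simp add: c'_def)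
    next
      case 3
      then show ?thesis using mm[of s t] that by (simp add: c'_def)
    qed
  qed
  have lip: "mdist X (c' s) (c' t) \<le> \<bar>s - t\<bar>" if "0 \<le> s" "0 \<le> t" for s t
    using ordered[of s t] ordered[of t s] that mdist_commute[of X "c' s" "c' t"] by (cases "s \<le> t") auto
  have fin: "c' t = r" if "t \<ge> l + \<delta>" for t
  proof (cases "\<delta> = 0")
    case False
    then have "t > l" "\<theta> t = 1" using that \<delta>0 by (auto simp: \<theta>_def min_def field_simps)
    then show ?thesis by (simp add: c'_def m_def)
  next
    case True
    have "q x = r x" for x
    proof (cases "x \<in> \<sigma>")
      case True
      then show ?thesis using cell_dist_eq[OF pl_step(2,3,4,5) True] \<open>\<delta> = 0\<close> by (simp add: \<delta>_def)
    next
      case False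
      then show ?thesis using pl_step(3,4) by (simp add: cell_points_def)
    qed
    then have "q = r" by auto
    moreover have "m t = r" using True by (simp add: m_def \<theta>_def)
    ultimately show ?thesis using that \<delta>0 c(3)[of t] by (cases "t \<le> l") (auto simp: c'_def)
  qed
  show ?case
    using c(1,2) l0 m\<sigma> \<sigma>X lip fin unfolding \<delta>_def[symmetric]
    by (intro exI[of _ c']) (auto simp: c'_def Pi_iff)
qed

text \<open>The distance is an infimum of lengths. Almost shortest paths, parametrised as
  1-Lipschitz paths, converge along a subsequence to one that reaches \<open>q\<close> at time
  \<open>d\<close>; such a path is geodesic.\<close>

lemma geodesic_X: "geodesic_metric X"
  unfolding geodesic_metric_def
proof (intro ballI)
  fix p q assume pq: "p \<in> mspace X" "q \<in> mspace X"
  define d where "d = mdist X p q"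
  have ex: "\<exists>c l. c \<in> {0..} \<rightarrow> mspace X \<and> c 0 = p \<and> (\<forall>t\<ge>l. c t = q) \<and>
     (\<forall>s\<ge>0. \<forall>t\<ge>0. mdist X (c s) (c t) \<le> \<bar>s - t\<bar>) \<and> l < d + 1 / (real n + 1)" for n
  proof -
    obtain l where "pl_path G S p q l" "l < d + 1 / (real n + 1)"
      using pl_path_near_mdist[OF pq, of "1 / (real n + 1)"] unfolding d_def by auto
    then show ?thesis using pl_path_Lipschitz[of p q l] by blast
  qed
  obtain c l where c: "\<And>n. c n \<in> {0..} \<rightarrow> mspace X" "\<And>n. c n 0 = p" "\<And>n t. t \<ge> l n \<Longrightarrow> c n t = q"
    "\<And>n s t. s \<ge> 0 \<Longrightarrow> t \<ge> 0 \<Longrightarrow> mdist X (c n s) (c n t) \<le> \<bar>s - t\<bar>" "\<And>n. l n < d + 1 / (real n + 1)"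
    using ex by metis
  obtain g \<rho> where g: "g \<in> {0..} \<rightarrow> mspace X" and g0: "g 0 = p" and g': "strict_mono (\<rho> :: nat \<Rightarrow> nat)"
    "\<And>s t. s \<ge> 0 \<Longrightarrow> t \<ge> 0 \<Longrightarrow> mdist X (g s) (g t) \<le> \<bar>s - t\<bar>"
    "\<And>n t. t \<in> {0..real n} \<Longrightarrow> mdist X (c (\<rho> n) t) (g t) \<le> 1 / (real n + 1)"
    by (rule Lipschitz_paths_subsequence[OF proper_X pq(1), of c]) (use c in auto)
  have \<rho>: "n \<le> \<rho> n" for n using g'(1) by (rule strict_mono_imp_increasing)
  have d0: "0 \<le> d" by (simp add: d_def)
  have small: "x = y" if xy: "x \<in> mspace X" "y \<in> mspace X" and "\<And>n. real n \<ge> d \<Longrightarrow> mdist X x y \<le> 2 /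
      (real n + 1)" for x y
  proof -
    have "mdist X x y \<le> 0"
    proof (rule field_le_epsilon)
      fix \<epsilon> :: real assume \<epsilon>: "\<epsilon> > 0"
      obtain n where n: "real n > max d (2 / \<epsilon>)" using reals_Archimedean2 by blast
      then have "2 / \<epsilon> < real n + 1" by simp
      then have "2 / (real n + 1) \<le> \<epsilon>" using \<epsilon> by (simp add: field_simps)
      then show "mdist X x y \<le> 0 + \<epsilon>" using that(3)[of n] n by simp
    qed
    then show ?thesis using xy mdist_nonneg[of X x y] by simp
  qed
  have gm: "g t \<in> mspace X" if "t \<ge> 0" for t using g that by auto
  have gd: "g d = q"
  proof (rule small)
    fix n :: nat assume n: "real n \<ge> d"
    define m where "m = \<rho> n"
    have "1 / (real m + 1) \<le> 1 / (real n + 1)" using \<rho>[of n] by (simp add: m_def divide_left_mono)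
    then have ld: "l m \<le> d + 1 / (real n + 1)" using c(5)[of m] by linarith
    \<comment> \<open>By this time the path has arrived at \<open>q\<close>, and it exceeds
      \<open>d\<close> by at most the excess length of the path.\<close>
    define t where "t = max (l m) d"
    have "0 \<le> 1 / (real n + 1)" by simp
    then have t: "t \<ge> 0" "c m t = q" "\<bar>d - t\<bar> \<le> 1 / (real n + 1)"
      using d0 ld c(3)[of m t] unfolding t_def by linarith+
    have "mdist X (g d) q \<le> mdist X (g d) (c m d) + mdist X (c m d) (c m t)"
      using mdist_triangle[of "g d" X "c m d" q] gm[OF d0] c(1)[of m] d0 pq(2) t(2) by auto
    also have "\<dots> \<le> 1 / (real n + 1) + 1 / (real n + 1)"
      using g'(3)[of d n] n d0 c(4)[of d t m] t by (intro add_mono) (auto simp: m_def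
          mdist_commute[of X "g d"])
    finally show "mdist X (g d) q \<le> 2 / (real n + 1)" by simp
  qed (use gm d0 pq in auto)
  have "mdist X (g s) (g t) = \<bar>s - t\<bar>" if st: "s \<in> {0..d}" "t \<in> {0..d}" "s \<le> t" for s t
  proof -
    \<comment> \<open>The three summands are at most \<open>s\<close>, \<open>t - s\<close> and
      \<open>d - t\<close>, which add up to \<open>d\<close>; so none of them can be
      smaller.\<close>
    have "d \<le> mdist X (g 0) (g s) + mdist X (g s) (g t) + mdist X (g t) (g d)"
      using mdist_triangle4[of "g 0" X "g s" "g t" "g d"] gm st g0 gd by (auto simp: d_def)
    then show ?thesis using g'(2)[of 0 s] g'(2)[of s t] g'(2)[of t d] st by auto
  qed
  then have "mdist X (g s) (g t) = \<bar>s - t\<bar>" if "s \<in> {0..d}" "t \<in> {0..d}" for s t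
    using that mdist_commute[of X "g s" "g t"] by (cases "s \<le> t") auto
  then show "\<exists>c. c \<in> {0..mdist X p q} \<rightarrow> mspace X \<and> c 0 = p \<and> c (mdist X p q) = q \<and>
     (\<forall>s\<in>{0..mdist X p q}. \<forall>t\<in>{0..mdist X p q}. mdist X (c s) (c t) = \<bar>s - t\<bar>)"
    using g0 gd gm unfolding d_def[symmetric] by (intro exI[of _ g]) auto
qed

end

section \<open>Components of the boundary of a group\<close>

lemma nonsingleton_components_homeomorphic:
  assumes f: "homeomorphic_map T T' f" and C: "C \<in> nonsingleton_components T"
  shows "f ` C \<in> nonsingleton_components T'"
proof -
  have C': "C \<in> connected_components_of T" "\<not> is_singleton C" using C by (auto simp:
      nonsingleton_components_def)
  have inj: "inj_on f C"
    using homeomorphic_imp_injective_map[OF f] connected_components_of_subset[OF C'(1)] by (rule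
        inj_on_subset)
  have "is_singleton C" if "is_singleton (f ` C)"
    using that card_image[OF inj] by (simp add: is_singleton_altdef)
  then show ?thesis
    using C' homeomorphic_map_connected_components_of[OF f] by (auto simp: nonsingleton_components_def)
qed

text \<open>The form in which point-convergence is used, carried over the homeomorphism: two choices
  of points from the same distinct components cannot have different limits.\<close>

lemma point_convergent_unique_limit:
  assumes f: "homeomorphic_map T T' f" and pc: "point_convergent T' (nonsingleton_components T')"
    and A: "inj (A :: nat \<Rightarrow> _)" "range A \<subseteq> nonsingleton_components T"
    and \<xi>: "\<And>n. \<xi> n \<in> A n" "limitin T \<xi> x sequentially" and \<eta>: "\<And>n. \<eta> n \<in> A n" "limitin T \<eta> y
        sequentially"
  shows "x = y"
proof -
  have inj: "inj_on f (topspace T)" by (rule homeomorphic_imp_injective_map[OF f])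
  have sub: "A n \<subseteq> topspace T" for n
    using A(2) connected_components_of_subset by (force simp: nonsingleton_components_def)
  have "inj (\<lambda>n. f ` A n)"
    using A(1) inj_on_image_eq_iff[OF inj sub sub] by (auto simp: inj_def)
  moreover have "range (\<lambda>n. f ` A n) \<subseteq> nonsingleton_components T'"
    using nonsingleton_components_homeomorphic[OF f] A(2) by auto
  ultimately have card: "finite (set_limit T' (\<lambda>n. f ` A n))" "card (set_limit T' (\<lambda>n. f ` A n)) \<le> 1"
    using pc[unfolded point_convergent_def, rule_format, of "\<lambda>n. f ` A n"] by auto
  have cont: "continuous_map T T' f" by (rule homeomorphic_imp_continuous_map[OF f])
  have "f x \<in> set_limit T' (\<lambda>n. f ` A n)"
    unfolding set_limit_def using continuous_map_limit[OF cont \<xi>(2)] \<xi>(1) by (intro CollectI exI[of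
        _ "f \<circ> \<xi>"]) auto
  moreover have "f y \<in> set_limit T' (\<lambda>n. f ` A n)"
    unfolding set_limit_def using continuous_map_limit[OF cont \<eta>(2)] \<eta>(1) by (intro CollectI exI[of
        _ "f \<circ> \<eta>"]) auto
  ultimately have "f x = f y"
    using card card_le_Suc0_iff_eq[OF card(1)] by auto
  moreover have "x \<in> topspace T" "y \<in> topspace T" using \<xi>(2) \<eta>(2) by (auto simp: limitin_def)
  ultimately show ?thesis using inj by (auto dest: inj_onD)
qed

lemma fellow_pointwise: "(\<And>t. t \<ge> 0 \<Longrightarrow> mdist X (\<alpha> t) (\<beta> t) \<le> D) \<Longrightarrow> fellow X D \<alpha> \<beta>"
  by (auto simp: fellow_def)

section \<open>The action on the boundary and the two inclusions\<close>

context cayley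
begin

abbreviation "e \<equiv> cayley_vertex \<one>"

abbreviation "bdry \<equiv> morse_boundary X e"

abbreviation "act \<equiv> boundary_action G S"

lemma e_X: "e \<in> mspace X"
  by (simp add: vertex_in_X)

lemma act_eq_boundary_map: "act g = boundary_map X e (cayley_translate G g)"
  by (simp add: fun_eq_iff boundary_action_def boundary_map_def)

lemma act_homeomorphic: "g \<in> carrier G \<Longrightarrow> homeomorphic_map bdry bdry (act g)"
  unfolding act_eq_boundary_map
  by (rule homeomorphic_boundary_map[OF translate_qi_pair proper_X geodesic_X proper_X geodesic_X
      e_X e_X])

text \<open>\<open>\<tau>\<close> may be any path asymptotic to \<open>a\<close>; it will be a
  shifted or reversed half of a line, which need not start at the identity.\<close>

lemma act_class:
  assumes g: "g \<in> carrier G" and a: "morse_ray_from X e B a"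
    and \<tau>: "\<tau> \<in> {0..} \<rightarrow> mspace X" "asymptotic X \<tau> a"
  shows "morse_class X e (\<lambda>t. cayley_translate G g (\<tau> t)) = act g (morse_class X e a)"
proof -
  have "act g (morse_class X e a) = act g (morse_class X e \<tau>)"
    by (simp add: morse_class_cong[OF \<tau>(2,1) morse_ray_from_mem[OF a]])
  also have "\<dots> = morse_class X e (\<lambda>t. cayley_translate G g (\<tau> t))"
    unfolding act_eq_boundary_map
    using morse_ray_in_class[OF a] morse_class_cong[OF \<tau>(2,1) morse_ray_from_mem[OF a]]
    by (intro boundary_map_class[OF translate_qi_pair[OF g] \<tau>(1)]) auto
  finally show ?thesis ..
qed

lemma act_act:
  assumes g: "g \<in> carrier G" and h: "h \<in> carrier G" and x: "x \<in> topspace bdry"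
  shows "act g (act h x) = act (g \<otimes> h) x"
proof -
  obtain B a where a: "morse_ray_from X e B a" "x = morse_class X e a"
    using x by (auto simp: in_topspace_morse_boundary)
  note am = morse_ray_from_mem[OF a(1)]
  have cl: "act k x = morse_class X e (\<lambda>t. cayley_translate G k (a t))" if "k \<in> carrier G" for k
    using act_class[OF that a(1) am asymptotic_refl[OF am]] a(2) by simp
  have "(\<lambda>t. cayley_translate G h (a t)) \<in> {0..} \<rightarrow> mspace X" using am translate_mem[OF h] by auto
  then have "boundary_map X e (cayley_translate G g) (morse_class X e (\<lambda>t. cayley_translate G h (a t)))
      = morse_class X e (\<lambda>t. cayley_translate G g (cayley_translate G h (a t)))"
    by (rule boundary_map_class[OF translate_qi_pair[OF g]])
      (rule morse_class_image_nonempty[OF translate_qi_pair[OF h] proper_X geodesic_X e_X e_X a(1)])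
  then show ?thesis using g h cl[OF h] cl[of "g \<otimes> h"] by (simp add: act_eq_boundary_map
      translate_translate)
qed

lemma act_inverse:
  assumes g: "g \<in> carrier G" and x: "x \<in> topspace bdry"
  shows "act g (act (inv g) x) = x"
  using boundary_map_inverse[OF translate_qi_pair[OF inv_closed[OF g]] proper_X geodesic_X e_X e_X x] g
  by (simp add: act_eq_boundary_map)

text \<open>The bounds of the two rays and of the line are enlarged to a common
  \<open>B\<close>.\<close>

lemma component_two_rays:
  assumes C: "C \<in> nonsingleton_components bdry" and x: "x \<in> C"
  obtains a b Q B where "morse_ray_from X e B a" "morse_ray_from X e B b" "morse_class X e a = x"
      "morse_class X e b \<in> C"
    "Q \<ge> 0" "quasi_geodesic X 3 Q UNIV (two_ended a b)" "morse_on X B UNIV (two_ended a b)"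
proof -
  have sub: "C \<subseteq> topspace bdry" "\<not> is_singleton C"
    using C connected_components_of_subset by (auto simp: nonsingleton_components_def)
  obtain y where y: "y \<in> C" "y \<noteq> x" using sub(2) x by (metis is_singletonI' empty_iff)
  obtain Ba a where a: "morse_ray_from X e Ba a" "x = morse_class X e a"
    using subsetD[OF sub(1) x] by (auto simp: in_topspace_morse_boundary)
  obtain Bb b where b: "morse_ray_from X e Bb b" "y = morse_class X e b"
    using subsetD[OF sub(1) y(1)] unfolding in_topspace_morse_boundary by blast
  define B0 where "B0 = (\<lambda>q Q. max (Ba q Q) (Bb q Q))"
  have ab: "morse_ray_from X e B0 a" "morse_ray_from X e B0 b"
    using morse_ray_from_mono[OF a(1), of B0] morse_ray_from_mono[OF b(1), of B0] by (auto simp: B0_def)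
  have "\<not> asymptotic X a b"
    using morse_class_cong[OF _ morse_ray_from_mem[OF a(1)] morse_ray_from_mem[OF b(1)]] a(2) b(2)
        y(2) by metis
  then obtain Q B1 where Q: "Q \<ge> 0" "quasi_geodesic X 3 Q UNIV (two_ended a b)" "morse_on X B1 UNIV
      (two_ended a b)"
    using morse_line[OF geodesic_X ab] by blast
  define B where "B = (\<lambda>q Q. max (B0 q Q) (B1 q Q))"
  have "morse_ray_from X e B a" "morse_ray_from X e B b"
    using morse_ray_from_mono[OF ab(1), of B] morse_ray_from_mono[OF ab(2), of B] by (auto simp: B_def)
  moreover have "morse_on X B UNIV (two_ended a b)" using Q(3) by (rule morse_on_mono) (simp add: B_def)
  ultimately show ?thesis using that a(2) b(2) y(1) Q by blast
qed

text \<open>Translating the line between two points of \<open>C\<close> by the inverses of the elements along the ray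
  towards one of them, the limits of the two ends are distinct. So point-convergence leaves only
  finitely many translates of \<open>C\<close>, and the ray stays close to finitely many cosets of the stabiliser.\<close>

lemma component_subset_relative_boundary:
  assumes C: "C \<in> nonsingleton_components bdry"
    and uniq: "\<And>A \<xi> \<eta> x y. inj (A :: nat \<Rightarrow> _) \<Longrightarrow> range A \<subseteq> nonsingleton_components bdry \<Longrightarrow>
      (\<And>n. \<xi> n \<in> A n) \<Longrightarrow> limitin bdry \<xi> x sequentially \<Longrightarrow>
      (\<And>n. \<eta> n \<in> A n) \<Longrightarrow> limitin bdry \<eta> y sequentially \<Longrightarrow> x = y"
  shows "C \<subseteq> relative_group_boundary G S (component_stabiliser G S C)"
proof
  fix x assume x: "x \<in> C"
  have sub: "C \<subseteq> topspace bdry" using C connected_components_of_subset by (auto simp: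
      nonsingleton_components_def)
  obtain a b Q B where ab: "morse_ray_from X e B a" "morse_ray_from X e B b" "morse_class X e a = x"
      "morse_class X e b \<in> C"
    and Q: "Q \<ge> 0" "quasi_geodesic X 3 Q UNIV (two_ended a b)" "morse_on X B UNIV (two_ended a b)"
    by (rule component_two_rays[OF C x])
  define \<sigma> where "\<sigma> = two_ended a b"
  have ag: "geodesic_ray X a" "a 0 = e" "b 0 = e" using ab by (auto simp: morse_ray_from_def)
  note am = geodesic_rayD[OF ag(1)]
  have \<sigma>a: "\<sigma> t = a t" if "t \<ge> 0" for t using that by (simp add: \<sigma>_def two_ended_def)
  have \<sigma>b: "\<sigma> (- t) = b t" if "t \<ge> 0" for t using that ag by (auto simp: \<sigma>_def two_ended_def)
  note \<sigma>q = Q(2)[folded \<sigma>_def] and \<sigma>M = Q(3)[folded \<sigma>_def]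
  have \<sigma>m: "\<sigma> t \<in> mspace X" for t using quasi_geodesic_mem[OF \<sigma>q] by simp
  have "\<exists>g\<in>carrier G. mdist X (cayley_vertex g) (a (real n)) \<le> 1" for n :: nat using near_vertex[OF
      am(1)] by simp
  then obtain g where g: "\<And>n. g n \<in> carrier G" "\<And>n. mdist X (cayley_vertex (g n)) (a (real n)) \<le> 1"
      by metis
  define A where "A n = act (inv (g n)) ` C" for n
  have A: "A n \<in> nonsingleton_components bdry" for n
    unfolding A_def using g(1) by (intro nonsingleton_components_homeomorphic[OF act_homeomorphic
        C]) auto
  have fin: "finite (range A)"
  proof (rule ccontr)
    assume "infinite (range A)"
    then obtain F :: "nat \<Rightarrow> _" where F: "inj F" "range F \<subseteq> range A"
      using infinite_countable_subset[of "range A"] by blast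
    have "\<forall>n. \<exists>m. A m = F n" using F(2) by (metis image_iff rangeI subsetD)
    then obtain \<nu> where \<nu>: "\<And>n. A (\<nu> n) = F n" by metis
    \<comment> \<open>Besides the translation, the parameter is shifted so that time 0 corresponds
      to \<open>a (real (\<nu> n))\<close>, which is near \<open>g (\<nu> n)\<close>. So
      \<open>\<sigma>' n 0\<close> is near the identity.\<close>
    define \<sigma>' where "\<sigma>' n t = cayley_translate G (inv (g (\<nu> n))) (\<sigma> (real (\<nu> n) + t))" for n t
    have q': "quasi_geodesic X (1 * 3) (1 * Q + 3 * 0) UNIV (\<sigma>' n)" for n
      unfolding \<sigma>'_def
      by (rule quasi_geodesic_image[OF translate_qi_pair quasi_geodesic_shift[OF \<sigma>q]]) (use g(1)
          Q(1) in auto)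
    have M': "morse_on X (image_bound 1 0 B) UNIV (\<sigma>' n)" for n
      unfolding \<sigma>'_def
      by (rule morse_on_image[OF translate_qi_pair morse_on_shift[OF \<sigma>M]]) (use g(1) \<sigma>m in auto)
    have near: "mdist X e (\<sigma>' n 0) \<le> 1" for n
    proof -
      define k where "k = g (\<nu> n)"
      have k: "k \<in> carrier G" using g by (simp add: k_def)
      have "e = cayley_translate G (inv k) (cayley_vertex k)" using k by (simp add:
          cayley_translate_vertex[OF grp])
      then show ?thesis
        using translate_mdist[of "inv k" "cayley_vertex k" "a (real (\<nu> n))"] k g(2)[of "\<nu> n"]
            vertex_in_X am(1)
        by (simp add: \<sigma>'_def \<sigma>a k_def)
    qed
    have q3: "1 * 3 \<ge> (1::real)" "1 * Q + 3 * 0 \<ge> 0" using Q(1) by auto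
    obtain \<rho> x' y' where \<rho>: "strict_mono (\<rho> :: nat \<Rightarrow> nat)" "x' \<noteq> y'"
      and lims: "limitin bdry (\<lambda>n. morse_class X e (\<sigma>' (\<rho> n))) x' sequentially"
        "limitin bdry (\<lambda>n. morse_class X e (\<lambda>t. \<sigma>' (\<rho> n) (- t))) y' sequentially"
      using morse_lines_limits[where \<sigma> = \<sigma>', OF proper_X geodesic_X q3 zero_le_one e_X q' M' near]
          by blast
    have shift: "mdist X (\<sigma> (r + t)) (\<sigma> t) \<le> 3 * \<bar>r\<bar> + Q" for r t
      using quasi_geodesic_upper[OF \<sigma>q, of "r + t" t] by simp
    have in1: "morse_class X e (\<sigma>' n) \<in> A (\<nu> n)" for n
    proof -
      \<comment> \<open>For a fixed \<open>n\<close> the shift of the parameter moves points by a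
        bounded amount and does not change the end of the line.\<close>
      have "asymptotic X (\<lambda>t. \<sigma> (real (\<nu> n) + t)) a"
        using shift[of "real (\<nu> n)"] by (intro fellow_imp_asymptotic[of X "3 * \<bar>real (\<nu> n)\<bar> + Q"]
            fellow_pointwise) (metis \<sigma>a)
      then have "morse_class X e (\<sigma>' n) = act (inv (g (\<nu> n))) (morse_class X e a)"
        unfolding \<sigma>'_def using g(1) \<sigma>m by (intro act_class[OF _ ab(1)]) auto
      then show ?thesis using ab(3) x by (simp add: A_def)
    qed
    have in2: "morse_class X e (\<lambda>t. \<sigma>' n (- t)) \<in> A (\<nu> n)" for n
    proof -
      have "asymptotic X (\<lambda>t. \<sigma> (real (\<nu> n) + - t)) b"
        using shift[of "real (\<nu> n)"] by (intro fellow_imp_asymptotic[of X "3 * \<bar>real (\<nu> n)\<bar> + Q"]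
            fellow_pointwise) (metis \<sigma>b)
      then have "morse_class X e (\<lambda>t. \<sigma>' n (- t)) = act (inv (g (\<nu> n))) (morse_class X e b)"
        unfolding \<sigma>'_def using g(1) \<sigma>m by (intro act_class[OF _ ab(2)]) auto
      then show ?thesis using ab(4) by (simp add: A_def)
    qed
    have "inj (\<lambda>n. A (\<nu> (\<rho> n)))"
      unfolding \<nu> using inj_compose[OF F(1) strict_mono_imp_inj_on[OF \<rho>(1)]] by (simp add: comp_def)
    moreover have "range (\<lambda>n. A (\<nu> (\<rho> n))) \<subseteq> nonsingleton_components bdry" using A by auto
    ultimately show False using uniq[OF _ _ in1 lims(1) in2 lims(2)] \<rho>(2) by blast
  qed
  \<comment> \<open>Finitely many indices that represent all translates of \<open>C\<close>;
    \<open>K\<close> is the largest distance of the corresponding inverses from the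
    identity.\<close>
  obtain R where R: "finite R" "range A = A ` R" using finite_subset_image[OF fin order_refl] by blast
  define K where "K = Max (insert 0 ((\<lambda>m. mdist X (cayley_vertex (inv (g m))) e) ` R))"
  have K: "mdist X (cayley_vertex (inv (g m))) e \<le> K" if "m \<in> R" for m
    unfolding K_def using R(1) that by (intro Max_ge) auto
  have near: "\<exists>h\<in>component_stabiliser G S C. mdist X (a t) (cayley_vertex h) \<le> K + 2" if t: "t \<ge> 0"
      for t
  proof -
    define n where "n = nat \<lfloor>t\<rfloor>"
    have n: "\<bar>t - real n\<bar> \<le> 1" using t by (simp add: n_def) linarith
    obtain m where m: "m \<in> R" "A n = A m" using R(2) by (metis image_iff rangeI)
    \<comment> \<open>From \<open>A n = A m\<close> it follows that \<open>h\<close> maps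
      \<open>C\<close> to itself. Its distance from \<open>g n\<close> is that of
      \<open>inv (g m)\<close> from the identity. Rounding \<open>t\<close> and passing from
      \<open>a (real n)\<close> to \<open>g n\<close> cost 1 each.\<close>
    define h where "h = g n \<otimes> inv (g m)"
    have h: "h \<in> carrier G" using g(1) by (simp add: h_def)
    have "act h ` C = act (g n) ` A m"
      unfolding A_def image_image h_def using act_act[OF g(1)[of n] inv_closed[OF g(1)[of m]]] sub
          by (intro image_cong) auto
    also have "\<dots> = C"
    proof -
      have "act (g n) (act (inv (g n)) y) = y" if "y \<in> C" for y using act_inverse[OF g(1)] sub that
          by blast
      then show ?thesis unfolding m(2)[symmetric] unfolding A_def image_image by simp
    qed
    finally have hH: "h \<in> component_stabiliser G S C" using h by (simp add: stabilizer_def)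
    have vh: "cayley_vertex h = cayley_translate G (g n) (cayley_vertex (inv (g m)))"
      "cayley_vertex (g n) = cayley_translate G (g n) e"
      using g(1) by (simp_all add: cayley_translate_vertex[OF grp] h_def)
    have "mdist X (cayley_vertex (g n)) (cayley_vertex h) \<le> K"
      unfolding vh using K[OF m(1)] g(1) by (subst translate_mdist) (auto simp: vertex_in_X
          mdist_commute[of X e])
    moreover have "mdist X (a t) (cayley_vertex h) \<le> mdist X (a t) (a (real n)) +
        mdist X (a (real n)) (cayley_vertex (g n)) + mdist X (cayley_vertex (g n)) (cayley_vertex h)"
      using am(1) t g(1) h by (intro mdist_triangle4 vertex_in_X) auto
    ultimately have "mdist X (a t) (cayley_vertex h) \<le> K + 2"
      using am(2)[OF t, of "real n"] n g(2)[of n] by (simp add: mdist_commute[of X "a (real n)"])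
    then show ?thesis using hH by blast
  qed
  have Hsub: "cayley_vertex ` component_stabiliser G S C \<subseteq> mspace X" by (auto simp: stabilizer_def
      vertex_in_X)
  have "a t \<in> closed_nbhd X (K + 2) (cayley_vertex ` component_stabiliser G S C)" if "t \<ge> 0" for t
    unfolding closed_nbhd_iff[OF Hsub] using near[OF that] am(1)[OF that] by force
  then have "a ` {0..} \<subseteq> closed_nbhd X (K + 2) (cayley_vertex ` component_stabiliser G S C)" by auto
  moreover have "morse_geodesic_ray X a" using ab(1) morse_geodesic_ray_iff[of X a e] by blast
  ultimately show "x \<in> relative_group_boundary G S (component_stabiliser G S C)"
    using ab(3) unfolding relative_morse_boundary_def by blast
qed

text \<open>A Morse ray near the stabiliser is approached by translates of a line between two points of
  \<open>C\<close>, hence it represents a limit of points of \<open>C\<close>, which is closed.\<close>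

lemma relative_boundary_subset_component:
  assumes C: "C \<in> nonsingleton_components bdry"
  shows "relative_group_boundary G S (component_stabiliser G S C) \<subseteq> C"
proof
  fix z assume "z \<in> relative_group_boundary G S (component_stabiliser G S C)"
  then obtain \<gamma>0 k where \<gamma>0: "z = morse_class X e \<gamma>0" "morse_geodesic_ray X \<gamma>0"
    and k: "\<gamma>0 ` {0..} \<subseteq> closed_nbhd X k (cayley_vertex ` component_stabiliser G S C)"
    by (auto simp: relative_morse_boundary_def)
  have comp: "C \<in> connected_components_of bdry" using C by (simp add: nonsingleton_components_def)
  obtain x where x: "x \<in> C" using nonempty_connected_components_of[OF comp] by blast
  obtain a b Q B where ab: "morse_ray_from X e B a" "morse_ray_from X e B b" "morse_class X e a = x"
      "morse_class X e b \<in> C"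
    and Q: "Q \<ge> 0" "quasi_geodesic X 3 Q UNIV (two_ended a b)" "morse_on X B UNIV (two_ended a b)"
    by (rule component_two_rays[OF C x])
  define \<sigma> where "\<sigma> = two_ended a b"
  have ag: "geodesic_ray X a" "geodesic_ray X b" "a 0 = e" "b 0 = e" using ab by (auto simp:
      morse_ray_from_def)
  have \<sigma>a: "\<sigma> t = a t" if "t \<ge> 0" for t using that by (simp add: \<sigma>_def two_ended_def)
  have \<sigma>b: "\<sigma> (- t) = b t" if "t \<ge> 0" for t using that ag by (auto simp: \<sigma>_def two_ended_def)
  note \<sigma>q = Q(2)[folded \<sigma>_def] and \<sigma>M = Q(3)[folded \<sigma>_def]
  have \<sigma>m: "\<sigma> t \<in> mspace X" for t using quasi_geodesic_mem[OF \<sigma>q] by simp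
  have Hsub: "cayley_vertex ` component_stabiliser G S C \<subseteq> mspace X" by (auto simp: stabilizer_def
      vertex_in_X)
  obtain B0 where B0: "morse_ray_from X (\<gamma>0 0) B0 \<gamma>0" using morse_geodesic_ray_iff[of X \<gamma>0 "\<gamma>0 0"]
      \<gamma>0(2) by blast
  have \<gamma>0g: "geodesic_ray X \<gamma>0" "morse_on X B0 {0..} \<gamma>0" using B0 by (auto simp: morse_ray_from_def)
  note \<gamma>0m = geodesic_rayD[OF \<gamma>0g(1)]
  obtain B1 D \<gamma> where \<gamma>: "morse_ray_from X e B1 \<gamma>" "fellow X D \<gamma> \<gamma>0"
    by (rule morse_ray_realisation[OF proper_X geodesic_X geodesic_ray_quasi_geodesic[OF \<gamma>0g(1)] \<gamma>0g(2)
          order_refl order_refl mdist_nonneg order_refl e_X])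
  note \<gamma>m = morse_ray_from_mem[OF \<gamma>(1)]
  have z: "z = morse_class X e \<gamma>"
    unfolding \<gamma>0(1) using morse_class_cong[OF fellow_imp_asymptotic[OF \<gamma>(2)] \<gamma>m \<gamma>0m(3)] by simp
  define K where "K = \<bar>D\<bar> + \<bar>k\<bar> + 1"
  have near: "\<exists>h\<in>component_stabiliser G S C. mdist X (cayley_vertex h) (\<gamma> t) \<le> K" if t: "t \<ge> 0" for t
  proof -
    obtain u where u: "u \<ge> 0" "mdist X (\<gamma> t) (\<gamma>0 u) \<le> D" using \<gamma>(2) t by (auto simp: fellow_def)
    have "\<gamma>0 u \<in> closed_nbhd X k (cayley_vertex ` component_stabiliser G S C)" using k u by auto
    then obtain h where h: "h \<in> component_stabiliser G S C" "mdist X (\<gamma>0 u) (cayley_vertex h) < k + 1"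
      unfolding closed_nbhd_iff[OF Hsub] using zero_less_one by blast
    have "mdist X (cayley_vertex h) (\<gamma> t) \<le> K"
      using mdist_triangle[of "\<gamma> t" X "\<gamma>0 u" "cayley_vertex h"] h u t Pi_mem[OF \<gamma>m, of t] \<gamma>0m(1)[of
          u] subsetD[OF Hsub imageI[OF h(1)]]
      by (auto simp: K_def mdist_commute[of X "cayley_vertex h"])
    then show ?thesis using h by blast
  qed
  have K: "0 \<le> K" by (simp add: K_def)
  \<comment> \<open>A common bound for the ray and for all translates of the line, as
    \<open>morse_line_approach\<close> expects.\<close>
  define B2 where "B2 = (\<lambda>q Q. max (B1 q Q) (image_bound 1 0 B q Q))"
  have \<gamma>2: "morse_ray_from X e B2 \<gamma>" by (rule morse_ray_from_mono[OF \<gamma>(1)]) (simp add: B2_def)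
  have q3: "1 * 3 \<ge> (1::real)" "1 * Q + 3 * 0 \<ge> 0" using Q(1) by auto
  obtain B3 K' where appr: "\<And>\<sigma> n. quasi_geodesic X (1 * 3) (1 * Q + 3 * 0) UNIV \<sigma> \<Longrightarrow> morse_on X B2
      UNIV \<sigma> \<Longrightarrow> n \<ge> 0 \<Longrightarrow>
      mdist X (\<sigma> 0) (\<gamma> n) \<le> K \<Longrightarrow>
    \<exists>c. morse_ray_from X e B3 c \<and> (asymptotic X c \<sigma> \<or> asymptotic X c (\<lambda>t. \<sigma> (- t))) \<and>
       (\<forall>t. 0 \<le> t \<and> t \<le> n - K' \<longrightarrow> mdist X (\<gamma> t) (c t) \<le> K')"
    using morse_line_approach[OF proper_X geodesic_X q3 K \<gamma>2] by blast
  have close: "\<exists>c. morse_ray_from X e B3 c \<and> morse_class X e c \<in> C \<and> (\<forall>t. 0 \<le> t \<and> t \<le> n - K' \<longrightarrow> mdist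
      X (\<gamma> t) (c t) \<le> K')"
    if n: "n \<ge> 0" for n
  proof -
    obtain h where h: "h \<in> component_stabiliser G S C" "mdist X (cayley_vertex h) (\<gamma> n) \<le> K" using
        near[OF n] by blast
    have hG: "h \<in> carrier G" "act h ` C = C" using h(1) by (auto simp: stabilizer_def)
    define \<sigma>' where "\<sigma>' t = cayley_translate G h (\<sigma> t)" for t
    have \<sigma>'m: "\<sigma>' t \<in> mspace X" for t using translate_mem[OF hG(1) \<sigma>m] by (simp add: \<sigma>'_def)
    have q': "quasi_geodesic X (1 * 3) (1 * Q + 3 * 0) UNIV \<sigma>'"
      unfolding \<sigma>'_def by (rule quasi_geodesic_image[OF translate_qi_pair[OF hG(1)] \<sigma>q]) (use Q(1)
          in auto)
    have "morse_on X (image_bound 1 0 B) UNIV \<sigma>'"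
      unfolding \<sigma>'_def by (rule morse_on_image[OF translate_qi_pair[OF hG(1)] \<sigma>M]) (use \<sigma>m in auto)
    then have M': "morse_on X B2 UNIV \<sigma>'" by (rule morse_on_mono) (simp add: B2_def)
    have "\<sigma>' 0 = cayley_vertex h" using hG(1) by (simp add: \<sigma>'_def \<sigma>a ag cayley_translate_vertex[OF
        grp])
    then obtain c where c: "morse_ray_from X e B3 c" "asymptotic X c \<sigma>' \<or> asymptotic X c (\<lambda>t. \<sigma>' (- t))"
      "\<forall>t. 0 \<le> t \<and> t \<le> n - K' \<longrightarrow> mdist X (\<gamma> t) (c t) \<le> K'"
      using appr[OF q' M' n] h(2) by auto
    have refl: "mdist X (\<sigma> t) (\<sigma> t) \<le> 0" for t using \<sigma>m by simp
    have "asymptotic X \<sigma> a"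
      by (intro fellow_imp_asymptotic[of X 0] fellow_pointwise) (metis \<sigma>a refl)
    then have ca: "morse_class X e \<sigma>' = act h x"
      unfolding \<sigma>'_def using \<sigma>m ab(3) act_class[OF hG(1) ab(1), of \<sigma>] by auto
    have "asymptotic X (\<lambda>t. \<sigma> (- t)) b"
      by (intro fellow_imp_asymptotic[of X 0] fellow_pointwise) (metis \<sigma>b refl)
    then have cb: "morse_class X e (\<lambda>t. \<sigma>' (- t)) = act h (morse_class X e b)"
      unfolding \<sigma>'_def using \<sigma>m act_class[OF hG(1) ab(2), of "\<lambda>t. \<sigma> (- t)"] by auto
    \<comment> \<open>Whichever end of the translated line is reached, it is the image under
      \<open>h\<close> of a point of \<open>C\<close>.\<close>
    have "morse_class X e c = morse_class X e \<sigma>' \<or> morse_class X e c = morse_class X e (\<lambda>t. \<sigma>' (- t))"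
      using c(2) morse_class_cong[OF _ morse_ray_from_mem[OF c(1)]] \<sigma>'m by (metis Pi_I)
    then have "morse_class X e c \<in> act h ` C" using ca cb x ab(4) by auto
    then show ?thesis using c hG(2) by auto
  qed
  show "z \<in> C"
  proof (rule ccontr)
    assume "z \<notin> C"
    define U where "U = topspace bdry - C"
    have "openin bdry U" unfolding U_def using closedin_connected_components_of[OF comp] by (simp
        add: closedin_def)
    moreover define B4 where "B4 = (\<lambda>q Q. max (B2 q Q) (B3 q Q))"
    have \<gamma>4: "morse_ray_from X e B4 \<gamma>" by (rule morse_ray_from_mono[OF \<gamma>2]) (simp add: B4_def)
    moreover have "morse_class X e \<gamma> \<in> U"
      using \<gamma>4 z \<open>z \<notin> C\<close> unfolding U_def by (auto simp: in_topspace_morse_boundary)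
    ultimately obtain k :: nat where k: "\<And>c. morse_ray_from X e B4 c \<Longrightarrow> \<forall>t\<in>{0..real k}. mdist X (\<gamma> t)
        (c t) \<le> K' \<Longrightarrow> morse_class X e c \<in> U"
      unfolding openin_morse_boundary_iff by blast
    \<comment> \<open>Taking the line near time \<open>k + \<bar>K'\<bar>\<close> leaves closeness
      on all of \<open>[0, k]\<close> after the loss of \<open>K'\<close>.\<close>
    obtain c where c: "morse_ray_from X e B3 c" "morse_class X e c \<in> C"
      "\<forall>t. 0 \<le> t \<and> t \<le> (real k + \<bar>K'\<bar>) - K' \<longrightarrow> mdist X (\<gamma> t) (c t) \<le> K'" using close[of "real k +
          \<bar>K'\<bar>"] by auto
    have "morse_ray_from X e B4 c" by (rule morse_ray_from_mono[OF c(1)]) (simp add: B4_def)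
    moreover have "\<forall>t\<in>{0..real k}. mdist X (\<gamma> t) (c t) \<le> K'" using c(3) by auto
    ultimately show False using k c(2) by (auto simp: U_def)
  qed
qed

end

theorem corollary1p2:
  fixes G :: "('a, 'm) monoid_scheme" and S :: "'a set"
    and G' :: "('b, 'n) monoid_scheme" and S' :: "'b set"
  assumes "group G" and "finite_generating_set G S"
    and "point_convergent (group_morse_boundary G S)
           (nonsingleton_components (group_morse_boundary G S))"
    and "group G'" and "finite_generating_set G' S'"
    and "quasi_isometric (cayley_graph G' S') (cayley_graph G S)"
    and "C' \<in> nonsingleton_components (group_morse_boundary G' S')"
  shows "relative_group_boundary G' S' (component_stabiliser G' S' C') = C'"
proof -
  interpret G: cayley G S using assms(1,2) by (rule cayley.intro)
  interpret G': cayley G' S' using assms(4,5) by (rule cayley.intro)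
  obtain f g q Q where "qi_pair (cayley_graph G' S') (cayley_graph G S) f g q Q"
    using quasi_isometric_imp_qi_pair[OF assms(6)] .
  \<comment> \<open>The map goes from the boundary of \<open>G'\<close> to that of \<open>G\<close>,
    so components of the former are sent to where point-convergence is assumed.\<close>
  from homeomorphic_boundary_map[OF this G'.proper_X G'.geodesic_X G.proper_X G.geodesic_X G'.e_X G.e_X]
  have hom: "homeomorphic_map (group_morse_boundary G' S') (group_morse_boundary G S)
      (boundary_map (cayley_graph G S) (cayley_vertex \<one>\<^bsub>G\<^esub>) f)" .
  show ?thesis
  proof
    show "relative_group_boundary G' S' (component_stabiliser G' S' C') \<subseteq> C'"
      by (rule G'.relative_boundary_subset_component[OF assms(7)])
    show "C' \<subseteq> relative_group_boundary G' S' (component_stabiliser G' S' C')"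
    proof (rule G'.component_subset_relative_boundary[OF assms(7)])
      fix A \<xi> \<eta> x y
      assume *: "inj (A :: nat \<Rightarrow> _)" "range A \<subseteq> nonsingleton_components (group_morse_boundary G' S')"
        "\<And>n. \<xi> n \<in> A n" "limitin (group_morse_boundary G' S') \<xi> x sequentially"
        "\<And>n. \<eta> n \<in> A n" "limitin (group_morse_boundary G' S') \<eta> y sequentially"
      show "x = y" by (rule point_convergent_unique_limit[OF hom assms(3) *])
    qed
  qed
qed

end
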